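(* Let $g:\overline{\mathbb{D}}\to\mathbb{C}$ be continuous, let $\psi\in L^{1}(\mathbb{T})$ be bounded, and let $f\in\mathcal{C}^{2}(\mathbb{D})$ satisfy $\Delta f=g$ in $\mathbb{D}$ and $f|_{\mathbb{T}}=\psi$. For $x\in(0,1)$ put $$\mu(x)=\frac{\|g\|_{\infty}(1-x^{2})}{8x^{2}}\left[\frac{1+x^{2}}{1-x^{2}}-\frac{1-x^{2}}{2x}\log\frac{1+x}{1-x}\right].$$ Then for every $z\in\mathbb{D}\setminus\{0\}$, $$\|D_{f}(z)\|\leq\frac{4\|\mathcal{P}_{\psi}\|_{\infty}}{\pi}\,\frac{1}{1-|z|^{2}}+2\mu(|z|),$$ where $\frac{\|g\|_{\infty}}{4}\leq\mu(|z|)\leq\frac{\|g\|_{\infty}}{3}$ and $\mu(|z|)$ is decreasing in $|z|\in(0,1)$. In particular, at $z=0$, $$\|D_{f}(0)\|\leq\lim_{|z|\rightarrow0^{+}}\left(\frac{4\|\mathcal{P}_{\psi}\|_{\infty}}{\pi}\,\frac{1}{1-|z|^{2}}+2\mu(|z|)\right)=\frac{4}{\pi}\|\mathcal{P}_{\psi}\|_{\infty}+\frac{2}{3}\|g\|_{\infty}.$$ Moreover, if $\|g\|_{\infty}=0$, both estimates are sharp, as shown by the functions $$f(z)=\frac{2M\alpha}{\pi}\arg\left(\frac{1+\phi(z)}{1-\phi(z)}\right),$$ where $|\alpha|=1$ and $M>0$ are constants and $\phi$ is a conformal automorphism of $\mathbb{D}$: for every $z_{0}\in\mathbb{D}$ there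 is a choice of $\phi$ such that equality holds at $z_{0}$ in the corresponding estimate for this $f$.
   Context: $\mathbb{D}=\{z\in\mathbb{C}:|z|<1\}$ and $\mathbb{T}=\partial\mathbb{D}$. $\mathcal{C}^{2}(\mathbb{D})$ is the set of complex-valued twice continuously differentiable functions on $\mathbb{D}$; $\Delta f=f_{xx}+f_{yy}$ for $z=x+iy$. $D_f$ is the real $2\times 2$ Jacobian matrix of $f=u+iv$, and $\|D_f\|=\sup\{|D_f\xi|:|\xi|=1\}=|f_z|+|f_{\overline z}|$, with $f_z=\frac12(f_x-if_y)$, $f_{\overline z}=\frac12(f_x+if_y)$. For bounded $\psi\in L^1(\mathbb{T})$, $$\mathcal{P}_{\psi}(z)=\frac{1}{2\pi}\int_{0}^{2\pi}P(z,e^{it})\psi(e^{it})\,dt,\qquad P(z,e^{it})=\frac{1-|z|^{2}}{|1-ze^{-it}|^{2}},\quad z\in\mathbb{D},$$ and for continuous $g$, $$\mathcal{G}_{g}(z)=\frac{1}{2\pi}\int_{\mathbb{D}}G(z,w)g(w)\,dA(w),\qquad G(z,w)=\log\left|\frac{1-z\overline{w}}{z-w}\right|,$$ where $dA$ is Lebesgue area measure. The statement that $f$ satisfies $\Delta f=g$ with boundary condition $f|_{\mathbb{T}}=\psi$ means that $f=\mathcal{P}_{\psi}-\mathcal{G}_{g}$ in $\mathbb{D}$. Norms: $\|\mathcal{P}_{\psi}\|_{\infty}=\sup_{z\in\mathbb{D}}|\mathcal{P}_{\psi}(z)|$ and $\|g\|_{\infty}=\sup_{z\in\mathbb{D}}|g(z)|$.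 $\arg$ denotes the principal argument (here with values in $(-\pi/2,\pi/2)$). *)

theory Defs
  imports "HOL-Complex_Analysis.Complex_Analysis"
begin

text \<open>
  Functions on the circle are represented by total functions on \<^typ>\<open>complex\<close> whose values off
  the circle play no role. Members of \<open>L\<^sup>1\<close> are classes modulo null sets, so boundedness
  is required almost everywhere.
\<close>

definition bounded_L1_circle :: "(complex \<Rightarrow> complex) \<Rightarrow> bool" where
  "bounded_L1_circle \<psi> \<longleftrightarrow>
     set_integrable lebesgue {0..2*pi} (\<lambda>t. \<psi> (cis t)) \<and>
     (\<exists>B. AE t\<in>{0..2*pi} in lebesgue. norm (\<psi> (cis t)) \<le> B)"

definition poisson_kernel :: "complex \<Rightarrow> complex \<Rightarrow> real" where
  "poisson_kernel z \<zeta> = (1 - (norm z)\<^sup>2) / (norm (1 - z * cnj \<zeta>))\<^sup>2"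

definition poisson_integral :: "(complex \<Rightarrow> complex) \<Rightarrow> complex \<Rightarrow> complex" where
  "poisson_integral \<psi> z =
     (1 / (2*pi)) *\<^sub>R (LINT t:{0..2*pi}|lebesgue. poisson_kernel z (cis t) *\<^sub>R \<psi> (cis t))"

text \<open>The junk value on the diagonal \<open>w = z\<close> affects only a null set of the integration below.\<close>

definition green :: "complex \<Rightarrow> complex \<Rightarrow> real" where
  "green z w = ln (norm ((1 - z * cnj w) / (z - w)))"

definition green_potential :: "(complex \<Rightarrow> complex) \<Rightarrow> complex \<Rightarrow> complex" where
  "green_potential g z = (1 / (2*pi)) *\<^sub>R (LINT w:ball 0 1|lebesgue. green z w *\<^sub>R g w)"

text \<open>
  The meaning of ``\<open>\<Delta>f = g\<close> in the unit disc with boundary values \<open>\<psi>\<close>'': the boundary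
  condition for a merely bounded integrable \<open>\<psi>\<close> is understood through the
  Poisson--Green representation.
\<close>

definition solves_poisson_dirichlet ::
    "(complex \<Rightarrow> complex) \<Rightarrow> (complex \<Rightarrow> complex) \<Rightarrow> (complex \<Rightarrow> complex) \<Rightarrow> bool" where
  "solves_poisson_dirichlet f g \<psi> \<longleftrightarrow>
     (\<forall>z\<in>ball 0 1. f z = poisson_integral \<psi> z - green_potential g z)"

text \<open>Derivatives are real derivatives, with \<open>\<complex>\<close> viewed as the real plane.\<close>

definition partial_x :: "(complex \<Rightarrow> complex) \<Rightarrow> complex \<Rightarrow> complex" where
  "partial_x f z = frechet_derivative f (at z) 1"

definition partial_y :: "(complex \<Rightarrow> complex) \<Rightarrow> complex \<Rightarrow> complex" where
  "partial_y f z = frechet_derivative f (at z) \<i>"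

definition C1_on :: "complex set \<Rightarrow> (complex \<Rightarrow> complex) \<Rightarrow> bool" where
  "C1_on S f \<longleftrightarrow> (\<forall>z\<in>S. f differentiable (at z)) \<and>
     continuous_on S (partial_x f) \<and> continuous_on S (partial_y f)"

definition C2_on :: "complex set \<Rightarrow> (complex \<Rightarrow> complex) \<Rightarrow> bool" where
  "C2_on S f \<longleftrightarrow> C1_on S f \<and> C1_on S (partial_x f) \<and> C1_on S (partial_y f)"

definition jacobian_norm :: "(complex \<Rightarrow> complex) \<Rightarrow> complex \<Rightarrow> real" where
  "jacobian_norm f z = onorm (frechet_derivative f (at z))"

definition disc_norm :: "(complex \<Rightarrow> complex) \<Rightarrow> real" where
  "disc_norm h = (SUP z\<in>ball 0 1. norm (h z))"

text \<open>The argument \<open>K\<close> stands for the supremum norm of the right-hand side \<open>g\<close>.\<close>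

definition mu :: "real \<Rightarrow> real \<Rightarrow> real" where
  "mu K x = K * (1 - x\<^sup>2) / (8 * x\<^sup>2) *
     ((1 + x\<^sup>2) / (1 - x\<^sup>2) - (1 - x\<^sup>2) / (2 * x) * ln ((1 + x) / (1 - x)))"

text \<open>The inverse of a bijective holomorphic map is automatically holomorphic.\<close>

definition disc_automorphism :: "(complex \<Rightarrow> complex) \<Rightarrow> bool" where
  "disc_automorphism \<phi> \<longleftrightarrow> \<phi> holomorphic_on ball 0 1 \<and> bij_betw \<phi> (ball 0 1) (ball 0 1)"

definition extremal :: "real \<Rightarrow> complex \<Rightarrow> (complex \<Rightarrow> complex) \<Rightarrow> complex \<Rightarrow> complex" where
  "extremal M \<alpha> \<phi> z =
     complex_of_real (2 * M) * \<alpha> / complex_of_real pi *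
     complex_of_real (Arg ((1 + \<phi> z) / (1 - \<phi> z)))"

end

theory Submission
  imports Defs "HOL-Real_Asymp.Real_Asymp"
begin

text \<open>
  Write \<open>f = P - G\<close> with \<open>P\<close> the Poisson integral and \<open>G\<close> the Green potential. Each real part
  \<open>Re (\<beta> P)\<close> with \<open>|\<beta>| = 1\<close> is the real part of a holomorphic function into a strip of width
  \<open>2 \<parallel>P\<parallel>\<close>, so the Schwarz--Pick lemma for the strip bounds the gradient of \<open>P\<close>.
  The gradient in \<open>z\<close> of Green's function has length \<open>(1 - |w|\<^sup>2) / (|z - w| |1 - cnj z w|)\<close>; the
  substitution \<open>w = (z - u) / (1 - cnj z u)\<close> followed by polar coordinates in \<open>u\<close> evaluates its integral
  over the disc as \<open>2 \<pi>\<close> times \<open>2 mu 1 |z|\<close>. Instead of differentiating \<open>G\<close> under the integral sign,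
  Tonelli's theorem turns the pointwise bound into a local Lipschitz bound for \<open>G\<close>, which is enough
  because \<open>G = P - f\<close> is known to be differentiable.
  For the extremal functions, the boundary function is a step function, and the Poisson
  representation is obtained as a limit over circles of radius \<open>r \<rightarrow> 1\<close>.
\<close>

subsection \<open>The radial function mu\<close>

text \<open>The constant \<open>4 / pi\<close> stems from the strip: an exponential of rate
  \<open>pi / (2 * M)\<close> turns a strip of width \<open>2 * M\<close> into a half-plane, and the
  resulting bound loses nothing exactly on the centre line of the strip. The extremal functions are
  built so that the prescribed point lands on that line; their norm cannot be below
  \<open>M\<close>, because the derivative they attain would then violate the bound. On the Green
  side, a Lipschitz bound near \<open>z\<close> sees the worst area integral in a neighbourhood, not
  the one at \<open>z\<close>. Continuity of that integral in \<open>z\<close> lets the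
  neighbourhood shrink. The formula for \<open>mu\<close> gives no meaningful value at
  \<open>0\<close>, so the estimate there is obtained directly from the area integral at
  \<open>0\<close>, which supplies \<open>2 / 3\<close>, and not as a limit of estimates at nearby
  points. On the Poisson side the boundary data are only essentially bounded, so every estimate runs
  through the values of the Poisson integral inside the disc.\<close>

lemma frac_eqI: "a * d = c * b \<Longrightarrow> b \<noteq> 0 \<Longrightarrow> d \<noteq> 0 \<Longrightarrow> a / b = c / (d :: real)"
  by (simp add: frac_eq_eq)

lemma inverse_add_inverse_one_minus:
  fixes t :: real
  assumes "0 < t" "t < 1"
  shows "1 / (1 + t) + 1 / (1 - t) = 2 / (1 - t\<^sup>2)"
proof -
  have "1 / (1 + t) + 1 / (1 - t) = (1 * (1 - t) + 1 * (1 + t)) / ((1 + t) * (1 - t))"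
    using assms by (intro add_frac_eq) auto
  also have "(1 + t) * (1 - t) = 1 - t\<^sup>2" by algebra
  finally show ?thesis by simp
qed

text \<open>The right-hand side is the value of the logarithm at which the derivative of
  \<open>mu 1\<close> would vanish, so this inequality is the monotonicity of \<open>mu\<close>. The
  difference \<open>q\<close> of the two sides vanishes at \<open>0\<close> and has a positive
  derivative.\<close>

lemma ln_quotient_less:
  fixes x :: real
  assumes "0 < x" "x < 1"
  shows "ln ((1 + x) / (1 - x)) < 2 * x * (3 - x\<^sup>2) / ((1 - x\<^sup>2) * (3 + x\<^sup>2))"
proof -
  define q where "q = (\<lambda>x::real. 2 * x * (3 - x\<^sup>2) / ((1 - x\<^sup>2) * (3 + x\<^sup>2)) - ln ((1 + x) / (1 - x)))"
  have "q 0 < q x"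
  proof (rule DERIV_pos_imp_increasing_open[OF assms(1)])
    fix t :: real assume t: "0 < t" "t < x"
    then have t1: "t < 1" using assms by simp
    have t2: "t\<^sup>2 < 1" using t t1 by (simp add: power_less_one_iff abs_square_less_1)
    have p: "0 < 3 + t\<^sup>2" by (simp add: add_pos_nonneg)
    let ?u = "1 - t\<^sup>2" and ?v = "3 + t\<^sup>2"
    have nz: "?u \<noteq> 0" "?v \<noteq> 0" using t2 p by auto
    have D: "(q has_real_derivative
        (((2 * (3 - t\<^sup>2) + 2 * t * (- 2 * t)) * (?u * ?v) - 2 * t * (3 - t\<^sup>2) * (- 2 * t * ?v + ?u * (2 * t)))
          / (?u * ?v)\<^sup>2 - (1 / (1 + t) + 1 / (1 - t)))) (at t)"
    proof -
      have "((\<lambda>x. 2 * x * (3 - x\<^sup>2) / ((1 - x\<^sup>2) * (3 + x\<^sup>2)) - (ln (1 + x) - ln (1 - x)))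
        has_real_derivative
        (((2 * (3 - t\<^sup>2) + 2 * t * (- 2 * t)) * (?u * ?v) - 2 * t * (3 - t\<^sup>2) * (- 2 * t * ?v + ?u * (2 * t)))
          / (?u * ?v)\<^sup>2 - (1 / (1 + t) + 1 / (1 - t)))) (at t)"
        using nz t t1 by (auto intro!: derivative_eq_intros simp: power2_eq_square)
      moreover have "\<forall>\<^sub>F x in nhds t. 2 * x * (3 - x\<^sup>2) / ((1 - x\<^sup>2) * (3 + x\<^sup>2)) - (ln (1 + x) - ln (1 - x)) = q x"
        using eventually_nhds_in_open[of "{0<..<1}" t] t t1
        by (auto elim!: eventually_mono simp: q_def ln_div)
      ultimately show ?thesis
        by (subst (asm) DERIV_cong_ev[OF refl _ refl])
    qed
    have "1 / (1 + t) + 1 / (1 - t) = 2 * ?u * ?v\<^sup>2 / (?u * ?v)\<^sup>2"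
    proof -
      have "1 / (1 + t) + 1 / (1 - t) = 2 / ?u"
        by (rule inverse_add_inverse_one_minus[OF t(1) t1])
      also have "\<dots> = 2 * ?u * ?v\<^sup>2 / (?u * ?v)\<^sup>2"
      proof -
        have "2 / u = 2 * u * v\<^sup>2 / (u * v)\<^sup>2" if "u \<noteq> 0" "v \<noteq> 0" for u v :: real
          using that by (simp add: power2_eq_square)
        then show ?thesis using nz by blast
      qed
      finally show ?thesis .
    qed
    then have "((2 * (3 - t\<^sup>2) + 2 * t * (- 2 * t)) * (?u * ?v) - 2 * t * (3 - t\<^sup>2) * (- 2 * t * ?v + ?u * (2 * t)))
          / (?u * ?v)\<^sup>2 - (1 / (1 + t) + 1 / (1 - t))
       = (((2 * (3 - t\<^sup>2) + 2 * t * (- 2 * t)) * (?u * ?v) - 2 * t * (3 - t\<^sup>2) * (- 2 * t * ?v + ?u * (2 * t)))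
          - 2 * ?u * ?v\<^sup>2) / (?u * ?v)\<^sup>2"
      by (simp add: diff_divide_distrib)
    \<comment> \<open>All other powers of \<open>t\<close> in the numerator cancel: the fraction
      agrees with the logarithm at \<open>0\<close> through order four.\<close>
    also have "\<dots> = 32 * t^4 / (?u * ?v)\<^sup>2"
      by (rule arg_cong[where f = "\<lambda>y. y / _"]) algebra
    finally have "(q has_real_derivative (32 * t^4 / (?u * ?v)\<^sup>2)) (at t)"
      using D by simp
    moreover have "32 * t^4 / (?u * ?v)\<^sup>2 > 0"
      using t nz by auto
    ultimately show "\<exists>y. (q has_real_derivative y) (at t) \<and> 0 < y" by blast
  next
    have "t\<^sup>2 < 1" if "0 \<le> t" "t \<le> x" for t
      using that assms by (simp add: power_less_one_iff abs_square_less_1)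
    moreover have "3 + t\<^sup>2 > 0" for t :: real by (simp add: add_pos_nonneg)
    ultimately show "continuous_on {0..x} q" unfolding q_def using assms
      by (intro continuous_intros) (force simp: less_le)+
  qed
  then show ?thesis by (simp add: q_def)
qed

lemma mu_scale: "mu K x = K * mu 1 x" by (simp add: mu_def)

lemma mu_tendsto_0: "(mu 1 \<longlongrightarrow> 1/3) (at_right 0)"
  unfolding mu_def by real_asymp
lemma mu_tendsto_1: "(mu 1 \<longlongrightarrow> 1/4) (at_left 1)"
  unfolding mu_def by real_asymp

text \<open>The derivative is kept in factored form: its first factor is the difference that
  \<open>ln_quotient_less\<close> makes negative, and the remaining factors are positive on the
  interval.\<close>

lemma mu_has_derivative:
  assumes "0 < x" "x < 1"
  shows "(mu 1 has_real_derivative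
     (ln ((1 + x) / (1 - x)) - 2 * x * (3 - x\<^sup>2) / ((1 - x\<^sup>2) * (3 + x\<^sup>2))) *
       (1 - x\<^sup>2) * (3 + x\<^sup>2) / (16 * x^4)) (at x)"
proof -
  define L where "L = ln ((1 + x) / (1 - x))"
  have x2: "1 - x\<^sup>2 \<noteq> 0" using assms by (simp add: power2_eq_1_iff)
  have p: "3 + x\<^sup>2 \<noteq> 0" by (metis add_pos_nonneg less_irrefl zero_le_power2 zero_less_numeral)
  have D1: "((\<lambda>x. (1 + x\<^sup>2) / (8 * x\<^sup>2)) has_real_derivative
     (2 * x * (8 * x\<^sup>2) - (1 + x\<^sup>2) * (16 * x)) / (8 * x\<^sup>2)\<^sup>2) (at x)"
    using assms by (auto intro!: derivative_eq_intros simp: power2_eq_square)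
  have D2: "((\<lambda>x. (1 - x\<^sup>2)\<^sup>2 / (16 * x^3)) has_real_derivative
     (2 * (1 - x\<^sup>2) * (- 2 * x) * (16 * x^3) - (1 - x\<^sup>2)\<^sup>2 * (48 * x\<^sup>2)) / (16 * x^3)\<^sup>2) (at x)"
    using assms by (auto intro!: derivative_eq_intros simp: power2_eq_square)
  have D3: "((\<lambda>x. ln (1 + x) - ln (1 - x)) has_real_derivative 1 / (1 + x) + 1 / (1 - x)) (at x)"
    using assms by (auto intro!: derivative_eq_intros)
  have D: "((\<lambda>x. (1 + x\<^sup>2) / (8 * x\<^sup>2) - (1 - x\<^sup>2)\<^sup>2 / (16 * x^3) * (ln (1 + x) - ln (1 - x))) has_real_derivative
     (2 * x * (8 * x\<^sup>2) - (1 + x\<^sup>2) * (16 * x)) / (8 * x\<^sup>2)\<^sup>2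
     - ((2 * (1 - x\<^sup>2) * (- 2 * x) * (16 * x^3) - (1 - x\<^sup>2)\<^sup>2 * (48 * x\<^sup>2)) / (16 * x^3)\<^sup>2 * (ln (1 + x) - ln (1 - x))
       + (1 - x\<^sup>2)\<^sup>2 / (16 * x^3) * (1 / (1 + x) + 1 / (1 - x)))) (at x)"
    using DERIV_diff[OF D1 DERIV_mult[OF D2 D3]] by (simp only: mult.commute)
  \<comment> \<open>Multiplying out the bracket of \<open>mu\<close> removes the denominator
    \<open>1 - x\<^sup>2\<close>; what remains consists of the pieces differentiated in
    \<open>D1\<close>, \<open>D2\<close> and \<open>D3\<close>.\<close>
  have *: "u / (8 * y\<^sup>2) * (v / u - u / (2 * y) * l) = v / (8 * y\<^sup>2) - u\<^sup>2 / (16 * y^3) * l"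
    if "u \<noteq> 0" "y \<noteq> 0" for u v l y :: real
    using that by (simp add: field_simps power2_eq_square power3_eq_cube)
  have eq: "(1 + y\<^sup>2) / (8 * y\<^sup>2) - (1 - y\<^sup>2)\<^sup>2 / (16 * y^3) * (ln (1 + y) - ln (1 - y)) = mu 1 y"
    if y: "y \<in> {0<..<1}" for y
  proof -
    have "1 - y\<^sup>2 \<noteq> 0" using y by (simp add: power2_eq_1_iff)
    then show ?thesis
      using y *[of "1 - y\<^sup>2" y "1 + y\<^sup>2" "ln (1 + y) - ln (1 - y)"] by (simp add: mu_def ln_div)
  qed
  have ev: "\<forall>\<^sub>F y in nhds x. (1 + y\<^sup>2) / (8 * y\<^sup>2) - (1 - y\<^sup>2)\<^sup>2 / (16 * y^3) * (ln (1 + y) - ln (1 - y)) = mu 1 y"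
    by (rule eventually_mono[OF eventually_nhds_in_open[of "{0<..<1}"] eq]) (use assms in auto)
  have f1: "(2 * x * (8 * x\<^sup>2) - (1 + x\<^sup>2) * (16 * x)) / (8 * x\<^sup>2)\<^sup>2 = - 1 / (4 * x^3)"
  proof -
    have "(2 * x * (8 * x\<^sup>2) - (1 + x\<^sup>2) * (16 * x)) * (4 * x^3) = - 1 * (8 * x\<^sup>2)\<^sup>2" by algebra
    then show ?thesis by (rule frac_eqI) (use assms in simp_all)
  qed
  have f2: "(2 * (1 - x\<^sup>2) * (- 2 * x) * (16 * x^3) - (1 - x\<^sup>2)\<^sup>2 * (48 * x\<^sup>2)) / (16 * x^3)\<^sup>2
      = - (1 - x\<^sup>2) * (3 + x\<^sup>2) / (16 * x^4)"
  proof -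
    have "(2 * (1 - x\<^sup>2) * (- 2 * x) * (16 * x^3) - (1 - x\<^sup>2)\<^sup>2 * (48 * x\<^sup>2)) * (16 * x^4)
      = (- (1 - x\<^sup>2) * (3 + x\<^sup>2)) * (16 * x^3)\<^sup>2"
      by (simp add: algebra_simps power2_eq_square power3_eq_cube power4_eq_xxxx)
    then show ?thesis by (rule frac_eqI) (use assms in simp_all)
  qed
  have f3: "(1 - x\<^sup>2)\<^sup>2 / (16 * x^3) * (1 / (1 + x) + 1 / (1 - x)) = (1 - x\<^sup>2) / (8 * x^3)"
  proof -
    have "1 / (1 + x) + 1 / (1 - x) = 2 / (1 - x\<^sup>2)"
      by (rule inverse_add_inverse_one_minus[OF assms])
    moreover have "u\<^sup>2 / (16 * y) * (2 / u) = u / (8 * y)" if "u \<noteq> 0" for u y :: real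
      using that by (simp add: power2_eq_square)
    ultimately show ?thesis using x2 by (simp only:)
  qed
  have f4: "(L - 2 * x * (3 - x\<^sup>2) / ((1 - x\<^sup>2) * (3 + x\<^sup>2))) * (1 - x\<^sup>2) * (3 + x\<^sup>2) / (16 * x^4)
    = - 1 / (4 * x^3) + ((1 - x\<^sup>2) * (3 + x\<^sup>2) / (16 * x^4) * L - (1 - x\<^sup>2) / (8 * x^3))"
  proof -
    have e1: "(L - 2 * x * (3 - x\<^sup>2) / ((1 - x\<^sup>2) * (3 + x\<^sup>2))) * (1 - x\<^sup>2) * (3 + x\<^sup>2)
      = L * (1 - x\<^sup>2) * (3 + x\<^sup>2) - 2 * x * (3 - x\<^sup>2)"
    proof -
      have "(l - a / (u * v)) * u * v = l * u * v - a" if "u \<noteq> 0" "v \<noteq> 0" for l a u v :: real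
        using that by (simp add: left_diff_distrib)
      then show ?thesis using x2 p by blast
    qed
    have e2: "2 * x * (3 - x\<^sup>2) / (16 * x^4) = 1 / (4 * x^3) + (1 - x\<^sup>2) / (8 * x^3)"
    proof -
      have "2 * x * (3 - x\<^sup>2) * (8 * x^3) = (2 + (1 - x\<^sup>2)) * (16 * x^4)" by algebra
      then have "2 * x * (3 - x\<^sup>2) / (16 * x^4) = (2 + (1 - x\<^sup>2)) / (8 * x^3)"
        by (rule frac_eqI) (use assms in simp_all)
      moreover have "(2 + u) / (8 * y) = 1 / (4 * y) + u / (8 * y)" for u y :: real
        by (simp add: add_divide_distrib)
      ultimately show ?thesis by (simp only:)
    qed
    have e3: "(l * u * v - a) / z = u * v / z * l - a / z" for l u v a z :: real
      by (simp add: diff_divide_distrib)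
    have e4: "y - (1 / w + q) = - 1 / w + (y - q)" for y w q :: real by simp
    show ?thesis by (simp only: e1 e2 e3 e4)
  qed
  have f5: "ln (1 + x) - ln (1 - x) = L" using assms by (simp add: L_def ln_div)
  have f6: "p - (- u * v / z * l + q) = p + (u * v / z * l - q)" for p u v z l q :: real
    by simp
  have "((\<lambda>x. (1 + x\<^sup>2) / (8 * x\<^sup>2) - (1 - x\<^sup>2)\<^sup>2 / (16 * x^3) * (ln (1 + x) - ln (1 - x))) has_real_derivative
     (L - 2 * x * (3 - x\<^sup>2) / ((1 - x\<^sup>2) * (3 + x\<^sup>2))) * (1 - x\<^sup>2) * (3 + x\<^sup>2) / (16 * x^4)) (at x)"
    using D by (simp only: f1 f2 f3 f4 f5 f6)
  then show ?thesis
    unfolding L_def using DERIV_cong_ev[OF refl ev refl] by blast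
qed

lemma mu_strict_antimono:
  assumes "0 < x" "x < y" "y < 1"
  shows "mu 1 y < mu 1 x"
proof (rule DERIV_neg_imp_decreasing[OF assms(2)])
  fix t assume "x \<le> t" "t \<le> y"
  then have t: "0 < t" "t < 1" using assms by auto
  have "(ln ((1 + t) / (1 - t)) - 2 * t * (3 - t\<^sup>2) / ((1 - t\<^sup>2) * (3 + t\<^sup>2))) *
       ((1 - t\<^sup>2) * (3 + t\<^sup>2) / (16 * t^4)) < 0"
    using ln_quotient_less[OF t] t
    by (intro mult_neg_pos divide_pos_pos mult_pos_pos) (auto simp: power_less_one_iff abs_square_less_1 add_pos_nonneg)
  then show "\<exists>d. (mu 1 has_real_derivative d) (at t) \<and> d < 0"
    using mu_has_derivative[OF t] by (auto simp: mult.assoc)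
qed

text \<open>Since \<open>mu 1\<close> decreases, its one-sided limits \<open>1 / 3\<close> at
  \<open>0\<close> and \<open>1 / 4\<close> at \<open>1\<close> are bounds from above and
  below.\<close>

lemma mu_bounds:
  assumes "0 < x" "x < 1"
  shows "1 / 4 \<le> mu 1 x" "mu 1 x \<le> 1 / 3"
proof -
  show "1 / 4 \<le> mu 1 x"
  proof (rule tendsto_upperbound[OF mu_tendsto_1])
    show "\<forall>\<^sub>F y in at_left 1. mu 1 y \<le> mu 1 x"
      using eventually_at_left_real[OF assms(2)]
      by eventually_elim (use assms in \<open>auto intro!: less_imp_le[OF mu_strict_antimono]\<close>)
  qed simp
  show "mu 1 x \<le> 1 / 3"
  proof (rule tendsto_lowerbound[OF mu_tendsto_0])
    show "\<forall>\<^sub>F y in at_right 0. mu 1 x \<le> mu 1 y"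
      using eventually_at_right_real[OF assms(1)]
      by eventually_elim (use assms in \<open>auto intro!: less_imp_le[OF mu_strict_antimono]\<close>)
  qed simp
qed

text \<open>The formula for \<open>mu\<close> divides by zero at \<open>0\<close>, where its continuous extension is \<open>1 / 3\<close>.\<close>

definition area_factor :: "real \<Rightarrow> real" where
  "area_factor r = (if r = 0 then 2 / 3 else 2 * mu 1 r)"

text \<open>Up to the factor \<open>2 * pi\<close>, the integrand is what remains of the area
  integral after integrating over the angle. With \<open>w = 1 - r\<^sup>2 * x\<^sup>2\<close> the
  antiderivative combines \<open>x / w\<^sup>2\<close>, \<open>x / w\<close> and the area hyperbolic
  tangent of \<open>r * x\<close> divided by \<open>r\<close>; the last term is the origin of the
  logarithm in \<open>mu\<close>. Its coefficients have \<open>r\<^sup>2\<close> in the denominator,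
  hence the separate case \<open>r = 0\<close>.\<close>

lemma radial_has_integral:
  assumes r: "0 \<le> r" "r < 1"
  shows "((\<lambda>x. (1 - r\<^sup>2) * (1 - x\<^sup>2) * (1 + r\<^sup>2 * x\<^sup>2) / (1 - r\<^sup>2 * x\<^sup>2)^3) has_integral area_factor r) {0..1}"
proof (cases "r = 0")
  case True
  have "((\<lambda>x::real. 1 - x\<^sup>2) has_integral (1 - 1^3 / 3) - (0 - 0^3 / 3)) {0..1}"
    by (rule fundamental_theorem_of_calculus)
      (auto simp flip: has_real_derivative_iff_has_vector_derivative intro!: derivative_eq_intros)
  then show ?thesis using True by (simp add: area_factor_def)
next
  case False
  then have r0: "r > 0" using r by simp
  have r2: "r\<^sup>2 < 1" using r by (simp add: power_less_one_iff abs_square_less_1)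
  define L where "L = (\<lambda>x. (ln (1 + r * x) - ln (1 - r * x)) / (2 * r))"
  \<comment> \<open>The coefficients solve a linear system: over the common denominator
    \<open>4 * r\<^sup>2 * w^3\<close> the numerators of the three derivatives must add up to
    \<open>4 * r\<^sup>2 * ((1 - x\<^sup>2) * (1 + r\<^sup>2 * x\<^sup>2))\<close>.\<close>
  define F where "F = (\<lambda>x. (1 - r\<^sup>2) * (- (1 - r\<^sup>2) / (2 * r\<^sup>2) * (x / (1 - r\<^sup>2 * x\<^sup>2)\<^sup>2)
      + (r\<^sup>2 + 3) / (4 * r\<^sup>2) * (x / (1 - r\<^sup>2 * x\<^sup>2)) - (1 - r\<^sup>2) / (4 * r\<^sup>2) * L x))"
  have "((\<lambda>x. (1 - r\<^sup>2) * (1 - x\<^sup>2) * (1 + r\<^sup>2 * x\<^sup>2) / (1 - r\<^sup>2 * x\<^sup>2)^3) has_integral F 1 - F 0) {0..1}"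
  proof (rule fundamental_theorem_of_calculus, simp)
    fix x :: real assume x: "x \<in> {0..1}"
    let ?w = "1 - r\<^sup>2 * x\<^sup>2"
    have "r * x \<le> r" using x r0 by (intro mult_left_le) auto
    then have rx: "r * x < 1" "0 \<le> r * x" using x r by auto
    then have "(r * x)\<^sup>2 < 1" by (simp add: abs_square_less_1)
    then have w: "?w > 0" by (simp add: power_mult_distrib)
    have D1: "((\<lambda>x. x / (1 - r\<^sup>2 * x\<^sup>2)\<^sup>2) has_real_derivative (1 + 3 * (r\<^sup>2 * x\<^sup>2)) / ?w^3) (at x)"
    proof -
      have "((\<lambda>x. x / (1 - r\<^sup>2 * x\<^sup>2)\<^sup>2) has_real_derivative
        (1 * ?w\<^sup>2 - x * (2 * ?w * (- (r\<^sup>2 * (2 * x))))) / (?w\<^sup>2 * ?w\<^sup>2)) (at x)"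
        using w by (auto intro!: derivative_eq_intros)
      also have "1 * ?w\<^sup>2 - x * (2 * ?w * (- (r\<^sup>2 * (2 * x)))) = ?w * (1 + 3 * (r\<^sup>2 * x\<^sup>2))" by algebra
      also have "?w\<^sup>2 * ?w\<^sup>2 = ?w * ?w^3" by algebra
      finally show ?thesis using w by simp
    qed
    have D2: "((\<lambda>x. x / (1 - r\<^sup>2 * x\<^sup>2)) has_real_derivative (1 + r\<^sup>2 * x\<^sup>2) / ?w\<^sup>2) (at x)"
    proof -
      have "((\<lambda>x. x / (1 - r\<^sup>2 * x\<^sup>2)) has_real_derivative
        (1 * ?w - x * (- (r\<^sup>2 * (2 * x)))) / (?w * ?w)) (at x)"
        using w by (auto intro!: derivative_eq_intros)
      also have "1 * ?w - x * (- (r\<^sup>2 * (2 * x))) = 1 + r\<^sup>2 * x\<^sup>2" by algebra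
      finally show ?thesis by (simp add: power2_eq_square)
    qed
    have D3: "(L has_real_derivative 1 / ?w) (at x)"
    proof -
      have "(L has_real_derivative (r / (1 + r * x) + r / (1 - r * x)) / (2 * r)) (at x)"
      proof -
        have "((\<lambda>x. ln (1 + r * x) - ln (1 - r * x)) has_real_derivative r / (1 + r * x) + r / (1 - r * x)) (at x)"
          using rx by (auto intro!: derivative_eq_intros)
        then show ?thesis unfolding L_def by (rule DERIV_cdivide)
      qed
      also have "(r / (1 + r * x) + r / (1 - r * x)) / (2 * r) = 1 / ?w"
      proof -
        have "r / (1 + r * x) + r / (1 - r * x) = (r * (1 - r * x) + r * (1 + r * x)) / ((1 + r * x) * (1 - r * x))"
          using rx by (intro add_frac_eq) auto
        also have "\<dots> = (2 * r) / ?w"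
          by (rule arg_cong2[where f = "(/)"]) algebra+
        finally show ?thesis using r0 by simp
      qed
      finally show ?thesis .
    qed
    have "(F has_real_derivative (1 - r\<^sup>2) * (- (1 - r\<^sup>2) / (2 * r\<^sup>2) * ((1 + 3 * (r\<^sup>2 * x\<^sup>2)) / ?w^3)
      + (r\<^sup>2 + 3) / (4 * r\<^sup>2) * ((1 + r\<^sup>2 * x\<^sup>2) / ?w\<^sup>2) - (1 - r\<^sup>2) / (4 * r\<^sup>2) * (1 / ?w))) (at x)"
      unfolding F_def by (intro DERIV_cmult DERIV_diff DERIV_add D1 D2 D3)
    also have "- (1 - r\<^sup>2) / (2 * r\<^sup>2) * ((1 + 3 * (r\<^sup>2 * x\<^sup>2)) / ?w^3)
      + (r\<^sup>2 + 3) / (4 * r\<^sup>2) * ((1 + r\<^sup>2 * x\<^sup>2) / ?w\<^sup>2) - (1 - r\<^sup>2) / (4 * r\<^sup>2) * (1 / ?w)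
      = (1 - x\<^sup>2) * (1 + r\<^sup>2 * x\<^sup>2) / ?w^3"
    proof -
      have gen: "- (1 - q) / (2 * q) * (A / w^3) + (q + 3) / (4 * q) * (B / w\<^sup>2) - (1 - q) / (4 * q) * (1 / w)
        = (- 2 * (1 - q) * A + (q + 3) * B * w - (1 - q) * w\<^sup>2) / (4 * q * w^3)"
        if "q \<noteq> 0" "w \<noteq> 0" for q A B w :: real
        using that by (simp add: divide_simps power2_eq_square power3_eq_cube)
      have "- 2 * (1 - r\<^sup>2) * (1 + 3 * (r\<^sup>2 * x\<^sup>2)) + (r\<^sup>2 + 3) * (1 + r\<^sup>2 * x\<^sup>2) * ?w - (1 - r\<^sup>2) * ?w\<^sup>2
        = 4 * r\<^sup>2 * ((1 - x\<^sup>2) * (1 + r\<^sup>2 * x\<^sup>2))" by algebra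
      with gen[of "r\<^sup>2" ?w] r0 w show ?thesis by simp
    qed
    finally show "(F has_vector_derivative (1 - r\<^sup>2) * (1 - x\<^sup>2) * (1 + r\<^sup>2 * x\<^sup>2) / ?w^3) (at x within {0..1})"
      by (simp add: has_real_derivative_iff_has_vector_derivative has_vector_derivative_at_within mult.assoc)
  qed
  moreover have "F 0 = 0" by (simp add: F_def L_def)
  moreover have "F 1 = 2 * mu 1 r"
  proof -
    have gen: "q * (- q / (2 * s) * (1 / q\<^sup>2) + (s + 3) / (4 * s) * (1 / q) - q / (4 * s) * (l / (2 * r)))
      = 2 * (q / (8 * s) * ((1 + s) / q - q / (2 * r) * l))"
      if "q \<noteq> 0" "s \<noteq> 0" for q s l :: real
      using that r0 by (simp add: divide_simps power2_eq_square)
    have "ln ((1 + r) / (1 - r)) = ln (1 + r) - ln (1 - r)" using r r0 by (simp add: ln_div)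
    then show ?thesis
      using gen[of "1 - r\<^sup>2" "r\<^sup>2" "ln (1 + r) - ln (1 - r)"] r2 r0
      by (simp only: F_def L_def mu_def power_one mult_1_right mult_1) simp
  qed
  ultimately show ?thesis using False by (simp add: area_factor_def)
qed

subsection \<open>Planar integrals\<close>

lemma continuous_on_vector2 [continuous_intros]:
  assumes "continuous_on S f" "continuous_on S g"
  shows "continuous_on S (\<lambda>p. vector [f p, g p] :: real^2)"
proof -
  have "(\<lambda>p. vector [f p, g p] :: real^2) = (\<lambda>p. \<chi> i. if i = 1 then f p else g p)"
    by (auto simp: vec_eq_iff forall_2)
  moreover have "continuous_on S (\<lambda>p. if i = 1 then f p else g p)" for i :: 2
    using assms by (cases "i = 1") auto
  ultimately show ?thesis by (simp only: continuous_on_vec_lambda)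
qed

lemma Basis_vec2: "Basis = {axis 1 1, axis 2 1 :: real^2}" "axis 1 1 \<noteq> (axis 2 1 :: real^2)"
  by (auto simp: Basis_vec_def UNIV_2 axis_eq_axis)

text \<open>The change of variables below takes place in \<open>real^2\<close>, the iterated
  integral in \<open>real \<times> real\<close>, and the Green potential in \<open>complex\<close>.
  This lemma and the next identify the three Lebesgue measures; agreement on boxes suffices.\<close>

lemma distr_lborel_complex:
  "distr (lborel :: (real^2) measure) borel (\<lambda>v. Complex (v $ 1) (v $ 2)) = lborel"
proof (rule lborel_eqI[symmetric])
  have m: "(\<lambda>v::real^2. Complex (v $ 1) (v $ 2)) \<in> borel_measurable borel"
    by (intro borel_measurable_continuous_onI) (auto simp: complex_eq_iff intro!: continuous_intros)
  fix l u :: complex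
  assume lu: "\<And>b. b \<in> Basis \<Longrightarrow> l \<bullet> b \<le> u \<bullet> b"
  have e: "(\<lambda>v::real^2. Complex (v $ 1) (v $ 2)) -` box l u = box (vector [Re l, Im l]) (vector [Re u, Im u])"
    by (auto simp: box_def Basis_complex_def Basis_vec_def inner_axis forall_2)
  have le: "Re l \<le> Re u" "Im l \<le> Im u" using lu[of 1] lu[of \<i>] by (auto simp: Basis_complex_def)
  show "emeasure (distr (lborel :: (real^2) measure) borel (\<lambda>v. Complex (v $ 1) (v $ 2))) (box l u)
      = ennreal (\<Prod>b\<in>Basis. (u - l) \<bullet> b)"
    using le m by (simp add: emeasure_distr e emeasure_lborel_box_eq Basis_complex_def inner_axis Basis_vec2)
qed simp

lemma distr_lborel_prod_vec:
  "distr (lborel :: (real \<times> real) measure) borel (\<lambda>p. vector [fst p, snd p] :: real^2) = lborel"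
proof (rule lborel_eqI[symmetric])
  have m: "(\<lambda>p. vector [fst p, snd p] :: real^2) \<in> borel_measurable borel"
    by (intro borel_measurable_continuous_onI)
       (auto intro!: continuous_intros)
  fix l u :: "real^2"
  assume lu: "\<And>b. b \<in> Basis \<Longrightarrow> l \<bullet> b \<le> u \<bullet> b"
  have e: "(\<lambda>p. vector [fst p, snd p] :: real^2) -` box l u = box (l $ 1, l $ 2) (u $ 1, u $ 2)"
    by (auto simp: box_def Basis_prod_def Basis_vec_def inner_axis forall_2)
  have le: "l $ 1 \<le> u $ 1" "l $ 2 \<le> u $ 2"
    using lu[of "axis 1 1"] lu[of "axis 2 1"] by (auto simp: Basis_vec2 inner_axis)
  then show "emeasure (distr (lborel :: (real \<times> real) measure) borel (\<lambda>p. vector [fst p, snd p] :: real^2)) (box l u)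
      = ennreal (\<Prod>b\<in>Basis. (u - l) \<bullet> b)"
    using m by (simp add: emeasure_distr e emeasure_lborel_box_eq Basis_vec2 Basis_prod_def inner_axis)
qed simp

text \<open>Fubini's theorem for pairs, carried over by the coordinate map.\<close>

lemma integral_cbox_vec2:
  fixes h :: "real^2 \<Rightarrow> real"
  assumes "continuous_on (cbox (vector [a, c]) (vector [b, d])) h"
  shows "integral (cbox (vector [a, c]) (vector [b, d])) h =
    integral {a..b} (\<lambda>x. integral {c..d} (\<lambda>y. h (vector [x, y])))"
proof -
  let ?V = "\<lambda>p. vector [fst p, snd p] :: real^2"
  let ?S = "cbox (vector [a, c]) (vector [b, d]) :: (real^2) set"
  have mV: "?V \<in> borel_measurable borel" and cV: "continuous_on UNIV ?V"
    by (auto intro!: continuous_intros borel_measurable_continuous_onI)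
  have V: "?V p \<in> ?S \<longleftrightarrow> p \<in> cbox (a, c) (b, d)" for p
    by (cases p) (auto simp: mem_box Basis_prod_def Basis_vec_def inner_axis forall_2)
  have i1: "set_integrable lborel ?S h"
    unfolding set_integrable_def by (rule borel_integrable_compact) (use assms in auto)
  have c2: "continuous_on (cbox (a, c) (b, d)) (\<lambda>p. h (?V p))"
    by (rule continuous_on_compose2[OF assms continuous_on_subset[OF cV subset_UNIV] image_subsetI]) (simp only: V)
  have i2: "set_integrable lborel (cbox (a, c) (b, d)) (\<lambda>p. h (?V p))"
    unfolding set_integrable_def by (rule borel_integrable_compact) (use c2 in auto)
  have "integral ?S h = (LINT v:?S|lborel. h v)"
    using set_borel_integral_eq_integral(2)[OF i1] by simp
  also have "\<dots> = (LINT v|distr (lborel :: (real \<times> real) measure) borel ?V. indicator ?S v *\<^sub>R h v)"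
    by (simp add: distr_lborel_prod_vec set_lebesgue_integral_def)
  also have "\<dots> = (LINT p|lborel. indicator ?S (?V p) *\<^sub>R h (?V p))"
    using i1 by (intro integral_distr) (auto simp: mV set_integrable_def dest: borel_measurable_integrable)
  also have "\<dots> = (LINT p:cbox (a, c) (b, d)|lborel. h (?V p))"
    unfolding set_lebesgue_integral_def
    by (intro Bochner_Integration.integral_cong refl) (simp add: indicator_def V)
  also have "\<dots> = integral (cbox (a, c) (b, d)) (\<lambda>p. h (?V p))"
    using set_borel_integral_eq_integral(2)[OF i2] by simp
  also have "\<dots> = integral {a..b} (\<lambda>x. integral {c..d} (\<lambda>y. h (vector [x, y])))"
    using integral_prod_continuous[OF c2] by simp
  finally show ?thesis .
qed

text \<open>On the unit circle \<open>cnj u\<close> is the inverse of \<open>u\<close>, so the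
  conjugate factor of the fourth power becomes a double pole at \<open>cnj b\<close>. Up to a factor
  \<open>\<i>\<close>, the integrand is \<open>f u / (u - cnj b)\<^sup>2\<close> along the circle
  with \<open>f\<close> holomorphic inside, and Cauchy's formula for the first derivative evaluates
  it as \<open>f' (cnj b)\<close>.\<close>

lemma has_integral_inverse_pow4_circle:
  fixes b :: complex
  assumes b: "norm b < 1"
  shows "((\<lambda>t. 1 / (norm (1 - b * cis t))^4) has_integral
    2 * pi * (1 + (norm b)\<^sup>2) / (1 - (norm b)\<^sup>2)^3) {0..2*pi}"
proof -
  have nz: "1 - b * u \<noteq> 0" if "norm u \<le> 1" for u
  proof
    assume "1 - b * u = 0"
    then have "norm b * norm u = 1" by (metis eq_iff_diff_eq_0 norm_mult norm_one)
    then show False using b that mult_left_le[of "norm u" "norm b"] by auto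
  qed
  define f where "f = (\<lambda>u. u / (1 - b * u)\<^sup>2)"
  define f' where "f' = (\<lambda>u. (1 + b * u) / (1 - b * u)^3)"
  have fd: "(f has_field_derivative f' u) (at u)" if "norm u \<le> 1" for u
  proof -
    have "(f has_field_derivative (1 * (1 - b * u)\<^sup>2 - u * (2 * (1 - b * u) * (- b))) / ((1 - b * u)\<^sup>2 * (1 - b * u)\<^sup>2)) (at u)"
      unfolding f_def using nz[OF that] by (auto intro!: derivative_eq_intros)
    also have "(1 * (1 - b * u)\<^sup>2 - u * (2 * (1 - b * u) * (- b))) / ((1 - b * u)\<^sup>2 * (1 - b * u)\<^sup>2)
      = ((1 - b * u) * (1 + b * u)) / ((1 - b * u) * (1 - b * u)^3)"
      by (rule arg_cong2[where f = "(/)"]) algebra+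
    also have "\<dots> = f' u" using nz[OF that] by (simp add: f'_def)
    finally show ?thesis .
  qed
  have hol: "f holomorphic_on ball 0 1"
    using fd by (intro holomorphic_onI) (meson DERIV_subset field_differentiable_def has_field_derivative_at_within less_imp_le mem_ball_0)
  have cont: "continuous_on (cball 0 1) f"
    using nz unfolding f_def by (auto intro!: continuous_intros)
  have "((\<lambda>u. f u / (u - cnj b)\<^sup>2) has_contour_integral 2 * of_real pi * \<i> * deriv f (cnj b)) (circlepath 0 1)"
    using Cauchy_has_contour_integral_higher_derivative_circlepath[OF cont hol, of "cnj b" 1] b
    by (simp add: numeral_2_eq_2)
  moreover have "deriv f (cnj b) = f' (cnj b)"
    using fd b by (intro DERIV_imp_deriv) auto
  moreover have "f' (cnj b) = of_real ((1 + (norm b)\<^sup>2) / (1 - (norm b)\<^sup>2)^3)"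
    by (simp only: f'_def mult.commute[of b] of_real_divide of_real_add of_real_diff of_real_1 of_real_power[of _ 3] complex_norm_square)
  ultimately have "((\<lambda>t. f (cis t) / (cis t - cnj b)\<^sup>2 * (\<i> * cis t)) has_integral
     2 * of_real pi * \<i> * of_real ((1 + (norm b)\<^sup>2) / (1 - (norm b)\<^sup>2)^3)) {0..2*pi}"
    by (simp add: circlepath_def has_contour_integral_part_circlepath_iff mult_ac)
  then have "((\<lambda>t. - \<i> * (f (cis t) / (cis t - cnj b)\<^sup>2 * (\<i> * cis t))) has_integral
     - \<i> * (2 * of_real pi * \<i> * of_real ((1 + (norm b)\<^sup>2) / (1 - (norm b)\<^sup>2)^3))) {0..2*pi}"
    by (rule has_integral_mult_right)
  moreover have "- \<i> * (f (cis t) / (cis t - cnj b)\<^sup>2 * (\<i> * cis t)) = of_real (1 / (norm (1 - b * cis t))^4)" for t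
  proof -
    have n: "of_real ((norm (1 - b * cis t))^4) = ((1 - b * cis t) * cnj (1 - b * cis t))\<^sup>2"
      by (simp only: complex_norm_square[symmetric] flip: of_real_power) simp
    have "cis t * cnj (1 - b * cis t) = cis t - cnj b"
      by (simp add: algebra_simps cis_cnj cis_mult)
    then have "(cis t - cnj b)\<^sup>2 = (cis t)\<^sup>2 * (cnj (1 - b * cis t))\<^sup>2"
      by (metis power_mult_distrib)
    then have "- \<i> * (f (cis t) / (cis t - cnj b)\<^sup>2 * (\<i> * cis t)) = 1 / ((1 - b * cis t) * cnj (1 - b * cis t))\<^sup>2"
      by (simp add: f_def power_mult_distrib power2_eq_square)
    then show ?thesis by (simp only: n[symmetric] of_real_divide of_real_1)
  qed
  moreover have "- \<i> * (2 * of_real pi * \<i> * of_real ((1 + (norm b)\<^sup>2) / (1 - (norm b)\<^sup>2)^3))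
     = of_real (2 * pi * ((1 + (norm b)\<^sup>2) / (1 - (norm b)\<^sup>2)^3))"
  proof -
    have "- \<i> * (2 * of_real pi * \<i> * of_real c) = of_real (2 * pi * c)" for c by simp
    then show ?thesis .
  qed
  ultimately have "((\<lambda>t. complex_of_real (1 / (norm (1 - b * cis t))^4)) has_integral
     of_real (2 * pi * ((1 + (norm b)\<^sup>2) / (1 - (norm b)\<^sup>2)^3))) {0..2*pi}"
    by (simp only:)
  from has_integral_Re[OF this] show ?thesis by simp
qed

subsection \<open>The area integral of the gradient of Green's function\<close>

definition green_kernel :: "complex \<Rightarrow> complex \<Rightarrow> real" where
  "green_kernel z w = (1 - (norm w)\<^sup>2) / (norm (z - w) * norm (1 - cnj z * w))"

lemma one_minus_cnj_mult_nonzero: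
  assumes "norm z < 1" "norm w \<le> 1"
  shows "1 - cnj z * w \<noteq> 0"
proof
  assume "1 - cnj z * w = 0"
  then have "norm z * norm w = 1" by (metis complex_mod_cnj eq_iff_diff_eq_0 norm_mult norm_one)
  then show False using assms mult_left_le[of "norm w" "norm z"] by auto
qed

text \<open>The map scales the second coordinate by \<open>p\<close> and then multiplies by
  \<open>A\<close>; the real determinants of the two steps are \<open>p\<close> and the squared
  modulus of \<open>A\<close>. Below, \<open>p\<close> is the polar radius.\<close>

lemma det_matrix_complex_linear:
  fixes A :: complex and p :: real
  shows "det (matrix (\<lambda>h :: real^2. vector [Re (A * Complex (h $ 1) (p * h $ 2)), Im (A * Complex (h $ 1) (p * h $ 2))] :: real^2))
    = p * (norm A)\<^sup>2"
  by (simp add: det_2 matrix_def axis_def cmod_power2) (simp add: algebra_simps power2_eq_square)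

text \<open>The map is an involution of the disc that exchanges \<open>0\<close> and
  \<open>z\<close>, as the quotient of the third identity by the second shows. It therefore moves
  the singularity of the kernel to the origin, where polar coordinates can absorb it.\<close>

lemma norm_moebius:
  assumes z: "norm z < 1" and u: "norm u \<le> 1"
  defines "w \<equiv> (z - u) / (1 - cnj z * u)"
  shows "1 - (norm w)\<^sup>2 = (1 - (norm z)\<^sup>2) * (1 - (norm u)\<^sup>2) / (norm (1 - cnj z * u))\<^sup>2"
    and "1 - cnj z * w = of_real (1 - (norm z)\<^sup>2) / (1 - cnj z * u)"
    and "z - w = u * of_real (1 - (norm z)\<^sup>2) / (1 - cnj z * u)"
    and "norm w \<le> 1"
proof -
  have nz: "1 - cnj z * u \<noteq> 0" by (rule one_minus_cnj_mult_nonzero[OF z u])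
  have "(norm (1 - cnj z * u))\<^sup>2 - (norm (z - u))\<^sup>2 = (1 - (norm z)\<^sup>2) * (1 - (norm u)\<^sup>2)"
    unfolding cmod_power2 by (simp add: algebra_simps power2_eq_square)
  then show n: "1 - (norm w)\<^sup>2 = (1 - (norm z)\<^sup>2) * (1 - (norm u)\<^sup>2) / (norm (1 - cnj z * u))\<^sup>2"
    using nz by (simp add: w_def norm_divide power_divide field_simps)
  have c: "of_real (1 - (norm z)\<^sup>2) = 1 - z * cnj z" by (simp only: of_real_diff of_real_1 complex_norm_square)
  show "1 - cnj z * w = of_real (1 - (norm z)\<^sup>2) / (1 - cnj z * u)"
    unfolding c w_def using nz by (simp add: field_simps)
  show "z - w = u * of_real (1 - (norm z)\<^sup>2) / (1 - cnj z * u)"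
    unfolding c w_def using nz by (simp add: field_simps)
  have "0 \<le> (1 - (norm z)\<^sup>2) * (1 - (norm u)\<^sup>2) / (norm (1 - cnj z * u))\<^sup>2"
    using z u by (simp add: power_le_one)
  then have "(norm w)\<^sup>2 \<le> 1" using n by simp
  then show "norm w \<le> 1" by (simp add: abs_square_le_1)
qed

text \<open>The squared norm is the area Jacobian of the substitution, and \<open>norm u\<close> is
  the Jacobian of polar coordinates. The latter cancels the only singular factor of the kernel, so
  that a continuous integrand remains.\<close>

lemma green_kernel_moebius:
  assumes z: "norm z < 1" and u: "norm u \<le> 1" "u \<noteq> 0"
  shows "norm u * (norm (complex_of_real (1 - (norm z)\<^sup>2) / (1 - cnj z * u)\<^sup>2))\<^sup>2 * green_kernel z ((z - u) / (1 - cnj z * u))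
    = (1 - (norm z)\<^sup>2) * (1 - (norm u)\<^sup>2) / (norm (1 - cnj z * u))^4"
proof -
  have q: "(norm z)\<^sup>2 < 1" using z by (simp add: abs_square_less_1)
  have s: "norm (complex_of_real (1 - (norm z)\<^sup>2)) = 1 - (norm z)\<^sup>2"
    using z by (simp only: norm_of_real) (simp add: power_le_one)
  have gen: "n * (q / d\<^sup>2)\<^sup>2 * ((q * m / d\<^sup>2) / ((n * q / d) * (q / d))) = q * m / d^4"
    if "n \<noteq> 0" "q \<noteq> 0" "d \<noteq> 0" for n q d m :: real
    using that by (simp add: divide_simps power2_eq_square) (simp add: algebra_simps eval_nat_numeral)
  let ?w = "(z - u) / (1 - cnj z * u)"
  have m: "norm (z - ?w) = norm u * (1 - (norm z)\<^sup>2) / norm (1 - cnj z * u)"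
    "norm (1 - cnj z * ?w) = (1 - (norm z)\<^sup>2) / norm (1 - cnj z * u)"
    unfolding norm_moebius(2,3)[OF z u(1)] norm_divide norm_mult s by simp_all
  have n: "norm (complex_of_real (1 - (norm z)\<^sup>2) / (1 - cnj z * u)\<^sup>2) = (1 - (norm z)\<^sup>2) / (norm (1 - cnj z * u))\<^sup>2"
    unfolding norm_divide norm_power s by simp
  show ?thesis
    unfolding green_kernel_def norm_moebius(1)[OF z u(1)] m n
    by (rule gen) (use u q one_minus_cnj_mult_nonzero[OF z u(1)] in auto)
qed

text \<open>The disc is covered by the rectangle of polar coordinates followed by the involution
  \<open>M\<close>. The integral is stated for nonnegative functions, with no integrability
  presupposed, which is the form needed for Tonelli's theorem.\<close>

lemma nn_integral_green_kernel_le: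
  assumes z: "norm z < 1"
  shows "(\<integral>\<^sup>+ w. ennreal (green_kernel z w) * indicator (ball 0 1) w \<partial>lborel) \<le> ennreal (2 * pi * area_factor (norm z))"
proof -
  define R where "R = norm z"
  define S where "S = (cbox (vector [0, 0]) (vector [1, 2 * pi]) :: (real^2) set)"
  define C where "C = (\<lambda>v :: real^2. Complex (v $ 1) (v $ 2))"
  define V where "V = (\<lambda>w. vector [Re w, Im w] :: real^2)"
  define P where "P = (\<lambda>v :: real^2. of_real (v $ 1) * cis (v $ 2))"
  define M where "M = (\<lambda>u. (z - u) / (1 - cnj z * u))"
  define A where "A = (\<lambda>v. - of_real (1 - R\<^sup>2) / (1 - cnj z * P v)\<^sup>2 * cis (v $ 2))"
  \<comment> \<open>An increment \<open>h\<close> in polar coordinates at radius \<open>r\<close>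
    and angle \<open>\<theta>\<close> moves the point by \<open>cis \<theta>\<close> times
    \<open>h $ 1 + \<i> * r * h $ 2\<close>. The factor \<open>A\<close> combines this rotation with
    the complex derivative of \<open>M\<close>.\<close>
  define G' where "G' = (\<lambda>v h :: real^2. V (A v * Complex (h $ 1) (v $ 1 * h $ 2)))"
  define H where "H = (\<lambda>v. (1 - R\<^sup>2) * (1 - (v $ 1)\<^sup>2) / (norm (1 - cnj z * P v))^4)"
  have CV: "C (V w) = w" "V (C v) = v" for w v
    by (auto simp: C_def V_def vec_eq_iff forall_2)
  have S: "v \<in> S \<longleftrightarrow> 0 \<le> v $ 1 \<and> v $ 1 \<le> 1 \<and> 0 \<le> v $ 2 \<and> v $ 2 \<le> 2 * pi" for v
    by (auto simp: S_def mem_box Basis_vec2 inner_axis)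
  have nP: "norm (P v) = v $ 1" "norm (P v) \<le> 1" if "v \<in> S" for v
    using that by (auto simp: S P_def norm_mult)
  have nz: "1 - cnj z * P v \<noteq> 0" if "v \<in> S" for v
    by (rule one_minus_cnj_mult_nonzero[OF z nP(2)[OF that]])
  have bl: "bounded_linear V"
    unfolding V_def by (intro linear_conv_bounded_linear[THEN iffD1] linearI) (auto simp: vec_eq_iff forall_2)
  have der: "((\<lambda>v. V (M (P v))) has_derivative G' v) (at v within S)" if v: "v \<in> S" for v
  proof -
    have "(P has_derivative (\<lambda>h. of_real (h $ 1) * cis (v $ 2) + of_real (v $ 1) * (of_real (h $ 2) * (\<i> * cis (v $ 2))))) (at v within S)"
    proof -
      have c1: "((\<lambda>v. of_real (v $ k) :: complex) has_derivative (\<lambda>h. of_real (h $ k))) (at v within S)" for k :: 2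
        by (intro bounded_linear_imp_has_derivative bounded_linear_compose[OF bounded_linear_of_real bounded_linear_vec_nth])
      have c2: "((\<lambda>v. cis (v $ 2)) has_derivative (\<lambda>h. of_real (h $ 2) * (\<i> * cis (v $ 2)))) (at v within S)"
      proof -
        have "((\<lambda>v. \<i> * of_real (v $ 2)) has_derivative (\<lambda>h. \<i> * of_real (h $ 2))) (at v within S)"
          by (intro has_derivative_mult_right c1)
        from has_derivative_compose[OF this DERIV_exp[unfolded has_field_derivative_def]]
        show ?thesis by (simp add: cis_conv_exp mult_ac)
      qed
      show ?thesis unfolding P_def
        using has_derivative_mult[OF c1[of 1] c2] by (simp add: add.commute)
    qed
    moreover have "(M has_field_derivative (- of_real (1 - R\<^sup>2) / (1 - cnj z * P v)\<^sup>2)) (at (P v))"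
    proof -
      have "(M has_field_derivative ((- 1) * (1 - cnj z * P v) - (z - P v) * (- cnj z)) / ((1 - cnj z * P v) * (1 - cnj z * P v))) (at (P v))"
        unfolding M_def using nz[OF v] by (auto intro!: derivative_eq_intros)
      also have "(- 1) * (1 - cnj z * P v) - (z - P v) * (- cnj z) = - of_real (1 - R\<^sup>2)"
        unfolding R_def of_real_diff of_real_1 complex_norm_square by (simp add: algebra_simps)
      finally show ?thesis by (simp add: power2_eq_square)
    qed
    ultimately have "((\<lambda>v. M (P v)) has_derivative (\<lambda>h. - of_real (1 - R\<^sup>2) / (1 - cnj z * P v)\<^sup>2 *
        (of_real (h $ 1) * cis (v $ 2) + of_real (v $ 1) * (of_real (h $ 2) * (\<i> * cis (v $ 2)))))) (at v within S)"
      unfolding has_field_derivative_def by (rule has_derivative_compose)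
    moreover have "- of_real (1 - R\<^sup>2) / (1 - cnj z * P v)\<^sup>2 *
        (of_real (h $ 1) * cis (v $ 2) + of_real (v $ 1) * (of_real (h $ 2) * (\<i> * cis (v $ 2))))
        = A v * Complex (h $ 1) (v $ 1 * h $ 2)" for h :: "real^2"
    proof -
      have "- q / d * (a * c + p * (b * (\<i> * c))) = - q / d * c * (a + \<i> * (p * b))" for q d a c p b :: complex
        by (simp add: divide_inverse algebra_simps)
      then show ?thesis by (simp only: A_def Complex_eq of_real_mult)
    qed
    ultimately have "((\<lambda>v. M (P v)) has_derivative (\<lambda>h. A v * Complex (h $ 1) (v $ 1 * h $ 2))) (at v within S)"
      by (simp only:)
    then show ?thesis unfolding G'_def by (rule bounded_linear.has_derivative[OF bl])
  qed
  have det: "\<bar>det (matrix (G' v))\<bar> * green_kernel z (C (V (M (P v)))) = H v" if v: "v \<in> S" "v $ 1 \<noteq> 0" for v :: "real^2"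
  proof -
    have "det (matrix (G' v)) = v $ 1 * (norm (A v))\<^sup>2"
      unfolding G'_def V_def by (rule det_matrix_complex_linear)
    moreover have "norm (A v) = norm ((1 - (norm z)\<^sup>2) / (1 - cnj z * P v)\<^sup>2)"
      by (simp add: A_def R_def norm_mult norm_divide norm_minus_commute)
    moreover have "P v \<noteq> 0" using v(2) by (simp add: P_def)
    ultimately show ?thesis
      using green_kernel_moebius[OF z nP(2)[OF v(1)]] v nP(1)[OF v(1)]
      by (simp add: CV M_def H_def R_def S abs_mult)
  qed
  have contH: "continuous_on S H"
  proof -
    have "continuous_on S P" unfolding P_def cis_conv_exp by (intro continuous_intros)
    then show ?thesis unfolding H_def using nz by (intro continuous_intros) auto
  qed
  \<comment> \<open>At radius \<open>0\<close> the identity \<open>det\<close> fails: its left side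
    vanishes, whereas \<open>H\<close> equals \<open>1 - R\<^sup>2\<close>. The exceptional line is
    null.\<close>
  have negl: "negligible {v :: real^2. v $ 1 = 0}" by (rule negligible_standard_hyperplane_cart)
  have intH: "H integrable_on S" using contH unfolding S_def by (rule integrable_continuous)
  have spike: "\<bar>det (matrix (G' v))\<bar> * green_kernel z (C (V (M (P v)))) = H v" if "v \<in> S - {v. v $ 1 = 0}" for v
    using that det by auto
  \<comment> \<open>This form of the change of variables asks for no injectivity, which polar
    coordinates violate at radius \<open>0\<close> and at the angles \<open>0\<close> and
    \<open>2 * pi\<close>; the price is an inequality in place of an equality.\<close>
  have ub: "(\<lambda>v. green_kernel z (C v)) integrable_on ((\<lambda>v. V (M (P v))) ` S) \<and>
    integral ((\<lambda>v. V (M (P v))) ` S) (\<lambda>v. green_kernel z (C v)) \<le>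
    integral S (\<lambda>v. \<bar>det (matrix (G' v))\<bar> * green_kernel z (C (V (M (P v)))))"
  proof (rule integral_on_image_ubound_nonneg)
    show "(\<lambda>v. \<bar>det (matrix (G' v))\<bar> * green_kernel z (C (V (M (P v))))) integrable_on S"
      by (rule integrable_spike[OF intH negl]) (use spike in simp)
    show "0 \<le> green_kernel z (C (V (M (P v))))" if "v \<in> S" for v
      using norm_moebius(4)[OF z nP(2)[OF that]] by (simp add: CV green_kernel_def M_def power_le_one)
  qed (rule der)
  have "integral S (\<lambda>v. \<bar>det (matrix (G' v))\<bar> * green_kernel z (C (V (M (P v))))) = integral S H"
    by (rule integral_spike[OF negl]) (use spike in simp)
  also have "\<dots> = integral {0..1} (\<lambda>x. integral {0..2*pi} (\<lambda>y. H (vector [x, y])))"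
    using contH unfolding S_def by (rule integral_cbox_vec2)
  \<comment> \<open>At radius \<open>x\<close> the angular integral is the circle integral with
    \<open>b = cnj z * of_real x\<close>.\<close>
  also have "\<dots> = integral {0..1} (\<lambda>x. 2 * pi * ((1 - R\<^sup>2) * (1 - x\<^sup>2) * (1 + R\<^sup>2 * x\<^sup>2) / (1 - R\<^sup>2 * x\<^sup>2)^3))"
  proof (rule integral_cong)
    fix x :: real assume x: "x \<in> {0..1}"
    have n: "norm (cnj z * of_real x) = R * x" using x by (simp add: norm_mult R_def)
    have "R * x \<le> R" using x by (intro mult_left_le) (auto simp: R_def)
    then have "R * x < 1" using z by (simp add: R_def)
    then have "((\<lambda>t. (1 - R\<^sup>2) * (1 - x\<^sup>2) * (1 / (norm (1 - cnj z * of_real x * cis t))^4)) has_integral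
      (1 - R\<^sup>2) * (1 - x\<^sup>2) * (2 * pi * (1 + (R * x)\<^sup>2) / (1 - (R * x)\<^sup>2)^3)) {0..2*pi}"
      using has_integral_inverse_pow4_circle[of "cnj z * of_real x"] unfolding n
      by (intro has_integral_mult_right)
    then show "integral {0..2*pi} (\<lambda>y. H (vector [x, y])) =
      2 * pi * ((1 - R\<^sup>2) * (1 - x\<^sup>2) * (1 + R\<^sup>2 * x\<^sup>2) / (1 - R\<^sup>2 * x\<^sup>2)^3)"
    proof (intro integral_unique)
      assume I: "((\<lambda>t. (1 - R\<^sup>2) * (1 - x\<^sup>2) * (1 / (norm (1 - cnj z * of_real x * cis t))^4)) has_integral
        (1 - R\<^sup>2) * (1 - x\<^sup>2) * (2 * pi * (1 + (R * x)\<^sup>2) / (1 - (R * x)\<^sup>2)^3)) {0..2*pi}"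
      have "q * m * (2 * pi * a / b) = 2 * pi * (q * m * a / b)" for q m a b :: real
        by simp
      moreover have "H (vector [x, y]) = (1 - R\<^sup>2) * (1 - x\<^sup>2) * (1 / (norm (1 - cnj z * of_real x * cis y))^4)" for y
        by (simp add: H_def P_def mult.assoc)
      ultimately show "((\<lambda>y. H (vector [x, y])) has_integral
        2 * pi * ((1 - R\<^sup>2) * (1 - x\<^sup>2) * (1 + R\<^sup>2 * x\<^sup>2) / (1 - R\<^sup>2 * x\<^sup>2)^3)) {0..2*pi}"
        using I by (simp only: power_mult_distrib)
    qed
  qed
  also have "\<dots> = 2 * pi * area_factor R"
    using radial_has_integral[of R] z by (intro integral_unique has_integral_mult_right) (auto simp: R_def)
  finally have le: "integral ((\<lambda>v. V (M (P v))) ` S) (\<lambda>v. green_kernel z (C v)) \<le> 2 * pi * area_factor R"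
    using ub by simp
  have meas: "(\<lambda>w. ennreal (green_kernel z w) * indicator (ball 0 1) w) \<in> borel_measurable borel"
  proof -
    have [measurable]: "ball (0::complex) 1 \<in> sets borel" by simp
    show ?thesis unfolding green_kernel_def by measurable
  qed
  have mC: "C \<in> borel_measurable borel"
    unfolding C_def by (intro borel_measurable_continuous_onI) (auto simp: Complex_eq intro!: continuous_intros)
  \<comment> \<open>Since \<open>M\<close> is its own inverse, a point of the disc is reached from
    the polar coordinates of its image under \<open>M\<close>.\<close>
  have sub: "v \<in> (\<lambda>v. V (M (P v))) ` S" if "C v \<in> ball 0 1" for v
  proof -
    have n: "norm (C v) \<le> 1" using that by simp
    define u where "u = M (C v)"
    have u: "norm u \<le> 1" unfolding u_def M_def by (rule norm_moebius(4)[OF z n])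
    have "M u = C v"
    proof -
      have "1 - cnj z * C v \<noteq> 0" by (rule one_minus_cnj_mult_nonzero[OF z n])
      moreover have "complex_of_real (1 - (norm z)\<^sup>2) \<noteq> 0" using z abs_square_less_1[of "norm z"] by (simp only: of_real_eq_0_iff) simp
      ultimately show ?thesis
        unfolding M_def[of] using norm_moebius(2,3)[OF z n] by (simp add: u_def M_def)
    qed
    moreover have "u = P (vector [norm u, Arg2pi u])"
      by (simp add: P_def cis_conv_exp Arg2pi_eq)
    moreover have "vector [norm u, Arg2pi u] \<in> S" using u by (simp add: S Arg2pi_ge_0 Arg2pi less_imp_le)
    ultimately show ?thesis by (metis CV(2) image_eqI)
  qed
  have "(\<integral>\<^sup>+ w. ennreal (green_kernel z w) * indicator (ball 0 1) w \<partial>lborel)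
    = (\<integral>\<^sup>+ w. ennreal (green_kernel z w) * indicator (ball 0 1) w \<partial>(distr (lborel :: (real^2) measure) borel C))"
    by (simp only: C_def distr_lborel_complex)
  also have "\<dots> = (\<integral>\<^sup>+ v. ennreal (green_kernel z (C v)) * indicator (ball 0 1) (C v) \<partial>lborel)"
    using mC meas by (intro nn_integral_distr) auto
  also have "\<dots> \<le> (\<integral>\<^sup>+ v. ennreal (green_kernel z (C v)) * indicator ((\<lambda>v. V (M (P v))) ` S) v \<partial>lborel)"
    using sub by (intro nn_integral_mono mult_left_mono) (auto simp: indicator_def)
  also have "\<dots> = ennreal (integral ((\<lambda>v. V (M (P v))) ` S) (\<lambda>v. green_kernel z (C v)))"
  proof (rule nn_integral_has_integral_lebesgue')
    fix v assume "v \<in> (\<lambda>v. V (M (P v))) ` S"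
    then obtain v' where "v' \<in> S" "v = V (M (P v'))" by blast
    then show "0 \<le> green_kernel z (C v)"
      using norm_moebius(4)[OF z nP(2)] by (simp add: CV green_kernel_def M_def power_le_one)
  qed (use ub in blast)
  also have "\<dots> \<le> ennreal (2 * pi * area_factor (norm z))"
    using le by (intro ennreal_leI) (simp add: R_def)
  finally show ?thesis .
qed

subsection \<open>Lipschitz estimate for the Green potential\<close>

text \<open>The difference of the two sides has the derivative
  \<open>(1 - 1 / x)\<^sup>2 / 2\<close>. For a quotient \<open>t = N / D\<close> the bound equals
  \<open>(N\<^sup>2 - D\<^sup>2) / (2 * D * N)\<close>, which is the shape of
  \<open>green_kernel\<close>.\<close>

lemma ln_le_half_diff_inverse:
  fixes t :: real
  assumes "1 \<le> t"
  shows "ln t \<le> (t - 1 / t) / 2"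
proof -
  have "(1 - 1 / 1) / 2 - ln 1 \<le> (t - 1 / t) / 2 - ln t"
  proof (rule DERIV_nonneg_imp_nondecreasing[OF assms])
    fix x :: real assume x: "1 \<le> x" "x \<le> t"
    have "((\<lambda>x. (x - 1 / x) / 2 - ln x) has_real_derivative (1 - (0 * x - 1 * 1) / (x * x)) / 2 - 1 / x) (at x)"
      using x by (auto intro!: derivative_eq_intros)
    also have "(1 - (0 * x - 1 * 1) / (x * x)) / 2 - 1 / x = (1 - 1 / x)\<^sup>2 / 2"
      using x by (simp add: field_simps power2_eq_square)
    finally show "\<exists>y. ((\<lambda>x. (x - 1 / x) / 2 - ln x) has_real_derivative y) (at x) \<and> 0 \<le> y" by force
  qed
  then show ?thesis by simp
qed

lemma norm_one_minus_mult_cnj: "norm (1 - z * cnj w) = norm (1 - cnj z * w)"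
  by (metis complex_cnj_cnj complex_cnj_diff complex_cnj_mult complex_cnj_one complex_mod_cnj)

text \<open>Domination by the kernel gives the integrability of Green's function from the area
  integral already computed. It rests on the factorisation of \<open>N\<^sup>2 - D\<^sup>2\<close>
  in \<open>ND\<close>, inserted into \<open>ln_le_half_diff_inverse\<close>.\<close>

lemma green_nonneg_le_kernel:
  assumes z: "norm z < 1" and w: "norm w < 1"
  shows "0 \<le> green z w" "green z w \<le> (1 - (norm z)\<^sup>2) / 2 * green_kernel z w"
proof -
  define N where "N = norm (1 - cnj z * w)"
  define D where "D = norm (z - w)"
  have N: "N > 0" using one_minus_cnj_mult_nonzero[OF z] w by (simp add: N_def)
  have ND: "N\<^sup>2 - D\<^sup>2 = (1 - (norm z)\<^sup>2) * (1 - (norm w)\<^sup>2)"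
    unfolding cmod_power2 N_def D_def by (simp add: algebra_simps power2_eq_square)
  have "0 \<le> green z w \<and> green z w \<le> (1 - (norm z)\<^sup>2) / 2 * green_kernel z w"
  proof (cases "D = 0")
    \<comment> \<open>On the diagonal both sides are \<open>0\<close>, by the conventions for
      division by zero and for \<open>ln 0\<close>.\<close>
    case True
    then show ?thesis by (simp add: green_def green_kernel_def D_def)
  next
    case False
    then have D: "D > 0" by (simp add: D_def)
    have "0 \<le> (1 - (norm z)\<^sup>2) * (1 - (norm w)\<^sup>2)"
      using z w by (intro mult_nonneg_nonneg) (auto simp: power_le_one)
    then have "D\<^sup>2 \<le> N\<^sup>2" using ND by linarith
    then have "D \<le> N" by (rule power2_le_imp_le) (use N in simp)
    then have t: "1 \<le> N / D" using D by simp
    have g: "green z w = ln (N / D)"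
      by (simp add: green_def norm_divide norm_one_minus_mult_cnj N_def D_def)
    have "(N / D - 1 / (N / D)) / 2 = (N\<^sup>2 - D\<^sup>2) / 2 / (D * N)"
    proof -
      have "(n / d - 1 / (n / d)) / 2 = (n\<^sup>2 - d\<^sup>2) / 2 / (d * n)" if "n \<noteq> 0" "d \<noteq> 0" for n d :: real
        using that by (simp add: diff_frac_eq power2_eq_square)
      then show ?thesis using N D by (metis less_irrefl)
    qed
    also have "\<dots> = (1 - (norm z)\<^sup>2) / 2 * green_kernel z w"
    proof -
      have "a * b / 2 / c = a / 2 * (b / c)" for a b c :: real by simp
      then show ?thesis unfolding ND green_kernel_def N_def[symmetric] D_def[symmetric] by blast
    qed
    finally have "ln (N / D) \<le> (1 - (norm z)\<^sup>2) / 2 * green_kernel z w"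
      using ln_le_half_diff_inverse[OF t] by (simp only:)
    then show ?thesis unfolding g using ln_ge_zero[OF t] by blast
  qed
  then show "0 \<le> green z w" "green z w \<le> (1 - (norm z)\<^sup>2) / 2 * green_kernel z w" by auto
qed

text \<open>The logarithm of the modulus is half the logarithm of an inner product, so the real part
  of the logarithmic derivative is obtained without choosing a branch of the complex logarithm along
  the path.\<close>

lemma has_real_derivative_ln_norm:
  fixes p :: "real \<Rightarrow> complex"
  assumes "(p has_vector_derivative p') (at s within S)" "p s \<noteq> 0"
  shows "((\<lambda>s. ln (norm (p s))) has_real_derivative Re (p' / p s)) (at s within S)"
proof -
  have eq: "ln (norm (p s)) = ln (p s \<bullet> p s) / 2" for s
    by (simp add: dot_square_norm ln_realpow)
  have pos: "p s \<bullet> p s > 0" using assms(2) by simp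
  have "((\<lambda>s. p s \<bullet> p s) has_real_derivative 2 * (p s \<bullet> p')) (at s within S)"
    unfolding has_field_derivative_def
    by (rule has_derivative_eq_rhs[OF has_derivative_inner[OF assms(1)[unfolded has_vector_derivative_def]
        assms(1)[unfolded has_vector_derivative_def]]]) (auto simp: fun_eq_iff inner_commute)
  then have "((\<lambda>s. ln (p s \<bullet> p s) / 2) has_real_derivative (1 / (p s \<bullet> p s) * (2 * (p s \<bullet> p'))) / 2) (at s within S)"
    using pos by (intro DERIV_cdivide DERIV_chain2[OF DERIV_ln_divide])
  moreover have "(1 / (p s \<bullet> p s) * (2 * (p s \<bullet> p'))) / 2 = Re (p' / p s)"
  proof -
    have "(1 / (p s \<bullet> p s) * (2 * (p s \<bullet> p'))) / 2 = (p s \<bullet> p') / (p s \<bullet> p s)" by simp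
    also have "\<dots> = Re (p' / p s)" by (simp add: Re_divide inner_complex_def power2_eq_square mult_ac)
    finally show ?thesis .
  qed
  ultimately show ?thesis by (simp add: eq)
qed

text \<open>The fundamental theorem of calculus is applied along the segment, which must avoid the
  pole \<open>w\<close>. The derivative is the real part of a complex number whose modulus is the
  integrand on the right.\<close>

lemma green_diff_le:
  assumes z: "norm z < 1" "norm z' < 1" and w: "norm w < 1" "w \<notin> closed_segment z z'"
  shows "ennreal \<bar>green z' w - green z w\<bar> \<le>
    (\<integral>\<^sup>+ s. ennreal (norm (z' - z) * green_kernel (z + of_real s * (z' - z)) w) * indicator {0..1} s \<partial>lborel)"
proof -
  define p where "p = (\<lambda>s::real. z + of_real s * (z' - z))"
  have seg: "p s \<in> closed_segment z z'" if "s \<in> {0..1}" for s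
    using that unfolding p_def closed_segment_def
    by (auto intro!: exI[of _ s] simp: scaleR_conv_of_real algebra_simps)
  have "closed_segment z z' \<subseteq> ball 0 1" using z by (intro closed_segment_subset) auto
  then have p1: "norm (p s) < 1" if "s \<in> {0..1}" for s using seg[OF that] by auto
  have n1: "p s - w \<noteq> 0" if "s \<in> {0..1}" for s using seg[OF that] w by auto
  have n2: "1 - cnj (p s) * w \<noteq> 0" "1 - p s * cnj w \<noteq> 0" if "s \<in> {0..1}" for s
    using one_minus_cnj_mult_nonzero[OF p1[OF that], of w] w(1) norm_one_minus_mult_cnj[of "p s" w] by auto
  have vd: "(p has_vector_derivative (z' - z)) (at s within {0..1})" for s
    unfolding p_def by (auto intro!: derivative_eq_intros)
  have vd2: "((\<lambda>s. 1 - p s * cnj w) has_vector_derivative (- (z' - z) * cnj w)) (at s within {0..1})" for s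
    by (rule has_vector_derivative_eq_rhs, (rule derivative_intros vd)+) (simp add: algebra_simps)
  define d where "d = (\<lambda>s. Re (- (z' - z) * cnj w / (1 - p s * cnj w)) - Re ((z' - z) / (p s - w)))"
  have "((\<lambda>s. ln (norm (1 - p s * cnj w)) - ln (norm (p s - w))) has_real_derivative d s) (at s within {0..1})"
    if "s \<in> {0..1}" for s
    unfolding d_def using n1[OF that] n2[OF that] vd2 has_vector_derivative_diff_const[THEN iffD2, OF vd]
    by (intro DERIV_diff has_real_derivative_ln_norm) auto
  moreover have gr: "ln (norm (1 - p s * cnj w)) - ln (norm (p s - w)) = green (p s) w" if "s \<in> {0..1}" for s
    using n1[OF that] n2[OF that] by (simp add: green_def norm_divide ln_div)
  ultimately have "(d has_integral (ln (norm (1 - p 1 * cnj w)) - ln (norm (p 1 - w))) - (ln (norm (1 - p 0 * cnj w)) - ln (norm (p 0 - w)))) {0..1}"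
    by (intro fundamental_theorem_of_calculus) (auto simp: has_real_derivative_iff_has_vector_derivative)
  then have int: "(d has_integral green z' w - green z w) {0..1}"
    using gr[of 0] gr[of 1] by (simp add: p_def)
  define k where "k = (\<lambda>s. norm (z' - z) * green_kernel (p s) w)"
  have dk: "norm (d s) \<le> k s" if "s \<in> {0..1}" for s
  proof -
    \<comment> \<open>Over the common denominator the terms containing \<open>p s\<close> cancel,
      which leaves the numerator \<open>1 - (norm w)\<^sup>2\<close> of the kernel.\<close>
    have "- (z' - z) * cnj w / (1 - p s * cnj w) - (z' - z) / (p s - w)
      = - (z' - z) * (1 - w * cnj w) / ((1 - p s * cnj w) * (p s - w))"
      using n1[OF that] n2[OF that] by (simp add: divide_simps) (simp add: algebra_simps)
    also have "1 - w * cnj w = of_real (1 - (norm w)\<^sup>2)"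
      by (simp only: of_real_diff of_real_1 complex_norm_square)
    finally have "norm (- (z' - z) * cnj w / (1 - p s * cnj w) - (z' - z) / (p s - w)) = k s"
      using w(1) norm_of_real[of "1 - (norm w)\<^sup>2", where 'a = complex]
      by (simp add: norm_divide norm_mult k_def green_kernel_def norm_one_minus_mult_cnj power_le_one mult_ac norm_minus_commute del: of_real_diff)
    moreover have "d s = Re (- (z' - z) * cnj w / (1 - p s * cnj w) - (z' - z) / (p s - w))" by (simp add: d_def)
    ultimately show ?thesis using abs_Re_le_cmod by (metis real_norm_def)
  qed
  have contp: "continuous_on {0..1} p" unfolding p_def by (intro continuous_intros)
  have contk: "continuous_on {0..1} k"
    unfolding k_def green_kernel_def using n1 n2(1) by (intro continuous_intros contp) auto
  have "\<bar>green z' w - green z w\<bar> = norm (integral {0..1} d)" using int by (simp add: integral_unique)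
  also have "\<dots> \<le> integral {0..1} k"
    by (rule integral_norm_bound_integral[OF has_integral_integrable[OF int] integrable_continuous_real[OF contk] dk])
  finally have le: "ennreal \<bar>green z' w - green z w\<bar> \<le> ennreal (integral {0..1} k)" by (rule ennreal_leI)
  have "(\<integral>\<^sup>+ s. ennreal (k s) * indicator {0..1} s \<partial>lborel) = ennreal (integral {0..1} k)"
  proof (rule nn_integral_has_integral_lebesgue')
    show "0 \<le> k s" if "s \<in> {0..1}" for s using dk[OF that] norm_ge_zero order_trans by blast
    show "(k has_integral integral {0..1} k) {0..1}"
      using contk by (intro integrable_integral integrable_continuous_real)
  qed
  with le show ?thesis by (simp add: k_def p_def)
qed

lemma AE_not_in_closed_segment: "AE w in lborel. w \<notin> closed_segment z (z' :: complex)"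
proof -
  have "negligible (closed_segment z z')"
    by (rule negligible_convex_interior[THEN iffD2]) (auto simp: interior_closed_segment_ge2)
  then have "closed_segment z z' \<in> null_sets lborel"
    by (simp add: negligible_iff_null_sets null_sets_completion_iff)
  then show ?thesis by (rule AE_not_in)
qed

text \<open>After the two integrations are exchanged, each point of the segment contributes the area
  integral of its own kernel, which is at most \<open>2 * pi * B\<close>. The points
  \<open>w\<close> on the segment, where the line integral is singular, form a null set in the
  plane.\<close>

lemma nn_integral_green_diff_le:
  assumes z: "norm z < 1" "norm z' < 1"
    and B: "\<And>u. u \<in> closed_segment z z' \<Longrightarrow> area_factor (norm u) \<le> B"
  shows "(\<integral>\<^sup>+ w. ennreal \<bar>green z' w - green z w\<bar> * indicator (ball 0 1) w \<partial>lborel)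
    \<le> ennreal (2 * pi * B * norm (z' - z))"
proof -
  have [measurable]: "ball (0::complex) 1 \<in> sets borel" "cnj \<in> borel_measurable borel"
    by (auto intro: borel_measurable_continuous_onI continuous_intros)
  define k where "k = (\<lambda>s w. ennreal (green_kernel (z + of_real s * (z' - z)) w) * indicator (ball 0 1) w)"
  have "(\<integral>\<^sup>+ w. ennreal \<bar>green z' w - green z w\<bar> * indicator (ball 0 1) w \<partial>lborel)
    \<le> (\<integral>\<^sup>+ w. (\<integral>\<^sup>+ s. ennreal (norm (z' - z)) * k s w * indicator {0..1} s \<partial>lborel) \<partial>lborel)"
  proof (rule nn_integral_mono_AE)
    show "AE w in lborel. ennreal \<bar>green z' w - green z w\<bar> * indicator (ball 0 1) w
      \<le> (\<integral>\<^sup>+ s. ennreal (norm (z' - z)) * k s w * indicator {0..1} s \<partial>lborel)"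
      using AE_not_in_closed_segment[of z z']
    proof eventually_elim
      case (elim w)
      show ?case
      proof (cases "w \<in> ball 0 1")
        case True
        then show ?thesis
          using green_diff_le[OF z _ elim] by (simp add: k_def ennreal_mult')
      qed simp
    qed
  qed
  also have "\<dots> = (\<integral>\<^sup>+ s. (\<integral>\<^sup>+ w. ennreal (norm (z' - z)) * k s w * indicator {0..1} s \<partial>lborel) \<partial>lborel)"
    by (rule lborel_pair.Fubini'[symmetric]) (simp add: k_def green_kernel_def split_beta')
  also have "\<dots> \<le> (\<integral>\<^sup>+ s. ennreal (2 * pi * B * norm (z' - z)) * indicator {0..1::real} s \<partial>lborel)"
  proof (rule nn_integral_mono)
    fix s :: real
    show "(\<integral>\<^sup>+ w. ennreal (norm (z' - z)) * k s w * indicator {0..1} s \<partial>lborel)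
      \<le> ennreal (2 * pi * B * norm (z' - z)) * indicator {0..1} s"
    proof (cases "s \<in> {0..1}")
      case True
      let ?u = "z + of_real s * (z' - z)"
      have u: "?u \<in> closed_segment z z'"
        using True unfolding closed_segment_def
        by (auto intro!: exI[of _ s] simp: scaleR_conv_of_real algebra_simps)
      moreover have "closed_segment z z' \<subseteq> ball 0 1" using z by (intro closed_segment_subset) auto
      ultimately have "norm ?u < 1" by auto
      then have "(\<integral>\<^sup>+ w. k s w \<partial>lborel) \<le> ennreal (2 * pi * area_factor (norm ?u))"
        unfolding k_def by (rule nn_integral_green_kernel_le)
      also have "\<dots> \<le> ennreal (2 * pi * B)" using B[OF u] by (intro ennreal_leI) simp
      finally have "ennreal (norm (z' - z)) * (\<integral>\<^sup>+ w. k s w \<partial>lborel) \<le> ennreal (norm (z' - z)) * ennreal (2 * pi * B)"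
        by (rule mult_left_mono) simp
      moreover have "(\<integral>\<^sup>+ w. ennreal (norm (z' - z)) * k s w \<partial>lborel) = ennreal (norm (z' - z)) * (\<integral>\<^sup>+ w. k s w \<partial>lborel)"
        by (rule nn_integral_cmult) (simp add: k_def green_kernel_def)
      ultimately show ?thesis using True by (simp add: mult.commute flip: ennreal_mult')
    qed simp
  qed
  also have "\<dots> = ennreal (2 * pi * B * norm (z' - z))" by (simp add: nn_integral_cmult_indicator)
  finally show ?thesis .
qed

text \<open>A real \<open>SUP\<close> is an upper bound only for sets bounded above; boundedness
  therefore accompanies every use of \<open>disc_norm\<close>.\<close>

lemma norm_le_disc_norm:
  assumes "bdd_above ((\<lambda>z. norm (h z)) ` ball 0 1)" "norm z < 1"
  shows "norm (h z) \<le> disc_norm h"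
  unfolding disc_norm_def using assms by (intro cSUP_upper) auto

lemma disc_norm_nonneg:
  assumes "bdd_above ((\<lambda>z. norm (h z)) ` ball 0 1)"
  shows "0 \<le> disc_norm h"
  using order_trans[OF norm_ge_zero norm_le_disc_norm[OF assms, of 0]] by simp

lemma bdd_above_norm_continuous_cball:
  assumes "continuous_on (cball 0 1) (g :: complex \<Rightarrow> complex)"
  shows "bdd_above ((\<lambda>z. norm (g z)) ` ball 0 1)"
proof -
  have "compact ((\<lambda>z. norm (g z)) ` cball 0 1)"
    using assms by (intro compact_continuous_image continuous_intros) auto
  then have "bdd_above ((\<lambda>z. norm (g z)) ` cball 0 1)"
    by (intro bounded_imp_bdd_above compact_imp_bounded)
  then show ?thesis by (rule bdd_above_mono) auto
qed

section \<open>Integrability of Green's function and the Lipschitz bound for the potential\<close>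

lemma borel_measurable_green: "green z \<in> borel_measurable borel"
proof -
  have [measurable]: "cnj \<in> borel_measurable borel"
    by (intro borel_measurable_continuous_onI continuous_intros)
  show ?thesis unfolding green_def[abs_def] by measurable
qed

lemma set_borel_measurable_green:
  fixes g :: "complex \<Rightarrow> complex"
  assumes "continuous_on (cball 0 1) g"
  shows "(\<lambda>w. indicator (ball 0 1) w *\<^sub>R (green z w *\<^sub>R g w)) \<in> borel_measurable borel"
proof -
  have "(\<lambda>w. indicator (ball 0 1) w *\<^sub>R g w) \<in> borel_measurable borel"
    using assms by (intro borel_measurable_continuous_on_indicator continuous_on_subset[OF assms]) auto
  then have "(\<lambda>w. green z w *\<^sub>R (indicator (ball 0 1) w *\<^sub>R g w)) \<in> borel_measurable borel"
    by (rule borel_measurable_scaleR[OF borel_measurable_green])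
  then show ?thesis by (simp add: mult.commute)
qed

text \<open>The integral of a non-integrable function is \<open>0\<close> by convention, so
  subtracting two potentials under the integral sign requires this. The integrand is dominated by a
  constant multiple of \<open>green_kernel\<close>.\<close>

lemma set_integrable_green:
  fixes g :: "complex \<Rightarrow> complex"
  assumes g: "continuous_on (cball 0 1) g" and z: "norm z < 1"
  shows "set_integrable lebesgue (ball 0 1) (\<lambda>w. green z w *\<^sub>R g w)"
  unfolding set_integrable_def
proof (rule integrableI_bounded)
  show "(\<lambda>w. indicator (ball 0 1) w *\<^sub>R green z w *\<^sub>R g w) \<in> borel_measurable lebesgue"
    using set_borel_measurable_green[OF g] by (intro measurable_completion) simp
  have [measurable]: "ball (0::complex) 1 \<in> sets borel" by simp
  note bdd = bdd_above_norm_continuous_cball[OF g]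
  define c where "c = (1 - (norm z)\<^sup>2) / 2 * disc_norm g"
  have c0: "c \<ge> 0" using z disc_norm_nonneg[OF bdd] by (simp add: c_def power_le_one)
  have "(\<integral>\<^sup>+ w. ennreal (norm (indicator (ball 0 1) w *\<^sub>R green z w *\<^sub>R g w)) \<partial>lebesgue)
    \<le> (\<integral>\<^sup>+ w. ennreal c * (ennreal (green_kernel z w) * indicator (ball 0 1) w) \<partial>lebesgue)"
  proof (rule nn_integral_mono)
    fix w :: complex
    show "ennreal (norm (indicator (ball 0 1) w *\<^sub>R green z w *\<^sub>R g w))
      \<le> ennreal c * (ennreal (green_kernel z w) * indicator (ball 0 1) w)"
    proof (cases "w \<in> ball 0 1")
      case True
      then have w: "norm w < 1" by simp
      have "norm (green z w *\<^sub>R g w) \<le> ((1 - (norm z)\<^sup>2) / 2 * green_kernel z w) * disc_norm g"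
      proof -
        have "green z w * norm (g w) \<le> ((1 - (norm z)\<^sup>2) / 2 * green_kernel z w) * disc_norm g"
          using green_nonneg_le_kernel[OF z w] norm_le_disc_norm[OF bdd w] by (intro mult_mono) (linarith | simp)+
        then show ?thesis using green_nonneg_le_kernel(1)[OF z w] by simp
      qed
      then have "ennreal (norm (green z w *\<^sub>R g w)) \<le> ennreal (c * green_kernel z w)"
        by (intro ennreal_leI) (simp add: c_def mult_ac)
      then show ?thesis using True c0 by (simp add: ennreal_mult')
    qed simp
  qed
  also have "\<dots> = (\<integral>\<^sup>+ w. ennreal c * (ennreal (green_kernel z w) * indicator (ball 0 1) w) \<partial>lborel)"
    by (rule nn_integral_completion)
  also have "\<dots> = ennreal c * (\<integral>\<^sup>+ w. ennreal (green_kernel z w) * indicator (ball 0 1) w \<partial>lborel)"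
    by (rule nn_integral_cmult) (simp add: green_kernel_def)
  also have "\<dots> \<le> ennreal c * ennreal (2 * pi * area_factor (norm z))"
    by (intro mult_left_mono nn_integral_green_kernel_le z) simp
  also have "\<dots> < \<infinity>" by (simp add: ennreal_mult_less_top)
  finally show "(\<integral>\<^sup>+ w. ennreal (norm (indicator (ball 0 1) w *\<^sub>R green z w *\<^sub>R g w)) \<partial>lebesgue) < \<infinity>" .
qed

text \<open>The bound \<open>B\<close> is required only along the segment; on small discs around
  \<open>z\<close> it can be taken arbitrarily close to \<open>area_factor (norm z)\<close>.\<close>

lemma green_potential_lipschitz:
  fixes g :: "complex \<Rightarrow> complex"
  assumes g: "continuous_on (cball 0 1) g" and z: "norm z < 1" "norm z' < 1"
    and B: "\<And>u. u \<in> closed_segment z z' \<Longrightarrow> area_factor (norm u) \<le> B" "0 \<le> B"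
  shows "norm (green_potential g z' - green_potential g z) \<le> disc_norm g * B * norm (z' - z)"
proof -
  note bdd = bdd_above_norm_continuous_cball[OF g]
  have [measurable]: "ball (0::complex) 1 \<in> sets borel" by simp
  have i: "set_integrable lebesgue (ball 0 1) (\<lambda>w. green z' w *\<^sub>R g w - green z w *\<^sub>R g w)"
    by (intro set_integral_diff(1) set_integrable_green g z)
  have "green_potential g z' - green_potential g z
    = (1 / (2 * pi)) *\<^sub>R (LINT w:ball 0 1|lebesgue. green z' w *\<^sub>R g w - green z w *\<^sub>R g w)"
    unfolding green_potential_def
    by (subst set_integral_diff(2)) (auto intro: set_integrable_green g z simp: scaleR_diff_right)
  then have "ennreal (norm (green_potential g z' - green_potential g z))
    = ennreal (1 / (2 * pi)) * ennreal (norm (LINT w:ball 0 1|lebesgue. green z' w *\<^sub>R g w - green z w *\<^sub>R g w))"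
    by (simp flip: ennreal_mult')
  also have "ennreal (norm (LINT w:ball 0 1|lebesgue. green z' w *\<^sub>R g w - green z w *\<^sub>R g w))
    \<le> (\<integral>\<^sup>+ w. ennreal (norm (indicator (ball 0 1) w *\<^sub>R (green z' w *\<^sub>R g w - green z w *\<^sub>R g w))) \<partial>lebesgue)"
    unfolding set_lebesgue_integral_def
    by (rule integral_norm_bound_ennreal) (use i in \<open>simp add: set_integrable_def\<close>)
  also have "\<dots> \<le> (\<integral>\<^sup>+ w. ennreal (disc_norm g) * (ennreal \<bar>green z' w - green z w\<bar> * indicator (ball 0 1) w) \<partial>lebesgue)"
  proof (rule nn_integral_mono)
    fix w :: complex
    show "ennreal (norm (indicator (ball 0 1) w *\<^sub>R (green z' w *\<^sub>R g w - green z w *\<^sub>R g w)))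
      \<le> ennreal (disc_norm g) * (ennreal \<bar>green z' w - green z w\<bar> * indicator (ball 0 1) w)"
    proof (cases "w \<in> ball 0 1")
      case True
      then have "norm (green z' w *\<^sub>R g w - green z w *\<^sub>R g w) \<le> disc_norm g * \<bar>green z' w - green z w\<bar>"
        using norm_le_disc_norm[OF bdd, of w] by (simp add: mult_right_mono mult.commute flip: scaleR_diff_left)
      then show ?thesis using True disc_norm_nonneg[OF bdd] by (simp add: ennreal_leI flip: ennreal_mult')
    qed simp
  qed
  also have "\<dots> = (\<integral>\<^sup>+ w. ennreal (disc_norm g) * (ennreal \<bar>green z' w - green z w\<bar> * indicator (ball 0 1) w) \<partial>lborel)"
    by (rule nn_integral_completion)
  also have "\<dots> = ennreal (disc_norm g) * (\<integral>\<^sup>+ w. ennreal \<bar>green z' w - green z w\<bar> * indicator (ball 0 1) w \<partial>lborel)"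
  proof (rule nn_integral_cmult)
    note [measurable] = borel_measurable_green
    show "(\<lambda>w. ennreal \<bar>green z' w - green z w\<bar> * indicator (ball 0 1) w) \<in> borel_measurable lborel"
      by measurable
  qed
  also have "\<dots> \<le> ennreal (disc_norm g) * ennreal (2 * pi * B * norm (z' - z))"
    by (intro mult_left_mono nn_integral_green_diff_le z B) auto
  finally have "ennreal (norm (green_potential g z' - green_potential g z))
    \<le> ennreal (1 / (2 * pi)) * (ennreal (disc_norm g) * ennreal (2 * pi * B * norm (z' - z)))"
    by (simp add: mult_left_mono)
  also have "\<dots> = ennreal (disc_norm g * B * norm (z' - z))"
    using disc_norm_nonneg[OF bdd] B(2) by (simp flip: ennreal_mult')
  finally show ?thesis
    using disc_norm_nonneg[OF bdd] B(2) by (simp add: ennreal_le_iff)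
qed

subsection \<open>Gradient estimate for bounded harmonic functions\<close>

lemma has_field_derivative_Moebius_function:
  assumes "norm a < 1"
  shows "(Moebius_function 0 a has_field_derivative 1 / (1 - (norm a)\<^sup>2)) (at a)"
proof -
  have nz: "1 - cnj a * a \<noteq> 0" by (rule one_minus_cnj_mult_nonzero) (use assms in auto)
  have "(Moebius_function 0 a has_field_derivative (1 * (1 - cnj a * a) - (a - a) * (- cnj a)) / ((1 - cnj a * a) * (1 - cnj a * a))) (at a)"
    unfolding Moebius_function_simple[abs_def] using nz by (auto intro!: derivative_eq_intros)
  also have "(1 * (1 - cnj a * a) - (a - a) * (- cnj a)) / ((1 - cnj a * a) * (1 - cnj a * a)) = 1 / (1 - cnj a * a)"
    using nz by simp
  also have "cnj a * a = of_real ((norm a)\<^sup>2)" by (simp only: complex_norm_square mult.commute)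
  finally show ?thesis by simp
qed

text \<open>Composing \<open>\<omega>\<close> with disc automorphisms that carry \<open>0\<close> to
  \<open>a\<close> before it and \<open>\<omega> a\<close> to \<open>0\<close> after it reduces the
  claim to the Schwarz lemma at the origin.\<close>

lemma Schwarz_Pick:
  assumes hol: "\<omega> holomorphic_on ball 0 1" and im: "\<And>z. norm z < 1 \<Longrightarrow> norm (\<omega> z) < 1"
    and a: "norm a < 1"
  shows "norm (deriv \<omega> a) \<le> (1 - (norm (\<omega> a))\<^sup>2) / (1 - (norm a)\<^sup>2)"
proof -
  define b where "b = \<omega> a"
  have b: "norm b < 1" using im[OF a] by (simp add: b_def)
  define h where "h = (\<lambda>u. Moebius_function 0 b (\<omega> (Moebius_function 0 (- a) u)))"
  have ma: "norm (Moebius_function 0 (- a) u) < 1" if "norm u < 1" for u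
    using Moebius_function_norm_lt_1[of "- a" u 0] a that by simp
  have "h holomorphic_on ball 0 1"
  proof -
    have "(\<lambda>u. \<omega> (Moebius_function 0 (- a) u)) holomorphic_on ball 0 1"
      by (rule holomorphic_on_compose_gen[OF Moebius_function_holomorphic hol, unfolded o_def]) (use a ma in auto)
    then show ?thesis unfolding h_def
      by (rule holomorphic_on_compose_gen[OF _ Moebius_function_holomorphic[OF b], unfolded o_def]) (use ma im in auto)
  qed
  moreover have "norm (h u) < 1" if "norm u < 1" for u
    unfolding h_def by (intro Moebius_function_norm_lt_1 b im ma that)
  moreover have m0: "Moebius_function 0 (- a) 0 = a" by (simp add: Moebius_function_of_zero)
  then have "h 0 = 0" by (simp add: h_def b_def Moebius_function_eq_zero)
  ultimately have le: "norm (deriv h 0) \<le> 1"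
    using Schwarz_Lemma(2)[of h 0] by simp
  have D1: "(Moebius_function 0 (- a) has_field_derivative (1 - a * cnj a)) (at 0)"
    unfolding Moebius_function_simple[abs_def] by (auto intro!: derivative_eq_intros)
  have D2: "(\<omega> has_field_derivative deriv \<omega> a) (at a)"
    using hol a by (intro holomorphic_derivI[of _ "ball 0 1"]) auto
  have nb: "1 - b * cnj b = of_real (1 - (norm b)\<^sup>2)" "1 - a * cnj a = of_real (1 - (norm a)\<^sup>2)"
    by (simp_all only: of_real_diff of_real_1 complex_norm_square)
  have pb: "0 < 1 - (norm b)\<^sup>2" "0 < 1 - (norm a)\<^sup>2" using a b by (simp_all add: abs_square_less_1)
  have D3: "(Moebius_function 0 b has_field_derivative (1 / (1 - b * cnj b))) (at b)"
    unfolding nb(1) using has_field_derivative_Moebius_function[OF b] by simp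
  have "((\<lambda>u. \<omega> (Moebius_function 0 (- a) u)) has_field_derivative deriv \<omega> a * (1 - a * cnj a)) (at 0)"
    by (rule DERIV_chain2[OF _ D1]) (simp add: m0 D2)
  then have "(h has_field_derivative (1 / (1 - b * cnj b)) * (deriv \<omega> a * (1 - a * cnj a))) (at 0)"
    unfolding h_def by (rule DERIV_chain2[rotated]) (use D3 in \<open>simp add: m0 b_def\<close>)
  then have dh: "deriv h 0 = (1 / (1 - b * cnj b)) * (deriv \<omega> a * (1 - a * cnj a))" by (rule DERIV_imp_deriv)
  have "norm (deriv h 0) = norm (deriv \<omega> a) * (1 - (norm a)\<^sup>2) / (1 - (norm b)\<^sup>2)"
    unfolding dh nb norm_mult norm_divide norm_of_real using pb by simp
  with le pb show ?thesis by (simp add: b_def field_simps)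
qed

text \<open>The exponential \<open>E\<close> maps the strip to the right half-plane and the Cayley
  map continues to the disc, where Schwarz--Pick applies to \<open>\<omega>\<close>. The strict
  bound on the real part keeps the angle of \<open>E\<close> strictly inside the half-plane.\<close>

lemma deriv_bound_Re_less:
  assumes hol: "F holomorphic_on ball 0 1" and im: "\<And>z. norm z < 1 \<Longrightarrow> \<bar>Re (F z)\<bar> < M"
    and z: "norm z < 1"
  shows "norm (deriv F z) * (pi * (1 - (norm z)\<^sup>2) / 4) \<le> M"
proof -
  have M: "M > 0" using im[of 0] by (simp add: less_le_trans)
  define c where "c = \<i> * of_real (pi / (2 * M))"
  define E where "E = (\<lambda>z. exp (c * F z))"
  define \<omega> where "\<omega> = (\<lambda>z. (E z - 1) / (E z + 1))"
  have ReE: "Re (E z) > 0" if "norm z < 1" for z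
  proof -
    have "pi / (2 * M) * \<bar>Re (F z)\<bar> < pi / (2 * M) * M"
      using M by (intro mult_strict_left_mono im that) simp
    then have "\<bar>pi / (2 * M) * Re (F z)\<bar> < pi / (2 * M) * M"
      using M by (simp only: abs_mult) simp
    then have "\<bar>pi / (2 * M) * Re (F z)\<bar> < pi / 2" using M by simp
    then have "cos (pi / (2 * M) * Re (F z)) > 0" by (intro cos_gt_zero_pi) linarith+
    then show ?thesis by (simp add: E_def c_def Re_exp)
  qed
  have nz: "E z + 1 \<noteq> 0" if "norm z < 1" for z
  proof
    assume "E z + 1 = 0"
    then have "Re (E z) = - 1" by (simp add: complex_eq_iff)
    then show False using ReE[OF that] by simp
  qed
  have id: "1 - (norm (\<omega> z))\<^sup>2 = 4 * Re (E z) / (norm (E z + 1))\<^sup>2" if "norm z < 1" for z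
  proof -
    have "(norm (E z + 1))\<^sup>2 - (norm (E z - 1))\<^sup>2 = 4 * Re (E z)"
      unfolding cmod_power2 by (simp add: algebra_simps power2_eq_square)
    moreover have "(norm (E z + 1))\<^sup>2 \<noteq> 0" using nz[OF that] by simp
    ultimately show ?thesis by (simp add: \<omega>_def norm_divide power_divide diff_divide_eq_iff)
  qed
  have holE: "E holomorphic_on ball 0 1" unfolding E_def by (intro holomorphic_intros hol)
  have "norm (\<omega> z) < 1" if "norm z < 1" for z
  proof -
    have "0 < 1 - (norm (\<omega> z))\<^sup>2" unfolding id[OF that] using ReE[OF that] nz[OF that] by simp
    then show ?thesis by (simp add: abs_square_less_1)
  qed
  moreover have "\<omega> holomorphic_on ball 0 1"
    unfolding \<omega>_def using nz by (intro holomorphic_intros holE) auto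
  ultimately have SP: "norm (deriv \<omega> z) \<le> (1 - (norm (\<omega> z))\<^sup>2) / (1 - (norm z)\<^sup>2)"
    using Schwarz_Pick z by blast
  have DF: "(F has_field_derivative deriv F z) (at z)"
    using hol z by (intro holomorphic_derivI[of _ "ball 0 1"]) auto
  have DE: "(E has_field_derivative E z * (c * deriv F z)) (at z)"
    unfolding E_def by (intro DERIV_chain2[OF DERIV_exp] DERIV_cmult DF)
  have "(\<omega> has_field_derivative ((E z * (c * deriv F z)) * (E z + 1) - (E z - 1) * (E z * (c * deriv F z))) / ((E z + 1) * (E z + 1))) (at z)"
    unfolding \<omega>_def using nz[OF z] by (auto intro!: derivative_eq_intros DE)
  also have "(E z * (c * deriv F z)) * (E z + 1) - (E z - 1) * (E z * (c * deriv F z)) = 2 * (E z * (c * deriv F z))"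
    by (simp add: algebra_simps)
  finally have "deriv \<omega> z = 2 * (E z * (c * deriv F z)) / ((E z + 1) * (E z + 1))" by (rule DERIV_imp_deriv)
  moreover have "norm c = pi / (2 * M)" using M by (simp add: c_def norm_mult del: of_real_divide)
  ultimately have nd: "norm (deriv \<omega> z) = 2 * (norm (E z) * (pi / (2 * M) * norm (deriv F z))) / (norm (E z + 1))\<^sup>2"
    by (simp add: norm_mult norm_divide power2_eq_square)
  define q where "q = 1 - (norm z)\<^sup>2"
  define d where "d = (norm (E z + 1))\<^sup>2"
  have q: "q > 0" using z by (simp add: q_def abs_square_less_1)
  have d: "d > 0" using nz[OF z] by (simp add: d_def)
  have e: "norm (E z) > 0" by (simp add: E_def)
  \<comment> \<open>The identity \<open>id\<close> puts \<open>Re (E z)\<close> into the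
    Schwarz--Pick bound; replacing it by the modulus loses nothing precisely where
    \<open>Re (F z)\<close> is zero.\<close>
  have "Re (E z) \<le> norm (E z)" by (rule complex_Re_le_cmod)
  then have "4 * Re (E z) / d / q \<le> 4 * norm (E z) / d / q"
    using d q by (intro divide_right_mono) auto
  with SP have "2 * (norm (E z) * (pi / (2 * M) * norm (deriv F z))) / d \<le> 4 * norm (E z) / d / q"
    unfolding nd id[OF z] d_def q_def by linarith
  then have "2 * (norm (E z) * (pi / (2 * M) * norm (deriv F z))) / d * (d * q * M / (4 * norm (E z)))
     \<le> 4 * norm (E z) / d / q * (d * q * M / (4 * norm (E z)))"
    using d q M e by (intro mult_right_mono) auto
  moreover have "2 * (n * (pi / (2 * m) * x)) / d * (d * q * m / (4 * n)) = x * (pi * q / 4)"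
    if "n \<noteq> 0" "m \<noteq> 0" "d \<noteq> 0" for n m x d q :: real
    using that by simp
  moreover have "4 * n / d / q * (d * q * m / (4 * n)) = m"
    if "n \<noteq> 0" "d \<noteq> 0" "q \<noteq> 0" for n m d q :: real
    using that by simp
  ultimately show ?thesis using d q M e unfolding q_def[symmetric] by (metis less_irrefl)
qed

text \<open>With a weak inequality the strip may be attained, for instance by a constant; every
  larger \<open>M'\<close> gives the strict version, and the derivative bound survives the passage
  to \<open>M\<close>.\<close>

lemma deriv_bound_Re_le:
  assumes hol: "F holomorphic_on ball 0 1" and im: "\<And>z. norm z < 1 \<Longrightarrow> \<bar>Re (F z)\<bar> \<le> M"
    and z: "norm z < 1"
  shows "norm (deriv F z) \<le> 4 * M / pi * (1 / (1 - (norm z)\<^sup>2))"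
proof -
  have "norm (deriv F z) * (pi * (1 - (norm z)\<^sup>2) / 4) \<le> M"
  proof (rule dense_ge)
    fix M' assume "M < M'"
    then show "norm (deriv F z) * (pi * (1 - (norm z)\<^sup>2) / 4) \<le> M'"
      using im by (intro deriv_bound_Re_less[OF hol _ z]) (auto intro: le_less_trans)
  qed
  moreover have "0 < 1 - (norm z)\<^sup>2" using z by (simp add: abs_square_less_1)
  ultimately show ?thesis by (simp add: field_simps)
qed

lemma has_derivative_holomorphic_add_cnj:
  assumes h1: "h1 holomorphic_on ball 0 1" and h2: "h2 holomorphic_on ball 0 1"
    and p: "\<And>z. norm z < 1 \<Longrightarrow> p z = h1 z + cnj (h2 z)" and z: "norm z < 1"
  shows "(p has_derivative (\<lambda>\<xi>. deriv h1 z * \<xi> + cnj (deriv h2 z * \<xi>))) (at z)"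
proof -
  have "(h1 has_derivative (*) (deriv h1 z)) (at z)" "(h2 has_derivative (*) (deriv h2 z)) (at z)"
    using holomorphic_derivI[OF h1 open_ball, of z] holomorphic_derivI[OF h2 open_ball, of z] z
    by (auto simp: has_field_derivative_def)
  then have "((\<lambda>z. h1 z + cnj (h2 z)) has_derivative (\<lambda>\<xi>. deriv h1 z * \<xi> + cnj (deriv h2 z * \<xi>))) (at z)"
    by (intro has_derivative_add bounded_linear.has_derivative[OF bounded_linear_cnj])
  then show ?thesis
    by (rule has_derivative_transform_within_open[of _ _ _ _ "ball 0 1"]) (use z p in auto)
qed

text \<open>For a fixed direction \<open>\<xi>\<close>, the rotation by \<open>\<beta>\<close> makes
  the derivative vector real. Conjugating the second summand does not change real parts, so the
  rotated harmonic function shares its real part with the holomorphic \<open>F\<close>, to which the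
  strip estimate applies.\<close>

lemma harmonic_derivative_bound:
  assumes h1: "h1 holomorphic_on ball 0 1" and h2: "h2 holomorphic_on ball 0 1"
    and M: "\<And>z. norm z < 1 \<Longrightarrow> norm (h1 z + cnj (h2 z)) \<le> M" and z: "norm z < 1"
  shows "norm (deriv h1 z * \<xi> + cnj (deriv h2 z * \<xi>)) \<le> 4 * M / pi * (1 / (1 - (norm z)\<^sup>2)) * norm \<xi>"
proof -
  define v where "v = deriv h1 z * \<xi> + cnj (deriv h2 z * \<xi>)"
  define \<beta> where "\<beta> = sgn v"
  have \<beta>: "norm \<beta> \<le> 1" by (simp add: \<beta>_def norm_sgn)
  define F where "F = (\<lambda>z. cnj \<beta> * h1 z + \<beta> * h2 z)"
  have ReF: "Re (cnj \<beta> * a + \<beta> * b) = Re (cnj \<beta> * (a + cnj b))" for a b by (simp add: algebra_simps)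
  have "F holomorphic_on ball 0 1" unfolding F_def by (intro holomorphic_intros h1 h2)
  moreover have "\<bar>Re (F w)\<bar> \<le> M" if "norm w < 1" for w
  proof -
    have "\<bar>Re (F w)\<bar> \<le> norm (cnj \<beta> * (h1 w + cnj (h2 w)))"
      unfolding F_def ReF by (rule abs_Re_le_cmod)
    also have "\<dots> \<le> 1 * M" unfolding norm_mult using \<beta> M[OF that] by (intro mult_mono) auto
    finally show ?thesis by simp
  qed
  ultimately have le: "norm (deriv F z) \<le> 4 * M / pi * (1 / (1 - (norm z)\<^sup>2))"
    using z by (rule deriv_bound_Re_le)
  have "(F has_field_derivative (cnj \<beta> * deriv h1 z + \<beta> * deriv h2 z)) (at z)"
    unfolding F_def using h1 h2 z
    by (intro DERIV_add DERIV_cmult holomorphic_derivI[of _ "ball 0 1"]) auto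
  then have "deriv F z = cnj \<beta> * deriv h1 z + \<beta> * deriv h2 z" by (rule DERIV_imp_deriv)
  then have "Re (deriv F z * \<xi>) = Re (cnj \<beta> * (deriv h1 z * \<xi>) + \<beta> * (deriv h2 z * \<xi>))"
    by (simp only: distrib_right mult.assoc)
  also have "\<dots> = Re (cnj \<beta> * v)" unfolding ReF v_def ..
  also have "cnj \<beta> * v = of_real (norm v)"
  proof (cases "v = 0")
    case False
    have "v * cnj v = of_real (norm v) * of_real (norm v)"
      using complex_norm_square[of v] by (simp add: power2_eq_square)
    with False show ?thesis by (simp add: \<beta>_def sgn_eq mult.commute)
  qed simp
  finally have "norm v = Re (deriv F z * \<xi>)" by simp
  also have "\<dots> \<le> norm (deriv F z) * norm \<xi>" using complex_Re_le_cmod[of "deriv F z * \<xi>"] by (simp add: norm_mult)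
  also have "\<dots> \<le> 4 * M / pi * (1 / (1 - (norm z)\<^sup>2)) * norm \<xi>"
    using le by (intro mult_right_mono) auto
  finally show ?thesis by (simp add: v_def)
qed

subsection \<open>The Poisson integral\<close>

text \<open>Used to differentiate under the integral sign: a quadratic remainder with a uniform
  constant replaces a limit theorem for difference quotients.\<close>

lemma has_derivative_quadratic_remainder:
  fixes f :: "'a::real_normed_vector \<Rightarrow> 'b::real_normed_vector"
  assumes "bounded_linear f'" "0 < e"
    and "\<And>y. dist y x < e \<Longrightarrow> norm (f y - f x - f' (y - x)) \<le> C * (norm (y - x))\<^sup>2"
  shows "(f has_derivative f') (at x)"
proof (rule has_derivativeI_sandwich[OF assms(2,1)])
  fix y assume "y \<noteq> x" "dist y x < e"
  then show "norm (f y - f x - f' (y - x)) / norm (y - x) \<le> C * norm (y - x)"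
    using assms(3)[of y] by (simp add: divide_le_eq power2_eq_square mult.assoc)
next
  show "((\<lambda>y. C * norm (y - x)) \<longlongrightarrow> 0) (at x)" by (rule tendsto_eq_intros refl | simp)+
qed

lemma set_integrable_mult_continuous:
  fixes u k :: "real \<Rightarrow> complex"
  assumes u: "set_integrable lebesgue {a..b} u" and k: "continuous_on {a..b} k"
  shows "set_integrable lebesgue {a..b} (\<lambda>t. k t * u t)"
proof -
  have "bounded (k ` {a..b})" using k by (intro compact_imp_bounded compact_continuous_image) auto
  then obtain B where "\<forall>x\<in>k ` {a..b}. norm x \<le> B" unfolding bounded_iff by blast
  then have B: "norm (k t) \<le> B" if "t \<in> {a..b}" for t using that by blast
  have m: "(\<lambda>t. indicator {a..b} t *\<^sub>R k t) \<in> borel_measurable lebesgue"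
    using k by (intro measurable_completion) (simp add: borel_measurable_continuous_on_indicator)
  have "integrable lebesgue (\<lambda>t. (indicator {a..b} t *\<^sub>R k t) * (indicator {a..b} t *\<^sub>R u t))"
  proof (rule Bochner_Integration.integrable_bound)
    show "integrable lebesgue (\<lambda>t. B *\<^sub>R (indicator {a..b} t *\<^sub>R u t))"
      using u unfolding set_integrable_def by (rule integrable_scaleR_right)
    show "(\<lambda>t. (indicator {a..b} t *\<^sub>R k t) * (indicator {a..b} t *\<^sub>R u t)) \<in> borel_measurable lebesgue"
      using m u by (intro borel_measurable_times) (auto simp: set_integrable_def dest: borel_measurable_integrable)
    show "AE t in lebesgue. norm ((indicator {a..b} t *\<^sub>R k t) * (indicator {a..b} t *\<^sub>R u t))
      \<le> norm (B *\<^sub>R (indicator {a..b} t *\<^sub>R u t))"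
      using B by (intro AE_I2) (auto simp: indicator_def norm_mult intro!: mult_right_mono order_trans[OF B abs_ge_self])
  qed
  moreover have "(\<lambda>t. (indicator {a..b} t *\<^sub>R k t) * (indicator {a..b} t *\<^sub>R u t)) = (\<lambda>t. indicator {a..b} t *\<^sub>R (k t * u t))"
    by (auto simp: indicator_def)
  ultimately show ?thesis by (simp add: set_integrable_def)
qed

lemma set_integrable_cnj:
  "set_integrable M A f \<Longrightarrow> set_integrable M A (\<lambda>x. cnj (f x))"
  unfolding set_integrable_def complex_cnj_scaleR[symmetric] by (rule integrable_cnj)

lemma continuous_on_cis_minus: "continuous_on S (\<lambda>t. cis (- t))"
  unfolding cis_conv_exp by (intro continuous_intros)

lemma one_minus_mult_cis_bound:
  assumes "norm z \<le> r" "r < 1"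
  shows "1 - r \<le> norm (1 - z * cis t)" "1 - z * cis t \<noteq> 0"
proof -
  have "norm (1::complex) - norm (z * cis t) \<le> norm (1 - z * cis t)" by (rule norm_triangle_ineq2)
  then show "1 - r \<le> norm (1 - z * cis t)" using assms by (simp add: norm_mult)
  then show "1 - z * cis t \<noteq> 0" using assms by auto
qed

text \<open>The Cauchy integral of the boundary function, left without the factor
  \<open>1 / (2 * pi)\<close> and written with \<open>cis (- t)\<close> in place of the inverse of
  \<open>cis t\<close>.\<close>

definition cauchy_transform :: "(real \<Rightarrow> complex) \<Rightarrow> complex \<Rightarrow> complex" where
  "cauchy_transform u z = (LINT t:{0..2*pi}|lebesgue. 1 / (1 - z * cis (- t)) * u t)"

lemma set_integrable_cauchy_transform:
  assumes u: "set_integrable lebesgue {0..2*pi} u" and z: "norm z < 1"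
  shows "set_integrable lebesgue {0..2*pi} (\<lambda>t. 1 / (1 - z * cis (- t)) * u t)"
  using one_minus_mult_cis_bound(2)[OF order_refl z]
  by (intro set_integrable_mult_continuous u continuous_intros continuous_on_cis_minus) auto

text \<open>The first-order Taylor remainder of the kernel has a closed form with the factor
  \<open>(y - z)\<^sup>2\<close> over three factors of modulus at least \<open>1 - r\<close>. It is
  thus quadratic in \<open>y - z\<close>, uniformly in \<open>t\<close>, and only the integral of
  \<open>norm (u t)\<close> enters.\<close>

lemma holomorphic_cauchy_transform:
  assumes u: "set_integrable lebesgue {0..2*pi} u"
  shows "cauchy_transform u holomorphic_on ball 0 1"
proof (rule holomorphic_onI)
  fix z :: complex assume "z \<in> ball 0 1"
  then have z: "norm z < 1" by simp
  \<comment> \<open>The midpoint between \<open>norm z\<close> and \<open>1\<close>: every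
    \<open>y\<close> closer to \<open>z\<close> than \<open>(1 - norm z) / 2\<close> still satisfies
    \<open>norm y \<le> r\<close>.\<close>
  define r where "r = (1 + norm z) / 2"
  have r: "norm z \<le> r" "r < 1" using z by (auto simp: r_def)
  define D where "D = (LINT t:{0..2*pi}|lebesgue. (cis (- t) / (1 - z * cis (- t))\<^sup>2) * u t)"
  define I where "I = (LINT t:{0..2*pi}|lebesgue. norm (u t))"
  have i2: "set_integrable lebesgue {0..2*pi} (\<lambda>t. (cis (- t) / (1 - z * cis (- t))\<^sup>2) * u t)"
    using one_minus_mult_cis_bound(2)[OF order_refl z]
    by (intro set_integrable_mult_continuous u continuous_intros continuous_on_cis_minus) auto
  have "(cauchy_transform u has_derivative (*) D) (at z)"
  proof (rule has_derivative_quadratic_remainder)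
    show "0 < (1 - norm z) / 2" using z by simp
    fix y assume y: "dist y z < (1 - norm z) / 2"
    have "norm y \<le> norm z + dist y z" unfolding dist_norm by norm
    then have y1: "norm y \<le> r" "norm y < 1" using y z by (auto simp: r_def field_simps)
    note iy = set_integrable_cauchy_transform[OF u y1(2)] and iz = set_integrable_cauchy_transform[OF u z]
    have eq: "cauchy_transform u y - cauchy_transform u z - D * (y - z)
      = (LINT t:{0..2*pi}|lebesgue. 1 / (1 - y * cis (- t)) * u t - 1 / (1 - z * cis (- t)) * u t
          - (cis (- t) / (1 - z * cis (- t))\<^sup>2) * u t * (y - z))"
      unfolding cauchy_transform_def D_def
        set_integral_diff(2)[OF set_integral_diff(1)[OF iy iz] set_integrable_mult_left[OF i2]]
        set_integral_diff(2)[OF iy iz] set_integral_mult_left ..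
    have "norm (cauchy_transform u y - cauchy_transform u z - D * (y - z))
      \<le> (LINT t:{0..2*pi}|lebesgue. (norm (y - z))\<^sup>2 / (1 - r)^3 * norm (u t))"
    proof -
      have e: "norm (1 / (1 - y * cis (- t)) * u t - 1 / (1 - z * cis (- t)) * u t
          - (cis (- t) / (1 - z * cis (- t))\<^sup>2) * u t * (y - z)) \<le> (norm (y - z))\<^sup>2 / (1 - r)^3 * norm (u t)" for t
      proof -
        let ?e = "cis (- t)" let ?A = "1 - y * ?e" let ?B = "1 - z * ?e"
        note b = one_minus_mult_cis_bound[OF r(1) r(2), of "- t"] one_minus_mult_cis_bound[OF y1(1) r(2), of "- t"]
        have gen: "1 / A * v - 1 / B * v - e / B\<^sup>2 * v * d = d\<^sup>2 * e\<^sup>2 / (A * B\<^sup>2) * v"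
          if "A \<noteq> 0" "B \<noteq> 0" "A = B - d * e" for A B v d e :: complex
        proof -
          have "1 / A * v - 1 / B * v - e / B\<^sup>2 * v * d = (B\<^sup>2 - A * B - A * e * d) / (A * B\<^sup>2) * v"
            using that(1,2) by (simp add: divide_simps power2_eq_square) (simp add: algebra_simps)
          also have "B\<^sup>2 - A * B - A * e * d = d\<^sup>2 * e\<^sup>2" using that(3) by algebra
          finally show ?thesis .
        qed
        have "1 / ?A * u t - 1 / ?B * u t - (?e / ?B\<^sup>2) * u t * (y - z) = (y - z)\<^sup>2 * ?e\<^sup>2 / (?A * ?B\<^sup>2) * u t"
          by (rule gen) (use b in \<open>auto simp: algebra_simps\<close>)
        also have "norm \<dots> = (norm (y - z))\<^sup>2 / (norm ?A * (norm ?B)\<^sup>2) * norm (u t)"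
          by (simp add: norm_mult norm_divide norm_power)
        also have "\<dots> \<le> (norm (y - z))\<^sup>2 / (1 - r)^3 * norm (u t)"
        proof -
          have "(1 - r) * (1 - r)\<^sup>2 \<le> norm ?A * (norm ?B)\<^sup>2"
            using b r by (intro mult_mono power_mono) auto
          then have le: "(1 - r)^3 \<le> norm ?A * (norm ?B)\<^sup>2" by (simp add: power3_eq_cube power2_eq_square mult.assoc)
          have "0 < (1 - r)^3" using r by simp
          with le show ?thesis by (intro mult_right_mono frac_le) auto
        qed
        finally show ?thesis .
      qed
      have "set_integrable lebesgue {0..2*pi} (\<lambda>t. norm (u t))"
        using u by (rule set_integrable_norm)
      then have "set_integrable lebesgue {0..2*pi} (\<lambda>t. (norm (y - z))\<^sup>2 / (1 - r)^3 * norm (u t))"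
        by (rule set_integrable_mult_right)
      note g = this[unfolded set_integrable_def]
      note f = set_integral_diff(1)[OF set_integral_diff(1)[OF iy iz] set_integrable_mult_left[OF i2, of "y - z"],
          unfolded set_integrable_def]
      have ind: "norm (indicator A t *\<^sub>R a) \<le> indicator A t *\<^sub>R b" if "norm a \<le> b"
        for A and t b :: real and a :: complex
        using that by (simp add: indicator_def)
      show ?thesis
        unfolding eq unfolding set_lebesgue_integral_def
        by (rule Bochner_Integration.integral_norm_bound_integral[OF f g ind[OF e]])
    qed
    also have "\<dots> = (norm (y - z))\<^sup>2 / (1 - r)^3 * I"
      unfolding I_def by (rule set_integral_mult_right)
    also have "\<dots> = I / (1 - r)^3 * (norm (y - z))\<^sup>2"
    proof -
      have "q / d * i = i / d * q" for q d i :: real by simp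
      then show ?thesis .
    qed
    finally show "norm (cauchy_transform u y - cauchy_transform u z - D * (y - z)) \<le> I / (1 - r)^3 * (norm (y - z))\<^sup>2" .
  qed (rule bounded_linear_mult_right)
  then show "cauchy_transform u field_differentiable at z within ball 0 1"
    unfolding field_differentiable_def has_field_derivative_def by (blast intro: has_derivative_at_withinI)
qed

text \<open>Because \<open>cis (- t)\<close> is unimodular, \<open>1 - (norm z)\<^sup>2\<close>
  equals \<open>2 * Re a - (norm a)\<^sup>2\<close> for \<open>a = 1 - z * cis (- t)\<close>;
  division by \<open>(norm a)\<^sup>2\<close> separates the holomorphic from the antiholomorphic
  part.\<close>

lemma poisson_kernel_cauchy:
  assumes "norm z < 1"
  shows "of_real (poisson_kernel z (cis t)) = 1 / (1 - z * cis (- t)) + cnj (1 / (1 - z * cis (- t))) - 1"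
proof -
  have nz: "1 - z * cis (- t) \<noteq> 0" using one_minus_mult_cis_bound(2)[OF order_refl assms] by blast
  let ?a = "1 - z * cis (- t)"
  have "1 - (norm z)\<^sup>2 = 2 * Re ?a - (norm ?a)\<^sup>2"
  proof -
    have "(1 - w) + cnj (1 - w) - (1 - w) * cnj (1 - w) = 1 - w * cnj w" for w
      by (simp add: algebra_simps)
    moreover have "z * cis (- t) * cnj (z * cis (- t)) = of_real ((norm z)\<^sup>2)"
      unfolding complex_norm_square[symmetric] by (simp add: norm_mult)
    ultimately have "complex_of_real (1 - (norm z)\<^sup>2) = ?a + cnj ?a - ?a * cnj ?a"
      by (simp only: of_real_diff of_real_1)
    also have "\<dots> = of_real (2 * Re ?a - (norm ?a)\<^sup>2)"
      by (simp only: complex_add_cnj complex_norm_square of_real_diff)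
    finally show ?thesis using of_real_eq_iff by blast
  qed
  then have "poisson_kernel z (cis t) = (2 * Re ?a - (norm ?a)\<^sup>2) / (norm ?a)\<^sup>2"
    by (simp add: poisson_kernel_def cis_cnj)
  then have "complex_of_real (poisson_kernel z (cis t)) = of_real (2 * Re ?a) / of_real ((norm ?a)\<^sup>2) - 1"
    using nz by (simp add: diff_divide_distrib)
  also have "\<dots> = (?a + cnj ?a) / (?a * cnj ?a) - 1"
    by (simp only: complex_add_cnj complex_norm_square)
  also have "\<dots> = 1 / ?a + cnj (1 / ?a) - 1"
  proof -
    have "(A + B) / (A * B) - 1 = 1 / A + 1 / B - 1" if "A \<noteq> 0" "B \<noteq> 0" for A B :: complex
      using that by (simp add: add_divide_distrib)
    then show ?thesis using nz by (simp only: complex_cnj_divide complex_cnj_one complex_cnj_zero_iff not_False_eq_True)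
  qed
  finally show ?thesis .
qed

text \<open>The splitting of the kernel is integrated against the boundary function. The
  antiholomorphic part is the conjugate of the Cauchy transform of the conjugated data, and the
  constant \<open>- 1\<close> of the kernel is absorbed into \<open>h1\<close>.\<close>

lemma poisson_integral_decomposition:
  assumes "bounded_L1_circle \<psi>"
  obtains h1 h2 where "h1 holomorphic_on ball 0 1" "h2 holomorphic_on ball 0 1"
    "\<And>z. norm z < 1 \<Longrightarrow> poisson_integral \<psi> z = h1 z + cnj (h2 z)"
proof -
  define u where "u = (\<lambda>t. \<psi> (cis t))"
  have u: "set_integrable lebesgue {0..2*pi} u" using assms by (simp add: bounded_L1_circle_def u_def)
  have cu: "set_integrable lebesgue {0..2*pi} (\<lambda>t. cnj (u t))"
    using u by (rule set_integrable_cnj)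
  define c where "c = complex_of_real (1 / (2 * pi))"
  define h1 where "h1 = (\<lambda>z. c * (cauchy_transform u z - (LINT t:{0..2*pi}|lebesgue. u t)))"
  define h2 where "h2 = (\<lambda>z. c * cauchy_transform (\<lambda>t. cnj (u t)) z)"
  have "poisson_integral \<psi> z = h1 z + cnj (h2 z)" if z: "norm z < 1" for z
  proof -
    have i3: "set_integrable lebesgue {0..2*pi} (\<lambda>t. cnj (1 / (1 - z * cis (- t)) * cnj (u t)))"
      by (rule set_integrable_cnj[OF set_integrable_cauchy_transform[OF cu z]])
    have "(LINT t:{0..2*pi}|lebesgue. poisson_kernel z (cis t) *\<^sub>R \<psi> (cis t))
      = (LINT t:{0..2*pi}|lebesgue. 1 / (1 - z * cis (- t)) * u t - u t + cnj (1 / (1 - z * cis (- t)) * cnj (u t)))"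
      unfolding u_def by (simp only: scaleR_conv_of_real poisson_kernel_cauchy[OF z]) (simp add: algebra_simps)
    also have "\<dots> = (cauchy_transform u z - (LINT t:{0..2*pi}|lebesgue. u t))
      + (LINT t:{0..2*pi}|lebesgue. cnj (1 / (1 - z * cis (- t)) * cnj (u t)))"
      unfolding cauchy_transform_def
      using set_integrable_cauchy_transform[OF u z] u i3
      by (simp only: set_integral_add set_integral_diff)
    also have "(LINT t:{0..2*pi}|lebesgue. cnj (1 / (1 - z * cis (- t)) * cnj (u t)))
      = cnj (cauchy_transform (\<lambda>t. cnj (u t)) z)"
      unfolding cauchy_transform_def set_lebesgue_integral_def Bochner_Integration.integral_cnj[symmetric] complex_cnj_scaleR ..
    finally have eq: "(LINT t:{0..2*pi}|lebesgue. poisson_kernel z (cis t) *\<^sub>R \<psi> (cis t))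
      = cauchy_transform u z - (LINT t:{0..2*pi}|lebesgue. u t) + cnj (cauchy_transform (\<lambda>t. cnj (u t)) z)" .
    have "cnj c = c" by (simp add: c_def)
    then show ?thesis
      unfolding poisson_integral_def eq unfolding h1_def h2_def scaleR_conv_of_real c_def[symmetric] complex_cnj_mult
      by (simp only: distrib_left)
  qed
  moreover have "h1 holomorphic_on ball 0 1" "h2 holomorphic_on ball 0 1"
    unfolding h1_def h2_def by (intro holomorphic_intros holomorphic_cauchy_transform u cu)+
  ultimately show ?thesis using that by blast
qed

lemma poisson_kernel_nonneg: "norm z < 1 \<Longrightarrow> 0 \<le> poisson_kernel z \<zeta>"
  by (simp add: poisson_kernel_def power_le_one)

lemma continuous_on_poisson_kernel:
  assumes "norm z < 1"
  shows "continuous_on S (\<lambda>t. poisson_kernel z (cis t))"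
proof -
  have "1 - z * cnj (cis t) \<noteq> 0" for t
    using one_minus_mult_cis_bound(2)[OF order_refl assms, of "- t"] by (simp add: cis_cnj)
  then show ?thesis unfolding poisson_kernel_def cis_conv_exp by (intro continuous_intros) auto
qed

text \<open>Cauchy's formula is applied to \<open>G u (1 - |z|\<^sup>2) / (1 - cnj z u)\<close>, which agrees with \<open>G\<close> at \<open>z\<close>
  and turns the Cauchy kernel on the circle into the Poisson kernel.\<close>

lemma poisson_integral_holomorphic:
  assumes cont: "continuous_on (cball 0 1) G" and hol: "G holomorphic_on ball 0 1" and z: "norm z < 1"
  shows "poisson_integral G z = G z"
proof -
  have nz: "1 - cnj z * u \<noteq> 0" if "norm u \<le> 1" for u
    using one_minus_cnj_mult_nonzero[OF z that] .
  define q where "q = 1 - z * cnj z"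
  define H where "H = (\<lambda>u. G u * q / (1 - cnj z * u))"
  have "continuous_on (cball 0 1) H"
    unfolding H_def using nz by (intro continuous_intros cont) auto
  moreover have "H holomorphic_on ball 0 1"
    unfolding H_def using nz by (intro holomorphic_intros hol) auto
  ultimately have "((\<lambda>u. H u / (u - z)) has_contour_integral (2 * of_real pi * \<i> * H z)) (circlepath 0 1)"
    using z by (intro Cauchy_integral_circlepath) auto
  moreover have "H z = G z" using nz[of z] z by (simp add: H_def q_def mult.commute)
  ultimately have "((\<lambda>t. H (cis t) / (cis t - z) * (\<i> * cis t)) has_integral (2 * of_real pi * \<i> * G z)) {0..2*pi}"
    by (simp add: circlepath_def has_contour_integral_part_circlepath_iff mult_ac)
  moreover have "H (cis t) / (cis t - z) * (\<i> * cis t) = \<i> * (poisson_kernel z (cis t) *\<^sub>R G (cis t))" for t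
  proof -
    have c: "cis t * cnj (cis t) = 1" by (simp add: cis_cnj cis_mult)
    have n1: "1 - z * cnj (cis t) \<noteq> 0"
      using one_minus_mult_cis_bound(2)[OF order_refl z, of "- t"] by (simp add: cis_cnj)
    have "cis t - z = cis t * (1 - z * cnj (cis t))" using c by (simp add: algebra_simps)
    then have "H (cis t) / (cis t - z) * (\<i> * cis t) = \<i> * (q / ((1 - z * cnj (cis t)) * (1 - cnj z * cis t)) * G (cis t))"
    proof -
      have "g * q / b / (c * a) * (\<i> * c) = \<i> * (q / (a * b) * g)" if "c \<noteq> 0" for g q a b c :: complex
        using that by (simp add: mult_ac)
      then show ?thesis by (simp only: H_def \<open>cis t - z = _\<close> cis_neq_zero not_False_eq_True)
    qed
    also have "(1 - z * cnj (cis t)) * (1 - cnj z * cis t) = of_real ((norm (1 - z * cnj (cis t)))\<^sup>2)"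
      unfolding complex_norm_square by simp
    also have "q = of_real (1 - (norm z)\<^sup>2)" unfolding q_def of_real_diff of_real_1 complex_norm_square ..
    finally show ?thesis by (simp add: poisson_kernel_def scaleR_conv_of_real)
  qed
  ultimately have "((\<lambda>t. \<i> * (poisson_kernel z (cis t) *\<^sub>R G (cis t))) has_integral (2 * of_real pi * \<i> * G z)) {0..2*pi}"
    by simp
  note I = this
  have "((\<lambda>t. poisson_kernel z (cis t) *\<^sub>R G (cis t)) has_integral (2 * of_real pi * G z)) {0..2*pi}"
  proof -
    have "- \<i> * (\<i> * w) = w" "- \<i> * (p * \<i> * w) = p * w" for p w :: complex
      by (simp_all add: complex_eq_iff)
    with has_integral_mult_right[OF I, of "- \<i>"] show ?thesis by (simp only:)
  qed
  moreover have "continuous_on {0..2*pi} (\<lambda>t. G (cis t))"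
    by (rule continuous_on_compose2[OF cont]) (auto simp: cis_conv_exp intro!: continuous_intros)
  then have "(\<lambda>t. poisson_kernel z (cis t) *\<^sub>R G (cis t)) absolutely_integrable_on {0..2*pi}"
    by (intro absolutely_integrable_continuous_real continuous_intros continuous_on_poisson_kernel z)
  ultimately have "(LINT t:{0..2*pi}|lebesgue. poisson_kernel z (cis t) *\<^sub>R G (cis t)) = 2 * of_real pi * G z"
    using set_lebesgue_integral_eq_integral(2) integral_unique by metis
  then show ?thesis by (simp add: poisson_integral_def scaleR_conv_of_real)
qed

text \<open>This makes \<open>disc_norm\<close> of a Poisson integral a genuine supremum. An
  essential bound of the data passes to the disc because the kernel is nonnegative and has total
  mass \<open>2 * pi\<close>.\<close>

lemma bdd_above_poisson_integral:
  assumes "bounded_L1_circle \<psi>"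
  shows "bdd_above ((\<lambda>z. norm (poisson_integral \<psi> z)) ` ball 0 1)"
proof -
  obtain B where B: "AE t\<in>{0..2*pi} in lebesgue. norm (\<psi> (cis t)) \<le> B"
    using assms by (auto simp: bounded_L1_circle_def)
  have u: "set_integrable lebesgue {0..2*pi} (\<lambda>t. \<psi> (cis t))" using assms by (simp add: bounded_L1_circle_def)
  have "norm (poisson_integral \<psi> z) \<le> B" if "z \<in> ball 0 1" for z
  proof -
    have z: "norm z < 1" using that by simp
    let ?k = "\<lambda>t. poisson_kernel z (cis t)"
    have ik: "set_integrable lebesgue {0..2*pi} ?k"
      using absolutely_integrable_continuous_real[OF continuous_on_poisson_kernel[OF z]] by blast
    have "continuous_on {0..2*pi} (\<lambda>t. complex_of_real (?k t))"
      by (intro continuous_intros continuous_on_poisson_kernel z)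
    from set_integrable_mult_continuous[OF u this]
    have iu: "set_integrable lebesgue {0..2*pi} (\<lambda>t. ?k t *\<^sub>R \<psi> (cis t))"
      by (simp add: scaleR_conv_of_real)
    \<comment> \<open>The reproducing property for the constant \<open>1\<close> gives the total
      mass of the kernel.\<close>
    have "poisson_integral (\<lambda>_. 1) z = 1" by (rule poisson_integral_holomorphic) (use z in auto)
    then have "(LINT t:{0..2*pi}|lebesgue. ?k t *\<^sub>R (1::complex)) = of_real (2 * pi)"
      by (simp add: poisson_integral_def scaleR_conv_of_real field_simps)
    moreover have "(LINT t:{0..2*pi}|lebesgue. ?k t *\<^sub>R (1::complex)) = of_real (LINT t:{0..2*pi}|lebesgue. ?k t)"
      unfolding set_lebesgue_integral_def by (simp add: scaleR_conv_of_real flip: of_real_mult)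
    ultimately have k: "(LINT t:{0..2*pi}|lebesgue. ?k t) = 2 * pi" by (metis of_real_eq_iff)
    have "norm (LINT t:{0..2*pi}|lebesgue. ?k t *\<^sub>R \<psi> (cis t)) \<le> (LINT t:{0..2*pi}|lebesgue. norm (?k t *\<^sub>R \<psi> (cis t)))"
      by (rule set_integral_norm_bound[OF iu])
    also have "\<dots> \<le> (LINT t:{0..2*pi}|lebesgue. ?k t * B)"
      unfolding set_lebesgue_integral_def
    proof (rule integral_mono_AE)
      show "integrable lebesgue (\<lambda>t. indicator {0..2*pi} t *\<^sub>R norm (?k t *\<^sub>R \<psi> (cis t)))"
        using set_integrable_norm[OF iu] by (simp add: set_integrable_def)
      show "integrable lebesgue (\<lambda>t. indicator {0..2*pi} t *\<^sub>R (?k t * B))"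
        using set_integrable_mult_left[OF ik, of B] by (simp add: set_integrable_def)
      show "AE t in lebesgue. indicator {0..2*pi} t *\<^sub>R norm (?k t *\<^sub>R \<psi> (cis t)) \<le> indicator {0..2*pi} t *\<^sub>R (?k t * B)"
        using B by eventually_elim (auto simp: indicator_def poisson_kernel_nonneg[OF z] intro!: mult_left_mono)
    qed
    also have "\<dots> = 2 * pi * B" using k by simp
    finally show ?thesis by (simp add: poisson_integral_def field_simps)
  qed
  then show ?thesis by (intro bdd_aboveI2)
qed

subsection \<open>Extremal functions\<close>

text \<open>This serves twice: for the gradient estimate, and later for bounding the norm of an
  extremal Poisson integral from below.\<close>

lemma poisson_integral_derivative_bound:
  assumes "bounded_L1_circle \<psi>" and z: "norm z < 1"
  obtains D where "(poisson_integral \<psi> has_derivative D) (at z)"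
    "\<And>\<xi>. norm (D \<xi>) \<le> 4 * disc_norm (poisson_integral \<psi>) / pi * (1 / (1 - (norm z)\<^sup>2)) * norm \<xi>"
proof -
  obtain h1 h2 where h: "h1 holomorphic_on ball 0 1" "h2 holomorphic_on ball 0 1"
    and eq: "\<And>z. norm z < 1 \<Longrightarrow> poisson_integral \<psi> z = h1 z + cnj (h2 z)"
    using poisson_integral_decomposition[OF assms(1)] by blast
  have "norm (h1 w + cnj (h2 w)) \<le> disc_norm (poisson_integral \<psi>)" if "norm w < 1" for w
    using norm_le_disc_norm[OF bdd_above_poisson_integral[OF assms(1)] that] eq[OF that] by simp
  with has_derivative_holomorphic_add_cnj[OF h eq z] harmonic_derivative_bound[OF h _ z] that show ?thesis
    by blast
qed

section \<open>Regularity and Jacobian norm of multiples of real parts of holomorphic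
  functions\<close>

lemma has_derivative_Re_scaled:
  assumes "F holomorphic_on S" "open S" "z \<in> S"
  shows "((\<lambda>z. c * complex_of_real (Re (F z))) has_derivative (\<lambda>\<xi>. c * of_real (Re (deriv F z * \<xi>)))) (at z)"
proof -
  have "(F has_derivative (*) (deriv F z)) (at z)"
    using holomorphic_derivI[OF assms] by (simp add: has_field_derivative_def)
  then have "((\<lambda>z. complex_of_real (Re (F z))) has_derivative (\<lambda>\<xi>. of_real (Re (deriv F z * \<xi>)))) (at z)"
    by (intro bounded_linear.has_derivative[OF bounded_linear_of_real] bounded_linear.has_derivative[OF bounded_linear_Re])
  then show ?thesis by (rule has_derivative_mult_right)
qed

text \<open>Both partial derivatives again have the form \<open>c\<close> times the real part of a
  holomorphic function, so the lemma can be applied to them in turn to obtain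
  \<open>C2_on\<close>.\<close>

lemma C1_on_Re_scaled:
  assumes F: "F holomorphic_on S" and S: "open S" and eq: "\<And>z. z \<in> S \<Longrightarrow> f z = c * complex_of_real (Re (F z))"
  shows "C1_on S f"
    and "\<And>z. z \<in> S \<Longrightarrow> partial_x f z = c * complex_of_real (Re (deriv F z))"
    and "\<And>z. z \<in> S \<Longrightarrow> partial_y f z = c * complex_of_real (Re (\<i> * deriv F z))"
proof -
  have der: "(f has_derivative (\<lambda>\<xi>. c * of_real (Re (deriv F z * \<xi>)))) (at z)" if "z \<in> S" for z
    by (rule has_derivative_transform_within_open[OF has_derivative_Re_scaled[OF F S that] S that]) (simp add: eq)
  have fd: "frechet_derivative f (at z) = (\<lambda>\<xi>. c * of_real (Re (deriv F z * \<xi>)))" if "z \<in> S" for z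
    using frechet_derivative_at[OF der[OF that]] by simp
  show x: "partial_x f z = c * complex_of_real (Re (deriv F z))" if "z \<in> S" for z
    by (simp add: partial_x_def fd[OF that])
  show y: "partial_y f z = c * complex_of_real (Re (\<i> * deriv F z))" if "z \<in> S" for z
    by (simp add: partial_y_def fd[OF that])
  have "continuous_on S (deriv F)"
    using F S by (intro holomorphic_on_imp_continuous_on holomorphic_deriv)
  then have "continuous_on S (\<lambda>z. c * complex_of_real (Re (deriv F z)))"
    "continuous_on S (\<lambda>z. c * complex_of_real (Re (\<i> * deriv F z)))"
    by (intro continuous_intros; assumption)+
  then have "continuous_on S (partial_x f)" "continuous_on S (partial_y f)"
    using x y by (simp_all cong: continuous_on_cong)
  then show "C1_on S f"
    unfolding C1_on_def differentiable_def using der by blast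
qed

lemma C2_on_Re_scaled:
  assumes F: "F holomorphic_on S" and S: "open S" and eq: "\<And>z. z \<in> S \<Longrightarrow> f z = c * complex_of_real (Re (F z))"
  shows "C2_on S f"
proof -
  have d: "deriv F holomorphic_on S" "(\<lambda>z. \<i> * deriv F z) holomorphic_on S"
    using F S by (auto intro!: holomorphic_intros holomorphic_deriv)
  show ?thesis
    unfolding C2_on_def
    using C1_on_Re_scaled(1)[OF F S eq] C1_on_Re_scaled(1)[OF d(1) S C1_on_Re_scaled(2)[OF F S eq]]
      C1_on_Re_scaled(1)[OF d(2) S C1_on_Re_scaled(3)[OF F S eq]] by blast
qed

text \<open>The upper bound is attained in the direction \<open>cnj a\<close>, in which
  \<open>a * \<xi>\<close> is real and nonnegative.\<close>

lemma onorm_Re_mult: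
  "onorm (\<lambda>\<xi>. c * complex_of_real (Re (a * \<xi>))) = norm c * norm a"
proof (rule antisym)
  show "onorm (\<lambda>\<xi>. c * complex_of_real (Re (a * \<xi>))) \<le> norm c * norm a"
  proof (rule onorm_le)
    fix \<xi>
    have "\<bar>Re (a * \<xi>)\<bar> \<le> norm a * norm \<xi>" using abs_Re_le_cmod[of "a * \<xi>"] by (simp add: norm_mult)
    then show "norm (c * complex_of_real (Re (a * \<xi>))) \<le> norm c * norm a * norm \<xi>"
      unfolding norm_mult norm_of_real mult.assoc by (rule mult_left_mono) simp
  qed
  have bl: "bounded_linear (\<lambda>\<xi>. c * complex_of_real (Re (a * \<xi>)))"
    by (intro bounded_linear_compose[OF bounded_linear_mult_right] bounded_linear_compose[OF bounded_linear_of_real]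
        bounded_linear_compose[OF bounded_linear_Re] bounded_linear_mult_right)
  show "norm c * norm a \<le> onorm (\<lambda>\<xi>. c * complex_of_real (Re (a * \<xi>)))"
  proof (cases "a = 0")
    case True
    then show ?thesis using onorm_pos_le[OF bl] by simp
  next
    case False
    have "a * cnj a = of_real ((norm a)\<^sup>2)" by (rule complex_norm_square[symmetric])
    then have "norm (c * complex_of_real (Re (a * cnj a))) = norm c * norm a * norm (cnj a)"
      by (simp add: norm_mult power2_eq_square)
    then show ?thesis
      using onorm[OF bl, of "cnj a"] False by (simp add: mult_le_cancel_right)
  qed
qed

text \<open>Each dilation of \<open>F\<close> extends continuously to the closed disc and is
  reproduced by its Poisson integral. Only the real part of \<open>F\<close> is assumed bounded, so
  real parts are taken before the radius tends to \<open>1\<close>; \<open>B\<close> times the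
  Poisson kernel then dominates.\<close>

lemma poisson_integral_radial_limit:
  assumes hol: "F holomorphic_on ball 0 1" and bound: "\<And>z. norm z < 1 \<Longrightarrow> \<bar>Re (F z)\<bar> \<le> B"
    and v: "(\<lambda>t. v (cis t)) \<in> borel_measurable borel"
    and lim: "AE t in lebesgue. (\<lambda>n. Re (F (of_real (1 - 1 / (real n + 2)) * cis t))) \<longlonglongrightarrow> v (cis t)"
    and z: "norm z < 1"
  shows "poisson_integral (\<lambda>\<zeta>. of_real (v \<zeta>)) z = of_real (Re (F z))"
proof -
  define r where "r = (\<lambda>n. 1 - 1 / (real n + 2))"
  have r: "0 \<le> r n" "r n < 1" for n by (auto simp: r_def field_simps)
  have rlim: "r \<longlonglongrightarrow> 1" unfolding r_def by real_asymp
  let ?k = "\<lambda>t. poisson_kernel z (cis t)"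
  have nr: "norm (of_real (r n) * u) < 1" if "norm u \<le> 1" for n and u :: complex
  proof -
    have "r n * norm u \<le> r n" using that r(1)[of n] by (intro mult_left_le)
    then show ?thesis using r[of n] by (simp add: norm_mult)
  qed
  have eq: "F (of_real (r n) * z) = (1 / (2 * pi)) *\<^sub>R (LINT t:{0..2*pi}|lebesgue. ?k t *\<^sub>R F (of_real (r n) * cis t))"
    and int: "set_integrable lebesgue {0..2*pi} (\<lambda>t. ?k t *\<^sub>R F (of_real (r n) * cis t))" for n
  proof -
    have cont: "continuous_on (cball 0 1) (\<lambda>u. F (of_real (r n) * u))"
      by (rule continuous_on_compose2[OF holomorphic_on_imp_continuous_on[OF hol]])
        (use nr in \<open>auto intro!: continuous_intros\<close>)
    have "(\<lambda>u. F (of_real (r n) * u)) holomorphic_on ball 0 1"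
      by (rule holomorphic_on_compose_gen[OF _ hol, unfolded o_def])
        (use nr in \<open>auto intro!: holomorphic_intros\<close>)
    from poisson_integral_holomorphic[OF cont this z]
    show "F (of_real (r n) * z) = (1 / (2 * pi)) *\<^sub>R (LINT t:{0..2*pi}|lebesgue. ?k t *\<^sub>R F (of_real (r n) * cis t))"
      by (simp add: poisson_integral_def)
    have "continuous_on {0..2*pi} (\<lambda>t. F (of_real (r n) * cis t))"
      by (rule continuous_on_compose2[OF cont]) (auto intro!: continuous_intros)
    then show "set_integrable lebesgue {0..2*pi} (\<lambda>t. ?k t *\<^sub>R F (of_real (r n) * cis t))"
      by (intro absolutely_integrable_continuous_real continuous_intros continuous_on_poisson_kernel z)
  qed
  have Reint: "integrable lebesgue (\<lambda>t. indicator {0..2*pi} t * (?k t * Re (F (of_real (r n) * cis t))))" for n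
    using integrable_Re[OF int[of n, unfolded set_integrable_def]] by (simp add: mult.assoc)
  have Req: "Re (F (of_real (r n) * z)) = 1 / (2 * pi) * (LINT t|lebesgue. indicator {0..2*pi} t * (?k t * Re (F (of_real (r n) * cis t))))" for n
  proof -
    have "Re (LINT t:{0..2*pi}|lebesgue. ?k t *\<^sub>R F (of_real (r n) * cis t))
      = (LINT t|lebesgue. Re (indicator {0..2*pi} t *\<^sub>R (?k t *\<^sub>R F (of_real (r n) * cis t))))"
      unfolding set_lebesgue_integral_def
      by (rule integral_Re[symmetric]) (use int[of n] in \<open>simp add: set_integrable_def\<close>)
    then show ?thesis by (subst eq) (simp add: mult.assoc)
  qed
  have ik: "set_integrable lebesgue {0..2*pi} ?k"
    using absolutely_integrable_continuous_real[OF continuous_on_poisson_kernel[OF z]] by blast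
  have mk: "?k \<in> borel_measurable borel"
    by (intro borel_measurable_continuous_onI continuous_on_poisson_kernel z)
  have "(\<lambda>n. LINT t|lebesgue. indicator {0..2*pi} t * (?k t * Re (F (of_real (r n) * cis t))))
    \<longlonglongrightarrow> (LINT t|lebesgue. indicator {0..2*pi} t * (?k t * v (cis t)))"
  proof (rule integral_dominated_convergence)
    show "(\<lambda>t. indicator {0..2*pi} t * (?k t * v (cis t))) \<in> borel_measurable lebesgue"
      using mk v by (intro measurable_completion borel_measurable_times) auto
    show "(\<lambda>t. indicator {0..2*pi} t * (?k t * Re (F (of_real (r n) * cis t)))) \<in> borel_measurable lebesgue" for n
      using Reint[of n] by (rule borel_measurable_integrable)
    show "integrable lebesgue (\<lambda>t. indicator {0..2*pi} t * ?k t * B)"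
      using ik by (simp add: set_integrable_def)
    show "AE t in lebesgue. (\<lambda>n. indicator {0..2*pi} t * (?k t * Re (F (of_real (r n) * cis t))))
      \<longlonglongrightarrow> indicator {0..2*pi} t * (?k t * v (cis t))"
      using lim by eventually_elim (auto simp: r_def intro!: tendsto_intros)
    show "AE t in lebesgue. norm (indicator {0..2*pi} t * (?k t * Re (F (of_real (r n) * cis t))))
      \<le> indicator {0..2*pi} t * ?k t * B" for n
    proof (rule AE_I2)
      fix t
      have "\<bar>Re (F (of_real (r n) * cis t))\<bar> \<le> B" by (intro bound nr) simp
      then show "norm (indicator {0..2*pi} t * (?k t * Re (F (of_real (r n) * cis t)))) \<le> indicator {0..2*pi} t * ?k t * B"
        using poisson_kernel_nonneg[OF z] by (auto simp: indicator_def abs_mult intro!: mult_left_mono)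
    qed
  qed
  then have l1: "(\<lambda>n. Re (F (of_real (r n) * z))) \<longlonglongrightarrow> 1 / (2 * pi) * (LINT t|lebesgue. indicator {0..2*pi} t * (?k t * v (cis t)))"
    unfolding Req by (rule tendsto_mult_left)
  have "(\<lambda>n. of_real (r n) * z) \<longlonglongrightarrow> of_real 1 * z" by (intro tendsto_intros rlim)
  then have "(\<lambda>n. F (of_real (r n) * z)) \<longlonglongrightarrow> F z"
    using continuous_on_tendsto_compose[OF holomorphic_on_imp_continuous_on[OF hol], of _ z sequentially] nr[of z] z
    by (simp add: less_imp_le)
  then have l2: "(\<lambda>n. Re (F (of_real (r n) * z))) \<longlonglongrightarrow> Re (F z)" by (rule tendsto_Re)
  have "Re (F z) = 1 / (2 * pi) * (LINT t|lebesgue. indicator {0..2*pi} t * (?k t * v (cis t)))"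
    by (rule LIMSEQ_unique[OF l2 l1])
  moreover have "(LINT t:{0..2*pi}|lebesgue. ?k t *\<^sub>R complex_of_real (v (cis t)))
    = of_real (LINT t|lebesgue. indicator {0..2*pi} t * (?k t * v (cis t)))"
    unfolding set_lebesgue_integral_def integral_complex_of_real[symmetric]
    by (simp add: scaleR_conv_of_real)
  ultimately show ?thesis by (simp add: poisson_integral_def scaleR_conv_of_real)
qed

lemma poisson_integral_cmult: "poisson_integral (\<lambda>\<zeta>. c * \<psi> \<zeta>) z = c * poisson_integral \<psi> z"
proof -
  have "(LINT t:{0..2*pi}|lebesgue. poisson_kernel z (cis t) *\<^sub>R (c * \<psi> (cis t)))
    = c * (LINT t:{0..2*pi}|lebesgue. poisson_kernel z (cis t) *\<^sub>R \<psi> (cis t))"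
    unfolding set_integral_mult_right[symmetric] mult_scaleR_right ..
  then show ?thesis unfolding poisson_integral_def by (simp only: mult_scaleR_right)
qed

section \<open>Boundary values of Moebius and Cayley maps\<close>

lemma countable_cis_eq: "countable {t. cis t = w}"
proof (cases "\<exists>t0. cis t0 = w")
  case True
  then obtain t0 where t0: "cis t0 = w" by blast
  have "{t. cis t = w} \<subseteq> range (\<lambda>n::int. t0 + 2 * pi * n)"
  proof
    fix t assume "t \<in> {t. cis t = w}"
    then have "cis t = cis t0" using t0 by simp
    then have "sin t = sin t0 \<and> cos t = cos t0" by (metis cis.sel)
    then obtain n where "t = t0 + 2 * pi * real_of_int n" unfolding sin_cos_eq_iff by blast
    then show "t \<in> range (\<lambda>n::int. t0 + 2 * pi * n)" by blast
  qed
  then show ?thesis by (rule countable_subset) simp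
qed simp

lemma norm_Moebius_function_cis:
  assumes "norm a < 1"
  shows "norm (Moebius_function 0 a (cis t)) = 1"
proof -
  have "cis t - a = cis t * (1 - a * cnj (cis t))" by (simp add: algebra_simps cis_cnj cis_mult)
  then have "norm (cis t - a) = norm (1 - cnj a * cis t)"
    by (simp add: norm_mult norm_one_minus_mult_cnj)
  moreover have "1 - cnj a * cis t \<noteq> 0" by (rule one_minus_cnj_mult_nonzero) (use assms in auto)
  ultimately show ?thesis by (simp add: Moebius_function_simple norm_divide)
qed

lemma Arg_imaginary: "y \<noteq> 0 \<Longrightarrow> Arg (\<i> * of_real y) = pi / 2 * sgn y"
  using Arg_eq_Im_Ln[of "\<i> * of_real y"] Arg_times_of_real[of "y" \<i>] Arg_times_of_real[of "- y" "- \<i>"]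
  by (cases "y > 0") (auto simp: sgn_if mult.commute)

text \<open>The Cayley map takes the unit circle to the imaginary axis, with the sign of
  \<open>Im p\<close> preserved; hence the argument has only the boundary values
  \<open>pi / 2\<close> and \<open>- pi / 2\<close> off the points \<open>1\<close> and
  \<open>- 1\<close>.\<close>

lemma cayley_unimodular:
  assumes "norm p = 1" "p \<noteq> 1"
  shows "(1 + p) / (1 - p) = \<i> * of_real (2 * Im p / (norm (1 - p))\<^sup>2)"
proof -
  have n: "p * cnj p = 1" using complex_norm_square[of p] assms by simp
  have "(1 + p) * cnj (1 - p) = p - cnj p" using n by (simp add: algebra_simps)
  also have "\<dots> = \<i> * of_real (2 * Im p)" by (simp add: complex_eq_iff)
  finally have "(1 + p) * cnj (1 - p) / ((1 - p) * cnj (1 - p)) = \<i> * of_real (2 * Im p) / of_real ((norm (1 - p))\<^sup>2)"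
    by (simp only: complex_norm_square)
  moreover have "(1 + p) * cnj (1 - p) / ((1 - p) * cnj (1 - p)) = (1 + p) / (1 - p)"
    using assms(2) by simp
  ultimately show ?thesis by simp
qed

lemma Re_cayley_pos:
  assumes "norm p < 1"
  shows "Re ((1 + p) / (1 - p)) > 0"
proof -
  have "p \<noteq> 1" using assms by auto
  have "(Re p)\<^sup>2 + (Im p)\<^sup>2 < 1" using assms by (simp add: abs_square_less_1 flip: cmod_power2)
  then have "0 < (1 + Re p) * (1 - Re p) - Im p * Im p" by (simp add: algebra_simps power2_eq_square)
  moreover have "0 < (1 - Re p)\<^sup>2 + (Im p)\<^sup>2"
    using \<open>p \<noteq> 1\<close> by (metis complex_eq_iff eq_iff_diff_eq_0 one_complex.sel sum_power2_gt_zero_iff)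
  ultimately show ?thesis by (simp add: Re_divide)
qed

lemma disc_automorphism_Moebius:
  assumes "norm a < 1"
  shows "disc_automorphism (Moebius_function 0 a)"
  unfolding disc_automorphism_def
proof
  show "Moebius_function 0 a holomorphic_on ball 0 1" by (rule Moebius_function_holomorphic[OF assms])
  show "bij_betw (Moebius_function 0 a) (ball 0 1) (ball 0 1)"
    by (rule bij_betw_byWitness[where f' = "Moebius_function 0 (- a)"])
      (use assms in \<open>auto simp: Moebius_function_compose Moebius_function_norm_lt_1\<close>)
qed

text \<open>The automorphism sends \<open>a\<close> to \<open>0\<close>, where the argument is
  \<open>0\<close>: the point lies on the centre line of the strip, where the strip estimate is an
  equality.\<close>

lemma extremal_attains_bound:
  fixes a \<alpha> :: complex and M :: real
  assumes a: "norm a < 1" and M: "M > 0" and \<alpha>: "norm \<alpha> = 1"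
  defines "\<phi> \<equiv> Moebius_function 0 a"
  obtains \<psi> where "bounded_L1_circle \<psi>" "C2_on (ball 0 1) (extremal M \<alpha> \<phi>)"
    "\<And>z. norm z < 1 \<Longrightarrow> extremal M \<alpha> \<phi> z = poisson_integral \<psi> z"
    "disc_norm (poisson_integral \<psi>) = M"
    "jacobian_norm (extremal M \<alpha> \<phi>) a = 4 * M / pi * (1 / (1 - (norm a)\<^sup>2))"
proof -
  \<comment> \<open>Multiplication by \<open>- \<i>\<close> turns the imaginary part of the
    logarithm, that is the argument, into a real part.\<close>
  define F where "F = (\<lambda>z. - \<i> * Ln ((1 + \<phi> z) / (1 - \<phi> z)))"
  define c where "c = complex_of_real (2 * M) * \<alpha> / complex_of_real pi"
  \<comment> \<open>The step function of radial limits; its value \<open>0\<close> from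
    \<open>sgn 0\<close> occurs only where \<open>\<phi>\<close> is \<open>1\<close> or
    \<open>- 1\<close>.\<close>
  define v where "v = (\<lambda>\<zeta>. pi / 2 * sgn (Im (\<phi> \<zeta>)))"
  define \<psi> where "\<psi> = (\<lambda>\<zeta>. c * of_real (v \<zeta>))"
  have \<phi>1: "norm (\<phi> z) < 1" if "norm z < 1" for z
    unfolding \<phi>_def by (rule Moebius_function_norm_lt_1[OF a that])
  have \<phi>hol: "\<phi> holomorphic_on ball 0 1" unfolding \<phi>_def by (rule Moebius_function_holomorphic[OF a])
  have n1: "1 - \<phi> z \<noteq> 0" if "norm z < 1" for z using \<phi>1[OF that] by auto
  have pos: "Re ((1 + \<phi> z) / (1 - \<phi> z)) > 0" if "norm z < 1" for z
    by (rule Re_cayley_pos[OF \<phi>1[OF that]])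
  have Fhol: "F holomorphic_on ball 0 1"
    unfolding F_def
  proof (intro holomorphic_intros \<phi>hol)
    fix z :: complex assume "z \<in> ball 0 1"
    then have z: "norm z < 1" by simp
    show "1 - \<phi> z \<noteq> 0" by (rule n1[OF z])
    show "(1 + \<phi> z) / (1 - \<phi> z) \<notin> \<real>\<^sub>\<le>\<^sub>0" using pos[OF z] by (auto simp: complex_nonpos_Reals_iff)
  qed
  have ReF: "Re (F z) = Arg ((1 + \<phi> z) / (1 - \<phi> z))" if "norm z < 1" for z
    using pos[OF that] by (subst Arg_eq_Im_Ln) (auto simp: F_def)
  have bound: "\<bar>Re (F z)\<bar> \<le> pi / 2" if "norm z < 1" for z
  proof -
    have "(1 + \<phi> z) / (1 - \<phi> z) \<noteq> 0" using pos[OF that] by (metis less_irrefl zero_complex.sel(1))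
    from Re_Ln_pos_lt[OF this] show ?thesis using pos[OF that] by (simp add: F_def)
  qed
  have ext: "extremal M \<alpha> \<phi> z = c * of_real (Re (F z))" if "norm z < 1" for z
    by (simp add: extremal_def c_def ReF[OF that])
  have nc: "norm c * (pi / 2) = M" "norm c = 2 * M / pi"
    using M \<alpha> by (simp_all add: c_def norm_mult norm_divide)
  have meas: "(\<lambda>t. v (cis t)) \<in> borel_measurable borel"
  proof -
    have "1 - cnj a * cis t \<noteq> 0" for t by (rule one_minus_cnj_mult_nonzero) (use a in auto)
    then have "continuous_on UNIV (\<lambda>t. Im (\<phi> (cis t)))"
      unfolding \<phi>_def Moebius_function_simple[abs_def] by (intro continuous_intros) auto
    then have [measurable]: "(\<lambda>t. Im (\<phi> (cis t))) \<in> borel_measurable borel" by (rule borel_measurable_continuous_onI)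
    show ?thesis unfolding v_def sgn_if by measurable
  qed
  have cont\<phi>: "isCont \<phi> (cis t)" for t
  proof -
    have "1 - cnj a * cis t \<noteq> 0" by (rule one_minus_cnj_mult_nonzero) (use a in auto)
    then show ?thesis unfolding \<phi>_def Moebius_function_simple[abs_def] by (intro continuous_intros) auto
  qed
  have lim: "(\<lambda>n. Re (F (of_real (1 - 1 / (real n + 2)) * cis t))) \<longlonglongrightarrow> v (cis t)" if t: "Im (\<phi> (cis t)) \<noteq> 0" for t
  proof -
    let ?p = "\<phi> (cis t)"
    have np: "norm ?p = 1" unfolding \<phi>_def by (rule norm_Moebius_function_cis[OF a])
    have p1: "?p \<noteq> 1" using t by auto
    define y where "y = 2 * Im ?p / (norm (1 - ?p))\<^sup>2"
    have y: "(1 + ?p) / (1 - ?p) = \<i> * of_real y" unfolding y_def by (rule cayley_unimodular[OF np p1])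
    have y0: "y \<noteq> 0" "sgn y = sgn (Im ?p)" using t p1 by (auto simp: y_def sgn_mult sgn_divide)
    have "(\<lambda>n. 1 - 1 / (real n + 2)) \<longlonglongrightarrow> 1" by real_asymp
    then have "(\<lambda>n. of_real (1 - 1 / (real n + 2)) * cis t) \<longlonglongrightarrow> of_real 1 * cis t"
      by (intro tendsto_intros)
    then have "(\<lambda>n. \<phi> (of_real (1 - 1 / (real n + 2)) * cis t)) \<longlonglongrightarrow> ?p"
      using isCont_tendsto_compose[OF cont\<phi>] by simp
    then have "(\<lambda>n. (1 + \<phi> (of_real (1 - 1 / (real n + 2)) * cis t)) / (1 - \<phi> (of_real (1 - 1 / (real n + 2)) * cis t)))
      \<longlonglongrightarrow> (1 + ?p) / (1 - ?p)"
      using p1 by (intro tendsto_intros) auto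
    moreover have "isCont Arg ((1 + ?p) / (1 - ?p))"
      unfolding y by (rule continuous_at_Arg) (use y0 in \<open>auto simp: complex_nonpos_Reals_iff\<close>)
    ultimately have "(\<lambda>n. Arg ((1 + \<phi> (of_real (1 - 1 / (real n + 2)) * cis t)) / (1 - \<phi> (of_real (1 - 1 / (real n + 2)) * cis t))))
      \<longlonglongrightarrow> Arg ((1 + ?p) / (1 - ?p))"
      by (rule isCont_tendsto_compose[rotated])
    moreover have "norm (of_real (1 - 1 / (real n + 2)) * cis t) < 1" for n
      unfolding norm_mult norm_of_real by (simp add: field_simps abs_if)
    ultimately show ?thesis
      using y0 by (simp add: ReF v_def y Arg_imaginary)
  qed
  have "AE t in lebesgue. Im (\<phi> (cis t)) \<noteq> 0"
  proof -
    \<comment> \<open>A unimodular number with zero imaginary part is \<open>1\<close> or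
      \<open>- 1\<close>; the fractions are the preimages of these two values \<open>e\<close> under
      \<open>\<phi>\<close>.\<close>
    have "{t. Im (\<phi> (cis t)) = 0} \<subseteq> (\<Union>e\<in>{1, - 1}. {t. cis t = (e + a) / (1 + e * cnj a)})"
    proof
      fix t assume "t \<in> {t. Im (\<phi> (cis t)) = 0}"
      then have im: "Im (\<phi> (cis t)) = 0" by simp
      moreover have np: "norm (\<phi> (cis t)) = 1" unfolding \<phi>_def by (rule norm_Moebius_function_cis[OF a])
      ultimately have "\<bar>Re (\<phi> (cis t))\<bar> = 1" by (simp add: cmod_eq_Re)
      then have "\<phi> (cis t) \<in> {1, - 1}"
        using im by (auto simp: complex_eq_iff abs_if split: if_splits)
      then obtain e :: complex where e: "e \<in> {1, - 1}" "\<phi> (cis t) = e" by blast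
      have nz: "1 - cnj a * cis t \<noteq> 0" "1 + e * cnj a \<noteq> 0"
        using one_minus_cnj_mult_nonzero[OF a, of "cis t"] one_minus_cnj_mult_nonzero[OF a, of "- e"] e(1)
        by (auto simp: mult.commute)
      have "cis t - a = e * (1 - cnj a * cis t)"
        using e(2) nz(1) by (simp add: \<phi>_def Moebius_function_simple divide_eq_eq)
      then have "cis t * (1 + e * cnj a) = e + a" by (simp add: algebra_simps)
      then have "cis t = (e + a) / (1 + e * cnj a)" using nz(2) by (simp add: eq_divide_eq)
      with e(1) show "t \<in> (\<Union>e\<in>{1, - 1}. {t. cis t = (e + a) / (1 + e * cnj a)})" by blast
    qed
    then have "countable {t. Im (\<phi> (cis t)) = 0}"
      by (rule countable_subset) (auto intro: countable_cis_eq)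
    then have "{t. Im (\<phi> (cis t)) = 0} \<in> null_sets lebesgue"
      using countable_imp_null_set_lborel null_sets_completionI by blast
    from AE_not_in[OF this] show ?thesis by simp
  qed
  then have AElim: "AE t in lebesgue. (\<lambda>n. Re (F (of_real (1 - 1 / (real n + 2)) * cis t))) \<longlonglongrightarrow> v (cis t)"
    by eventually_elim (rule lim)
  have rep: "extremal M \<alpha> \<phi> z = poisson_integral \<psi> z" if "norm z < 1" for z
    unfolding ext[OF that] \<psi>_def poisson_integral_cmult
    by (simp only: poisson_integral_radial_limit[OF Fhol bound meas AElim that])
  have v1: "\<bar>v \<zeta>\<bar> \<le> pi / 2" for \<zeta> by (simp add: v_def abs_mult sgn_if)
  have bL: "bounded_L1_circle \<psi>"
    unfolding bounded_L1_circle_def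
  proof (intro conjI exI AE_I2 impI)
    show n: "norm (\<psi> (cis t)) \<le> M" for t
    proof -
      have "norm c * \<bar>v (cis t)\<bar> \<le> norm c * (pi / 2)" by (intro mult_left_mono v1) simp
      then show ?thesis unfolding \<psi>_def norm_mult norm_of_real nc(1) .
    qed
    have m: "(\<lambda>t. \<psi> (cis t)) \<in> borel_measurable borel"
      unfolding \<psi>_def using meas by (intro borel_measurable_times borel_measurable_of_real) auto
    have "integrable lebesgue (\<lambda>t. indicator {0..2*pi} t *\<^sub>R M)"
      by simp
    then show "set_integrable lebesgue {0..2*pi} (\<lambda>t. \<psi> (cis t))"
      unfolding set_integrable_def
    proof (rule Bochner_Integration.integrable_bound)
      show "(\<lambda>t. indicator {0..2*pi} t *\<^sub>R \<psi> (cis t)) \<in> borel_measurable lebesgue"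
        using m by (intro measurable_completion borel_measurable_scaleR) auto
      show "AE t in lebesgue. norm (indicator {0..2*pi} t *\<^sub>R \<psi> (cis t)) \<le> norm (indicator {0..2*pi} t *\<^sub>R M)"
        using n M by (intro AE_I2) (auto simp: indicator_def)
    qed
  qed
  have jac: "jacobian_norm (extremal M \<alpha> \<phi>) a = 4 * M / pi * (1 / (1 - (norm a)\<^sup>2))"
  proof -
    have "((\<lambda>z. c * of_real (Re (F z))) has_derivative (\<lambda>\<xi>. c * of_real (Re (deriv F a * \<xi>)))) (at a)"
      by (rule has_derivative_Re_scaled[OF Fhol]) (use a in auto)
    then have "(extremal M \<alpha> \<phi> has_derivative (\<lambda>\<xi>. c * of_real (Re (deriv F a * \<xi>)))) (at a)"
      by (rule has_derivative_transform_within_open[of _ _ _ _ "ball 0 1"]) (use a ext in auto)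
    then have "frechet_derivative (extremal M \<alpha> \<phi>) (at a) = (\<lambda>\<xi>. c * of_real (Re (deriv F a * \<xi>)))"
      using frechet_derivative_at by metis
    then have j: "jacobian_norm (extremal M \<alpha> \<phi>) a = norm c * norm (deriv F a)"
      by (simp only: jacobian_norm_def onorm_Re_mult)
    \<comment> \<open>At the zero of \<open>\<phi>\<close> the Cayley map has derivative
      \<open>2\<close>, and \<open>\<phi>\<close> contributes \<open>?d\<close>; together with
      \<open>norm c = 2 * M / pi\<close> this produces \<open>4 * M / pi\<close>.\<close>
    have \<phi>a: "\<phi> a = 0" by (simp add: \<phi>_def Moebius_function_eq_zero)
    let ?d = "1 / complex_of_real (1 - (norm a)\<^sup>2)"
    have D: "(\<phi> has_field_derivative ?d) (at a)"
      using has_field_derivative_Moebius_function[OF a] by (simp add: \<phi>_def)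
    have "((\<lambda>z. (1 + \<phi> z) / (1 - \<phi> z)) has_field_derivative (?d * (1 - \<phi> a) - (1 + \<phi> a) * (- ?d)) / ((1 - \<phi> a) * (1 - \<phi> a))) (at a)"
      by (auto intro!: derivative_eq_intros D simp: \<phi>a)
    then have "((\<lambda>z. (1 + \<phi> z) / (1 - \<phi> z)) has_field_derivative 2 * ?d) (at a)" by (simp add: \<phi>a)
    then have "((\<lambda>z. Ln ((1 + \<phi> z) / (1 - \<phi> z))) has_field_derivative inverse ((1 + \<phi> a) / (1 - \<phi> a)) * (2 * ?d)) (at a)"
      by (rule DERIV_chain2[OF has_field_derivative_Ln, rotated]) (simp add: \<phi>a)
    then have "(F has_field_derivative - \<i> * (2 * ?d)) (at a)"
      unfolding F_def by (intro DERIV_cmult) (simp add: \<phi>a)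
    then have dF: "deriv F a = - \<i> * (2 * ?d)" by (rule DERIV_imp_deriv)
    have nd: "norm ?d = 1 / (1 - (norm a)\<^sup>2)"
      using a unfolding norm_divide norm_of_real by (simp add: power_le_one)
    show ?thesis unfolding j nc(2) dF norm_mult nd by simp
  qed
  have bdd: "bdd_above ((\<lambda>z. norm (poisson_integral \<psi> z)) ` ball 0 1)" by (rule bdd_above_poisson_integral[OF bL])
  have "disc_norm (poisson_integral \<psi>) \<le> M"
    unfolding disc_norm_def
  proof (rule cSUP_least)
    fix z :: complex assume "z \<in> ball 0 1"
    then have z: "norm z < 1" by simp
    have "norm c * \<bar>Re (F z)\<bar> \<le> norm c * (pi / 2)" by (intro mult_left_mono bound z) simp
    then show "norm (poisson_integral \<psi> z) \<le> M"
      unfolding rep[OF z, symmetric] ext[OF z] norm_mult norm_of_real nc(1) .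
  qed simp
  \<comment> \<open>Instead of approaching the boundary, the known Jacobian at \<open>a\<close> is
    compared with the general derivative bound, and the common positive factor is cancelled.\<close>
  moreover have "M \<le> disc_norm (poisson_integral \<psi>)"
  proof -
    obtain D where D: "(poisson_integral \<psi> has_derivative D) (at a)"
      "\<And>\<xi>. norm (D \<xi>) \<le> 4 * disc_norm (poisson_integral \<psi>) / pi * (1 / (1 - (norm a)\<^sup>2)) * norm \<xi>"
      using poisson_integral_derivative_bound[OF bL a] by blast
    have "(extremal M \<alpha> \<phi> has_derivative D) (at a)"
      by (rule has_derivative_transform_within_open[OF D(1), of "ball 0 1"]) (use a rep in auto)
    then have "jacobian_norm (extremal M \<alpha> \<phi>) a = onorm D"
      unfolding jacobian_norm_def using frechet_derivative_at by metis
    also have "\<dots> \<le> 4 * disc_norm (poisson_integral \<psi>) / pi * (1 / (1 - (norm a)\<^sup>2))"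
      by (rule onorm_le[OF D(2)])
    finally have "4 * M / pi * (1 / (1 - (norm a)\<^sup>2)) \<le> 4 * disc_norm (poisson_integral \<psi>) / pi * (1 / (1 - (norm a)\<^sup>2))"
      unfolding jac .
    moreover have "0 < 1 / (1 - (norm a)\<^sup>2)" using a by (simp add: abs_square_less_1)
    ultimately have "4 * M / pi \<le> 4 * disc_norm (poisson_integral \<psi>) / pi" by (rule mult_right_le_imp_le)
    then show ?thesis by (simp add: divide_le_cancel)
  qed
  ultimately have dn: "disc_norm (poisson_integral \<psi>) = M" by simp
  have "C2_on (ball 0 1) (extremal M \<alpha> \<phi>)"
    by (rule C2_on_Re_scaled[OF Fhol open_ball, of _ c]) (simp add: ext)
  with that bL rep dn jac show ?thesis by blast
qed

subsection \<open>The gradient estimate\<close>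

text \<open>The estimate compares points only with \<open>z\<close> itself, so it bounds difference
  quotients at \<open>z\<close>, and the derivative inherits the constant.\<close>

lemma has_derivative_norm_le_of_lipschitz_at:
  fixes f :: "'a::real_normed_vector \<Rightarrow> 'b::real_normed_vector"
  assumes der: "(f has_derivative D) (at z)" and e: "e > 0"
    and lip: "\<And>u. dist u z < e \<Longrightarrow> norm (f u - f z) \<le> L * norm (u - z)"
  shows "norm (D \<xi>) \<le> L * norm \<xi>"
proof (rule field_le_epsilon)
  fix c :: real assume c: "0 < c"
  define k where "k = c / (norm \<xi> + 1)"
  have n: "norm \<xi> + 1 > 0" by (simp add: add_nonneg_pos)
  have k: "k > 0" "k * norm \<xi> \<le> c" using c n by (auto simp: k_def pos_divide_le_eq mult_left_mono)
  obtain d where d: "d > 0" "\<And>y. norm (y - z) < d \<Longrightarrow> norm (f y - f z - D (y - z)) \<le> k * norm (y - z)"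
    using der k(1) unfolding has_derivative_at_alt by blast
  \<comment> \<open>The step stays inside both radii \<open>d\<close> and \<open>e\<close>; adding
    \<open>1\<close> to \<open>norm \<xi>\<close> keeps the denominator positive when
    \<open>\<xi>\<close> is \<open>0\<close>.\<close>
  define t where "t = min d e / 2 / (norm \<xi> + 1)"
  have t: "t > 0" using d e n by (simp add: t_def)
  have "t * norm \<xi> < t * (norm \<xi> + 1)" using t by simp
  also have "\<dots> = min d e / 2"
  proof -
    have "a / 2 / b * b = a / 2" if "b \<noteq> 0" for a b :: real using that by simp
    then show ?thesis using n unfolding t_def by (metis less_irrefl)
  qed
  finally have tn: "norm (z + t *\<^sub>R \<xi> - z) < d" "dist (z + t *\<^sub>R \<xi>) z < e"
    using t d e by (auto simp: dist_norm)
  have "t * norm (D \<xi>) = norm (D (z + t *\<^sub>R \<xi> - z))"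
    using t linear_cmul[OF has_derivative_linear[OF der]] by simp
  also have "\<dots> \<le> norm (f (z + t *\<^sub>R \<xi>) - f z) + norm (f (z + t *\<^sub>R \<xi>) - f z - D (z + t *\<^sub>R \<xi> - z))"
    by norm
  also have "\<dots> \<le> L * norm (z + t *\<^sub>R \<xi> - z) + k * norm (z + t *\<^sub>R \<xi> - z)"
    by (intro add_mono lip d(2) tn)
  also have "\<dots> = t * (L * norm \<xi> + k * norm \<xi>)"
    using t by (simp add: algebra_simps)
  finally have "norm (D \<xi>) \<le> L * norm \<xi> + k * norm \<xi>" using t by simp
  then show "norm (D \<xi>) \<le> L * norm \<xi> + c" using k(2) by linarith
qed

lemma area_factor_nonneg: "0 \<le> r \<Longrightarrow> r < 1 \<Longrightarrow> 0 \<le> area_factor r"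
  using mu_bounds(1)[of r] by (auto simp: area_factor_def)

lemma area_factor_le: "0 \<le> r \<Longrightarrow> r < 1 \<Longrightarrow> area_factor r \<le> 2 / 3"
  using mu_bounds(2)[of r] by (auto simp: area_factor_def)

text \<open>Away from \<open>0\<close> this is continuity of \<open>mu 1\<close>. At
  \<open>0\<close> the value \<open>2 / 3\<close> already bounds \<open>area_factor\<close> on the
  whole disc, so continuity there is bypassed.\<close>

lemma area_factor_eventually_le:
  fixes z :: complex
  assumes z: "norm z < 1" and B: "area_factor (norm z) < B"
  obtains e where "0 < e" "ball z e \<subseteq> ball 0 1" "\<And>u. u \<in> ball z e \<Longrightarrow> area_factor (norm u) \<le> B"
proof -
  have "\<forall>\<^sub>F u in nhds z. norm u < 1 \<and> area_factor (norm u) \<le> B"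
  proof (cases "z = 0")
    case True
    then have "2 / 3 < B" using B by (simp add: area_factor_def)
    then have "area_factor (norm u) \<le> B" if "norm u < 1" for u :: complex
      using area_factor_le[of "norm u"] that by simp
    then show ?thesis
      using eventually_nhds_in_open[of "ball 0 1" z] z by (auto elim!: eventually_mono)
  next
    case False
    then have zp: "0 < norm z" by simp
    have "isCont (mu 1) (norm z)" using mu_has_derivative[OF zp z] by (rule DERIV_isCont)
    then have "((\<lambda>u. 2 * mu 1 (norm u)) \<longlongrightarrow> 2 * mu 1 (norm z)) (nhds z)"
      by (intro tendsto_intros isCont_tendsto_compose[where g = "mu 1"]) (auto intro: tendsto_norm filterlim_ident)
    moreover have "2 * mu 1 (norm z) < B" using B False by (simp add: area_factor_def)
    ultimately have "\<forall>\<^sub>F u in nhds z. 2 * mu 1 (norm u) < B" by (rule order_tendstoD(2))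
    moreover have "\<forall>\<^sub>F u in nhds z. u \<in> ball 0 1 - {0}"
      using z False by (intro eventually_nhds_in_open) auto
    ultimately show ?thesis by eventually_elim (auto simp: area_factor_def)
  qed
  then obtain e where "e > 0" "\<And>u. dist u z < e \<Longrightarrow> norm u < 1 \<and> area_factor (norm u) \<le> B"
    unfolding eventually_nhds_metric by blast
  with that[of e] show ?thesis by (auto simp: dist_commute subset_iff)
qed

text \<open>As the difference of two functions differentiable at \<open>z\<close>, the Green
  potential has the derivative \<open>D - D'\<close> there, and its Lipschitz constants bound that
  derivative. The triangle inequality for \<open>D'\<close> then adds the Poisson and the Green
  contribution.\<close>

lemma jacobian_norm_le:
  assumes g: "continuous_on (cball 0 1) g" and \<psi>: "bounded_L1_circle \<psi>"
    and f: "f differentiable (at z)" and sol: "solves_poisson_dirichlet f g \<psi>" and z: "norm z < 1"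
  shows "jacobian_norm f z \<le> 4 * disc_norm (poisson_integral \<psi>) / pi * (1 / (1 - (norm z)\<^sup>2))
    + disc_norm g * area_factor (norm z)"
proof -
  define A where "A = 4 * disc_norm (poisson_integral \<psi>) / pi * (1 / (1 - (norm z)\<^sup>2))"
  obtain D where D: "(poisson_integral \<psi> has_derivative D) (at z)"
    "\<And>\<xi>. norm (D \<xi>) \<le> A * norm \<xi>"
    unfolding A_def using poisson_integral_derivative_bound[OF \<psi> z] by blast
  define D' where "D' = frechet_derivative f (at z)"
  have D': "(f has_derivative D') (at z)" unfolding D'_def using f by (simp add: frechet_derivative_works)
  have "((\<lambda>u. poisson_integral \<psi> u - f u) has_derivative (\<lambda>\<xi>. D \<xi> - D' \<xi>)) (at z)"
    by (rule has_derivative_diff[OF D(1) D'])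
  then have DG: "(green_potential g has_derivative (\<lambda>\<xi>. D \<xi> - D' \<xi>)) (at z)"
    by (rule has_derivative_transform_within_open[of _ _ _ _ "ball 0 1"])
      (use z sol in \<open>auto simp: solves_poisson_dirichlet_def\<close>)
  have K: "0 \<le> disc_norm g" by (rule disc_norm_nonneg[OF bdd_above_norm_continuous_cball[OF g]])
  have le: "jacobian_norm f z \<le> A + disc_norm g * B" if B: "area_factor (norm z) < B" for B
  proof -
    have B0: "0 \<le> B" using B area_factor_nonneg[of "norm z"] z by simp
    obtain e where e: "0 < e" "ball z e \<subseteq> ball 0 1" "\<And>u. u \<in> ball z e \<Longrightarrow> area_factor (norm u) \<le> B"
      using area_factor_eventually_le[OF z B] by blast
    have lip: "norm (green_potential g u - green_potential g z) \<le> disc_norm g * B * norm (u - z)" if "dist u z < e" for u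
    proof (rule green_potential_lipschitz[OF g z _ _ B0])
      have u: "u \<in> ball z e" using that by (simp add: dist_commute)
      then show "norm u < 1" using e(2) by auto
      have "closed_segment z u \<subseteq> ball z e" using u e(1) by (intro closed_segment_subset) auto
      then show "area_factor (norm w) \<le> B" if "w \<in> closed_segment z u" for w using e(3) that by blast
    qed
    have "norm (D' \<xi>) \<le> (A + disc_norm g * B) * norm \<xi>" for \<xi>
    proof -
      have "norm (D' \<xi>) \<le> norm (D \<xi>) + norm (D \<xi> - D' \<xi>)" by norm
      also have "\<dots> \<le> A * norm \<xi> + disc_norm g * B * norm \<xi>"
        by (intro add_mono D(2) has_derivative_norm_le_of_lipschitz_at[OF DG e(1) lip])
      finally show ?thesis by (simp add: distrib_right)
    qed
    then show ?thesis unfolding jacobian_norm_def D'_def[symmetric] by (rule onorm_le)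
  qed
  \<comment> \<open>The Lipschitz argument works for every \<open>B\<close> strictly above the area
    factor; letting \<open>B\<close> decrease to it gives the sharp value.\<close>
  have "((\<lambda>B. A + disc_norm g * B) \<longlongrightarrow> A + disc_norm g * area_factor (norm z)) (at_right (area_factor (norm z)))"
    by (intro tendsto_intros)
  then have "jacobian_norm f z \<le> A + disc_norm g * area_factor (norm z)"
    by (rule tendsto_lowerbound) (use le in \<open>auto simp: eventually_at_right_less intro: eventually_mono[OF eventually_at_right_less]\<close>)
  then show ?thesis by (simp add: A_def)
qed

theorem theorem3:
  fixes f g \<psi> :: "complex \<Rightarrow> complex"
  assumes "continuous_on (cball 0 1) g"
    and "bounded_L1_circle \<psi>"
    and "C2_on (ball 0 1) f"
    and "solves_poisson_dirichlet f g \<psi>"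
  shows "(\<forall>z\<in>ball 0 1 - {0}.
            jacobian_norm f z \<le>
              4 * disc_norm (poisson_integral \<psi>) / pi * (1 / (1 - (norm z)\<^sup>2))
              + 2 * mu (disc_norm g) (norm z)) \<and>
         (\<forall>x\<in>{0<..<1}. disc_norm g / 4 \<le> mu (disc_norm g) x \<and>
                        mu (disc_norm g) x \<le> disc_norm g / 3) \<and>
         antimono_on {0<..<1} (mu (disc_norm g)) \<and>
         (disc_norm g > 0 \<longrightarrow> strict_antimono_on {0<..<1} (mu (disc_norm g))) \<and>
         ((\<lambda>r. 4 * disc_norm (poisson_integral \<psi>) / pi * (1 / (1 - r\<^sup>2))
               + 2 * mu (disc_norm g) r)
            \<longlongrightarrow> 4 / pi * disc_norm (poisson_integral \<psi>) + 2 / 3 * disc_norm g) (at_right 0) \<and>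
         jacobian_norm f 0 \<le> 4 / pi * disc_norm (poisson_integral \<psi>) + 2 / 3 * disc_norm g \<and>
         (disc_norm g = 0 \<longrightarrow>
            (\<forall>M \<alpha> z\<^sub>0. M > 0 \<and> norm \<alpha> = 1 \<and> z\<^sub>0 \<in> ball 0 1 \<longrightarrow>
               (\<exists>\<phi> \<psi>\<^sub>0. disc_automorphism \<phi> \<and>
                  bounded_L1_circle \<psi>\<^sub>0 \<and>
                  C2_on (ball 0 1) (extremal M \<alpha> \<phi>) \<and>
                  solves_poisson_dirichlet (extremal M \<alpha> \<phi>) g \<psi>\<^sub>0 \<and>
                  jacobian_norm (extremal M \<alpha> \<phi>) z\<^sub>0 =
                    (if z\<^sub>0 = 0
                     then 4 / pi * disc_norm (poisson_integral \<psi>\<^sub>0) + 2 / 3 * disc_norm g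
                     else 4 * disc_norm (poisson_integral \<psi>\<^sub>0) / pi * (1 / (1 - (norm z\<^sub>0)\<^sup>2))
                          + 2 * mu (disc_norm g) (norm z\<^sub>0)))))"
proof (intro conjI)
  let ?K = "disc_norm g" let ?P = "disc_norm (poisson_integral \<psi>)"
  note bdd = bdd_above_norm_continuous_cball[OF assms(1)]
  have K: "0 \<le> ?K" by (rule disc_norm_nonneg[OF bdd])
  have est: "jacobian_norm f z \<le> 4 * ?P / pi * (1 / (1 - (norm z)\<^sup>2)) + ?K * area_factor (norm z)" if "norm z < 1" for z
    using assms(3) that by (intro jacobian_norm_le[OF assms(1,2) _ assms(4)]) (auto simp: C2_on_def C1_on_def)
  show "\<forall>z\<in>ball 0 1 - {0}. jacobian_norm f z \<le> 4 * ?P / pi * (1 / (1 - (norm z)\<^sup>2)) + 2 * mu ?K (norm z)"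
  proof
    fix z :: complex assume "z \<in> ball 0 1 - {0}"
    then show "jacobian_norm f z \<le> 4 * ?P / pi * (1 / (1 - (norm z)\<^sup>2)) + 2 * mu ?K (norm z)"
      using est[of z] mu_scale[of ?K "norm z"] by (simp add: area_factor_def)
  qed
  show "jacobian_norm f 0 \<le> 4 / pi * ?P + 2 / 3 * ?K"
    using est[of 0] by (simp add: area_factor_def mult.commute)
  show "\<forall>x\<in>{0<..<1}. ?K / 4 \<le> mu ?K x \<and> mu ?K x \<le> ?K / 3"
  proof
    fix x :: real assume "x \<in> {0<..<1}"
    then show "?K / 4 \<le> mu ?K x \<and> mu ?K x \<le> ?K / 3"
      using mult_left_mono[OF mu_bounds(1) K, of x] mult_left_mono[OF mu_bounds(2) K, of x] mu_scale[of ?K x] by simp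
  qed
  have strict: "mu ?K y < mu ?K x" if "?K > 0" "0 < x" "x < y" "y < 1" for x y
    using mult_strict_left_mono[OF mu_strict_antimono[OF that(2-4)] that(1)] mu_scale[of ?K] by simp
  then show "?K > 0 \<longrightarrow> strict_antimono_on {0<..<1} (mu ?K)"
    by (auto simp: monotone_on_def)
  \<comment> \<open>For a zero norm of \<open>g\<close> the function is identically
    \<open>0\<close>, so only weak monotonicity holds in general.\<close>
  show "antimono_on {0<..<1} (mu ?K)"
  proof (rule monotone_onI)
    fix x y :: real assume "x \<in> {0<..<1}" "y \<in> {0<..<1}" "x \<le> y"
    then show "mu ?K y \<le> mu ?K x"
      using strict[of x y] K mu_scale[of ?K x] mu_scale[of ?K y] by (cases "?K = 0"; cases "x = y") auto
  qed
  show "((\<lambda>r. 4 * ?P / pi * (1 / (1 - r\<^sup>2)) + 2 * mu ?K r) \<longlongrightarrow> 4 / pi * ?P + 2 / 3 * ?K) (at_right 0)"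
  proof -
    have "((\<lambda>r. 4 * ?P / pi * (1 / (1 - r\<^sup>2)) + 2 * (?K * mu 1 r)) \<longlongrightarrow>
      4 * ?P / pi * (1 / (1 - 0\<^sup>2)) + 2 * (?K * (1 / 3))) (at_right 0)"
      by (intro tendsto_intros mu_tendsto_0) auto
    then show ?thesis by (subst mu_scale) (simp add: mult.commute)
  qed
  show "?K = 0 \<longrightarrow>
            (\<forall>M \<alpha> z\<^sub>0. M > 0 \<and> norm \<alpha> = 1 \<and> z\<^sub>0 \<in> ball 0 1 \<longrightarrow>
               (\<exists>\<phi> \<psi>\<^sub>0. disc_automorphism \<phi> \<and>
                  bounded_L1_circle \<psi>\<^sub>0 \<and>
                  C2_on (ball 0 1) (extremal M \<alpha> \<phi>) \<and>
                  solves_poisson_dirichlet (extremal M \<alpha> \<phi>) g \<psi>\<^sub>0 \<and>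
                  jacobian_norm (extremal M \<alpha> \<phi>) z\<^sub>0 =
                    (if z\<^sub>0 = 0
                     then 4 / pi * disc_norm (poisson_integral \<psi>\<^sub>0) + 2 / 3 * ?K
                     else 4 * disc_norm (poisson_integral \<psi>\<^sub>0) / pi * (1 / (1 - (norm z\<^sub>0)\<^sup>2))
                          + 2 * mu ?K (norm z\<^sub>0))))"
  proof (intro impI allI)
    fix M :: real and \<alpha> z\<^sub>0 :: complex
    assume K0: "?K = 0" and "M > 0 \<and> norm \<alpha> = 1 \<and> z\<^sub>0 \<in> ball 0 1"
    then have M: "M > 0" "norm \<alpha> = 1" and z0: "norm z\<^sub>0 < 1" by auto
    have "g w = 0" if "norm w < 1" for w using norm_le_disc_norm[OF bdd that] K0 by simp
    then have "(LINT w:ball 0 1|lebesgue. green z w *\<^sub>R g w) = 0" for z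
      unfolding set_lebesgue_integral_def by (intro integral_eq_zero_AE AE_I2) (auto simp: indicator_def)
    then have G: "green_potential g z = 0" for z by (simp add: green_potential_def)
    \<comment> \<open>The automorphism is chosen to vanish at the point where equality is
      wanted.\<close>
    obtain \<psi>\<^sub>0 where p: "bounded_L1_circle \<psi>\<^sub>0" "C2_on (ball 0 1) (extremal M \<alpha> (Moebius_function 0 z\<^sub>0))"
      "\<And>z. norm z < 1 \<Longrightarrow> extremal M \<alpha> (Moebius_function 0 z\<^sub>0) z = poisson_integral \<psi>\<^sub>0 z"
      "disc_norm (poisson_integral \<psi>\<^sub>0) = M"
      "jacobian_norm (extremal M \<alpha> (Moebius_function 0 z\<^sub>0)) z\<^sub>0 = 4 * M / pi * (1 / (1 - (norm z\<^sub>0)\<^sup>2))"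
      using extremal_attains_bound[OF z0 M] by blast
    have "solves_poisson_dirichlet (extremal M \<alpha> (Moebius_function 0 z\<^sub>0)) g \<psi>\<^sub>0"
      by (simp add: solves_poisson_dirichlet_def G p(3))
    moreover have "mu 0 x = 0" for x by (simp add: mu_def)
    ultimately show "\<exists>\<phi> \<psi>\<^sub>0. disc_automorphism \<phi> \<and>
                  bounded_L1_circle \<psi>\<^sub>0 \<and>
                  C2_on (ball 0 1) (extremal M \<alpha> \<phi>) \<and>
                  solves_poisson_dirichlet (extremal M \<alpha> \<phi>) g \<psi>\<^sub>0 \<and>
                  jacobian_norm (extremal M \<alpha> \<phi>) z\<^sub>0 =
                    (if z\<^sub>0 = 0
                     then 4 / pi * disc_norm (poisson_integral \<psi>\<^sub>0) + 2 / 3 * ?K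
                     else 4 * disc_norm (poisson_integral \<psi>\<^sub>0) / pi * (1 / (1 - (norm z\<^sub>0)\<^sup>2))
                          + 2 * mu ?K (norm z\<^sub>0))"
      using p disc_automorphism_Moebius[OF z0] K0
      by (intro exI[of _ "Moebius_function 0 z\<^sub>0"] exI[of _ \<psi>\<^sub>0]) (auto simp: mult.commute)
  qed
qed

end
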